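(* Let $P_{YX}$ be a distribution on $\mathcal Y\times\mathcal X$ and let $(Q_{Y^n})_n$, $(Q_{X^n})_n$ be sequences of distributions on $\mathcal Y^n$, $\mathcal X^n$ satisfying (A) or (B) of the context. Then in testing $P_{YX}^{\otimes n}$ against $Q_{Y^n}\times Q_{X^n}$ using one-sided compression of the sequence $x^n$ at rate $R_c\ge0$, the maximum $\epsilon$-achievable error exponent is $$E^\star_\epsilon(R_c)=\max_{P_{U|X}:\,I(U;X)\le R_c}I(Y;U)+d^{\mathrm{yx}},\qquad\forall\,\epsilon\in[0,1),$$ where $(Y,X)\sim P_{YX}$, $U$ takes values in a finite alphabet and $Y-X-U$ is a Markov chain, and where $d^{\mathrm{yx}}=D(P_X\Vert Q_X)+D(P_Y\Vert Q_Y)$ in case (A) and $d^{\mathrm{yx}}=A_X+A_Y$ in case (B).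
   Context: All alphabets are finite; $\log$ is natural; $P^{\otimes n}$ is the $n$-fold product; $D$ is relative entropy; $I$ is mutual information; $P_X,P_Y$ are the marginals of $P_{YX}$. Assumption on $(Q_{Y^n}),(Q_{X^n})$: one of (A) $Q_{X^n}=Q_X^{\otimes n}$, $Q_{Y^n}=Q_Y^{\otimes n}$, with $D(P_X\Vert Q_X)<\infty$ and $D(P_Y\Vert Q_Y)<\infty$; (B) $(Q_{X^n})_n$ and $(Q_{Y^n})_n$ are the $n$-dimensional marginals of Markov processes of finite order with stationary (time-invariant) transition probabilities, $P_X^{\otimes n}\ll Q_{X^n}$ and $P_Y^{\otimes n}\ll Q_{Y^n}$ for all $n$, and the limits (which exist) $A_X=\lim_n[D(P_X^{\otimes(n+1)}\Vert Q_{X^{n+1}})-D(P_X^{\otimes n}\Vert Q_{X^n})]$, $A_Y=\lim_n[D(P_Y^{\otimes(n+1)}\Vert Q_{Y^{n+1}})-D(P_Y^{\otimes n}\Vert Q_{Y^n})]$ are finite. A testing scheme is a pair $(\phi_n,\psi_n)$ with $\phi_n:\mathcal X^n\to\mathcal M$ ($\mathcal M=\mathcal M_n$ finite, $|\phi_n|:=|\mathcal M|$) and a possibly randomized $\psi_n:\mathcal Y^n\times\mathcal M\to\{0,1\}$ (output $0$ means deciding the null hypothesis $P_{YX}^{\otimes n}$). $\alpha_n$ is the probability that $\psi_n(Y^n,\phi_n(X^n))=1$ when $(Y^n,X^n)\sim P_{YX}^{\otimes n}$; $\beta_n$ is the probability that $\psi_n(Y^n,\phi_n(X^n))=0$ when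 $(Y^n,X^n)\sim Q_{Y^n}\times Q_{X^n}$. For $\epsilon\in[0,1)$, $E$ is $\epsilon$-achievable at rate $R_c$ if there is a sequence of testing schemes with $\limsup_n\alpha_n\le\epsilon$, $\liminf_n\frac1n\log\frac1{\beta_n}\ge E$, $\limsup_n\frac1n\log|\phi_n|\le R_c$; $E^\star_\epsilon(R_c)$ is the supremum of $\epsilon$-achievable $E$. *)

theory Defs
  imports "HOL-Probability.Probability"
begin

text \<open>Sequences of length \<open>n\<close> are lists, and \<open>P\<close> to the \<open>n\<close>-fold product is
  \<^term>\<open>replicate_pmf n P\<close>. All information quantities are in nats.\<close>

text \<open>\<^const>\<open>KL_divergence\<close> is real-valued and takes the reference measure first; the value
  \<open>\<infinity>\<close> has to be added by hand. Used only for finitely supported \<open>P\<close>, for which the integral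
  in \<^const>\<open>KL_divergence\<close> always exists.\<close>

definition rel_entropy :: "'a pmf \<Rightarrow> 'a pmf \<Rightarrow> ereal" where
  "rel_entropy P Q =
     (if absolutely_continuous (measure_pmf Q) (measure_pmf P)
      then ereal (KL_divergence (exp 1) (measure_pmf Q) (measure_pmf P)) else \<infinity>)"

definition mutual_info :: "'c pmf \<Rightarrow> ('c \<Rightarrow> 'a) \<Rightarrow> ('c \<Rightarrow> 'b) \<Rightarrow> real" where
  "mutual_info J V W =
     prob_space.mutual_information (measure_pmf J) (exp 1)
       (count_space UNIV) (count_space UNIV) V W"

text \<open>The law of \<open>(Y, X, U)\<close> when \<open>(Y, X)\<close> has law \<open>P\<close> and \<open>U\<close> is drawn from \<open>W x\<close> given
  \<open>(Y, X) = (y, x)\<close>; this is what \<open>Y - X - U\<close> being a Markov chain means.\<close>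

definition joint_YXU :: "('y \<times> 'x) pmf \<Rightarrow> ('x \<Rightarrow> 'u pmf) \<Rightarrow> ('y \<times> 'x \<times> 'u) pmf" where
  "joint_YXU P W = bind_pmf P (\<lambda>(y, x). map_pmf (\<lambda>u. (y, x, u)) (W x))"

definition info_UX :: "('y \<times> 'x) pmf \<Rightarrow> ('x \<Rightarrow> 'u pmf) \<Rightarrow> real" where
  "info_UX P W = mutual_info (joint_YXU P W) (\<lambda>(y, x, u). u) (\<lambda>(y, x, u). x)"

definition info_YU :: "('y \<times> 'x) pmf \<Rightarrow> ('x \<Rightarrow> 'u pmf) \<Rightarrow> real" where
  "info_YU P W = mutual_info (joint_YXU P W) (\<lambda>(y, x, u). y) (\<lambda>(y, x, u). u)"

text \<open>Finite alphabets for \<open>U\<close> of every size are covered by channels into \<^typ>\<open>nat\<close> with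
  finite support.\<close>

definition feasible_channel :: "('y \<times> 'x) pmf \<Rightarrow> real \<Rightarrow> ('x \<Rightarrow> nat pmf) \<Rightarrow> bool" where
  "feasible_channel P R W \<longleftrightarrow> (\<forall>x. finite (set_pmf (W x))) \<and> info_UX P W \<le> R"

text \<open>The initial law on the first \<open>k\<close> symbols is arbitrary, and \<open>k = 0\<close> is the i.i.d. case. The
  product form avoids conditioning on null events.\<close>

definition markov_process_law :: "nat \<Rightarrow> 'a stream measure \<Rightarrow> bool" where
  "markov_process_law k L \<longleftrightarrow>
     prob_space L \<and> sets L = sets (stream_space (count_space UNIV)) \<and>
     (\<exists>T :: 'a list \<Rightarrow> 'a pmf. \<forall>n\<ge>k. \<forall>xs a. length xs = n \<longrightarrow>
        measure L {\<omega> \<in> space L. stake (Suc n) \<omega> = xs @ [a]} =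
        measure L {\<omega> \<in> space L. stake n \<omega> = xs} * pmf (T (drop (n - k) xs)) a)"

definition finite_order_markov_marginals :: "(nat \<Rightarrow> 'a list pmf) \<Rightarrow> bool" where
  "finite_order_markov_marginals Q \<longleftrightarrow>
     (\<exists>k L. markov_process_law k L \<and>
        (\<forall>n. measure_pmf (Q n) = distr L (count_space UNIV) (stake n)))"

definition rel_entropy_increment :: "'a pmf \<Rightarrow> (nat \<Rightarrow> 'a list pmf) \<Rightarrow> nat \<Rightarrow> ereal" where
  "rel_entropy_increment P Q n =
     rel_entropy (replicate_pmf (Suc n) P) (Q (Suc n)) - rel_entropy (replicate_pmf n P) (Q n)"

definition product_alternative ::
  "('y \<times> 'x) pmf \<Rightarrow> (nat \<Rightarrow> 'y list pmf) \<Rightarrow> (nat \<Rightarrow> 'x list pmf) \<Rightarrow> ereal \<Rightarrow> bool" where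
  "product_alternative P QYs QXs d \<longleftrightarrow>
     (let PX = map_pmf snd P; PY = map_pmf fst P in
      \<exists>QX QY. (\<forall>n. QXs n = replicate_pmf n QX) \<and> (\<forall>n. QYs n = replicate_pmf n QY) \<and>
        rel_entropy PX QX < \<infinity> \<and> rel_entropy PY QY < \<infinity> \<and>
        d = rel_entropy PX QX + rel_entropy PY QY)"

text \<open>The existence of the two limits is not assumed: by absolute continuity and the Markov
  property the increments are finite and eventually constant.\<close>

definition markov_alternative ::
  "('y \<times> 'x) pmf \<Rightarrow> (nat \<Rightarrow> 'y list pmf) \<Rightarrow> (nat \<Rightarrow> 'x list pmf) \<Rightarrow> ereal \<Rightarrow> bool" where
  "markov_alternative P QYs QXs d \<longleftrightarrow>
     (let PX = map_pmf snd P; PY = map_pmf fst P;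
          AX = lim (rel_entropy_increment PX QXs); AY = lim (rel_entropy_increment PY QYs) in
      finite_order_markov_marginals QXs \<and> finite_order_markov_marginals QYs \<and>
      (\<forall>n. absolutely_continuous (measure_pmf (QXs n)) (measure_pmf (replicate_pmf n PX))) \<and>
      (\<forall>n. absolutely_continuous (measure_pmf (QYs n)) (measure_pmf (replicate_pmf n PY))) \<and>
      \<bar>AX\<bar> \<noteq> \<infinity> \<and> \<bar>AY\<bar> \<noteq> \<infinity> \<and> d = AX + AY)"

text \<open>The randomized decision is \<^const>\<open>True\<close> for output 1 (reject the null hypothesis) and
  \<^const>\<open>False\<close> for output 0. Since only the cardinality of the message set matters, message
  sets are finite sets of natural numbers.\<close>

record ('y, 'x) test_scheme =
  messages :: "nat set"
  encoder :: "'x list \<Rightarrow> nat"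
  decider :: "'y list \<Rightarrow> nat \<Rightarrow> bool pmf"

definition is_test_scheme :: "nat \<Rightarrow> ('y, 'x) test_scheme \<Rightarrow> bool" where
  "is_test_scheme n s \<longleftrightarrow>
     finite (messages s) \<and> encoder s \<in> {xs. length xs = n} \<rightarrow> messages s"

definition type1_error :: "('y \<times> 'x) pmf \<Rightarrow> nat \<Rightarrow> ('y, 'x) test_scheme \<Rightarrow> real" where
  "type1_error P n s =
     pmf (bind_pmf (replicate_pmf n P)
       (\<lambda>yxs. decider s (map fst yxs) (encoder s (map snd yxs)))) True"

definition type2_error ::
  "'y list pmf \<Rightarrow> 'x list pmf \<Rightarrow> ('y, 'x) test_scheme \<Rightarrow> real" where
  "type2_error QYn QXn s =
     pmf (bind_pmf (pair_pmf QYn QXn) (\<lambda>(ys, xs). decider s ys (encoder s xs))) False"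

text \<open>The exponent of a vanishing error probability is \<open>\<infinity>\<close>, whereas \<^term>\<open>ln (1 / 0 :: real)\<close>
  is \<open>0\<close> in the library.\<close>

definition error_exponent :: "nat \<Rightarrow> real \<Rightarrow> ereal" where
  "error_exponent n \<beta> = (if \<beta> = 0 then \<infinity> else ereal (1 / real n * ln (1 / \<beta>)))"

definition achievable ::
  "('y \<times> 'x) pmf \<Rightarrow> (nat \<Rightarrow> 'y list pmf) \<Rightarrow> (nat \<Rightarrow> 'x list pmf) \<Rightarrow> real \<Rightarrow> real \<Rightarrow> real \<Rightarrow> bool"
where
  "achievable P QYs QXs \<epsilon> R E \<longleftrightarrow>
     (\<exists>s :: nat \<Rightarrow> ('y, 'x) test_scheme.
        (\<forall>n. is_test_scheme n (s n)) \<and>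
        limsup (\<lambda>n. ereal (type1_error P n (s n))) \<le> ereal \<epsilon> \<and>
        liminf (\<lambda>n. error_exponent n (type2_error (QYs n) (QXs n) (s n))) \<ge> ereal E \<and>
        limsup (\<lambda>n. ereal (1 / real n * ln (real (card (messages (s n)))))) \<le> ereal R)"

definition max_exponent ::
  "('y \<times> 'x) pmf \<Rightarrow> (nat \<Rightarrow> 'y list pmf) \<Rightarrow> (nat \<Rightarrow> 'x list pmf) \<Rightarrow> real \<Rightarrow> real \<Rightarrow> ereal" where
  "max_exponent P QYs QXs \<epsilon> R = Sup {ereal E | E. achievable P QYs QXs \<epsilon> R E}"

end

theory Submission
  imports Defs
begin

text \<open>A test channel from \<open>X\<close> to \<open>U\<close> splits \<open>P\<close> into a mixture of laws \<open>r\<close> on pairs \<open>(y, x)\<close>. The points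
  \<open>(r, H(r), H(r\<^sub>X), H(r\<^sub>Y))\<close> form a compact set, so its convex hull is compact, and feasible channels
  correspond to the points of the hull over \<open>P\<close> cut out by linear conditions; hence the maximum is
  attained.

  Converse: condition \<open>P\<close> to the power \<open>n\<close> on the acceptance region, which costs only a constant in
  relative entropy even when the first error is close to 1. Under the conditioned law the chain rule,
  with the message and the past pairs as auxiliary variable, gives a point of the hull satisfying the
  defining conditions up to \<open>O(1/n)\<close>; compactness then yields a point satisfying them exactly.

  Achievability: choose a covering code for the channel and accept when the information density of
  the codeword and \<open>y\<close> is large. In both directions the alternative is replaced by the product of the marginals
  of \<open>P\<close>, because the logarithm of their likelihood ratio concentrates (it has bounded differences) around a
  linear function of \<open>n\<close> with slope the relative entropy increment.\<close>

section \<open>Expectation and entropy of finitely supported distributions\<close>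

text \<open>The condition that Y - X - U be Markov is lost when P is conditioned on an acceptance
  region, and it is not convex in the joint law. Written as H(Y|X) \<le> H(Y,X|U) - H(X|U) it
  becomes affine in the hull coordinates, because conditional entropies are averages over U, and it
  survives with a small slack; hence h, hX and hY are carried as separate coordinates. Under this
  inequality I(U;X) = I(U;Y,X) = H(P) - h, so the rate is affine as well. The conditioned block law
  satisfies these conditions with cross entropies against P in place of entropies, up to -ln a / n,
  where a is the acceptance probability; so any a bounded away from 0 will do and \<epsilon>
  disappears. Closeness of the letter average v to P, D(v || P) \<le> -ln a / n, is recorded too: in
  the limit it forces v = P, and cross entropies turn back into entropies. In the direct part the
  rate is a limsup with the exact bound R, so the code may not waste a fixed amount of rate: its
  excess has to vanish with n while the first error still tends to 0.\<close>

abbreviation expect :: "'a pmf \<Rightarrow> ('a \<Rightarrow> real) \<Rightarrow> real" where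
  "expect p f \<equiv> measure_pmf.expectation p f"

lemma expect_sum:
  assumes "finite A" "set_pmf p \<subseteq> A"
  shows "expect p f = (\<Sum>a\<in>A. pmf p a * f a)"
  using assms by (subst integral_measure_pmf[of A]) auto

lemma expect_cong:
  assumes "\<And>x. x \<in> set_pmf p \<Longrightarrow> f x = g x"
  shows "expect p f = expect p g"
  by (rule integral_cong_AE) (auto simp: AE_measure_pmf_iff assms)

lemma expect_mono:
  assumes "finite (set_pmf p)" "\<And>x. x \<in> set_pmf p \<Longrightarrow> f x \<le> g x"
  shows "expect p f \<le> expect p g"
  by (rule integral_mono_AE) (auto simp: AE_measure_pmf_iff assms intro!: integrable_measure_pmf_finite)

lemma expect_add:
  assumes "finite (set_pmf p)"
  shows "expect p (\<lambda>x. f x + g x) = expect p f + expect p g"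
  using assms by (intro Bochner_Integration.integral_add integrable_measure_pmf_finite)

lemma expect_diff:
  assumes "finite (set_pmf p)"
  shows "expect p (\<lambda>x. f x - g x) = expect p f - expect p g"
  using assms by (intro Bochner_Integration.integral_diff integrable_measure_pmf_finite)

lemma expect_const [simp]: "expect p (\<lambda>_. c) = c"
  by simp

lemma expect_bind:
  assumes "finite (set_pmf p)" "\<And>x. x \<in> set_pmf p \<Longrightarrow> finite (set_pmf (r x))"
  shows "expect (bind_pmf p r) f = expect p (\<lambda>x. expect (r x) f)"
proof -
  have "expect (bind_pmf p r) f = (\<Sum>a\<in>set_pmf p. pmf p a *\<^sub>R expect (r a) f)"
    using assms by (intro pmf_expectation_bind) auto
  also have "\<dots> = expect p (\<lambda>x. expect (r x) f)"
    using assms by (subst expect_sum[of "set_pmf p"]) auto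
  finally show ?thesis .
qed

text \<open>Disintegration along \<phi>. Only labels of positive probability are drawn, so the
  unspecified value of \<open>cond_pmf\<close> on a null fibre never enters.\<close>

lemma bind_cond_pmf_fibre:
  "bind_pmf (map_pmf \<phi> p) (\<lambda>m. cond_pmf p {a. \<phi> a = m}) = p"
proof -
  have "measure (measure_pmf (map_pmf \<phi> p)) {m. \<phi> a = m} = measure (measure_pmf p) {b. \<phi> b = \<phi> a}" for a
    by (simp add: measure_map_pmf vimage_def eq_commute)
  then have "bind_pmf (map_pmf \<phi> p) (\<lambda>m. cond_pmf p {a. (\<lambda>m a. \<phi> a = m) m a}) = p"
    by (intro bind_cond_pmf_cancel) (auto simp: eq_commute)
  then show ?thesis by simp
qed

lemma set_cond_pmf_fibre:
  assumes "m \<in> set_pmf (map_pmf \<phi> p)"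
  shows "set_pmf (cond_pmf p {a. \<phi> a = m}) = set_pmf p \<inter> {a. \<phi> a = m}"
  using assms by (intro set_cond_pmf) auto

section \<open>Entropy: Gibbs' inequality and chain rules\<close>

definition pmf_entropy :: "'a pmf \<Rightarrow> real" where
  "pmf_entropy p = expect p (\<lambda>x. - ln (pmf p x))"

lemma pmf_entropy_return [simp]: "pmf_entropy (return_pmf a) = 0"
  by (simp add: pmf_entropy_def)

text \<open>Termwise t - 1 - ln t \<ge> 0 with t = q x / p x. The weights \<open>q\<close> are
  allowed to sum to less than 1: below they are conditional probabilities written as quotients,
  uniform weights, or masses divided by the probability of an event.\<close>

lemma
  assumes fin: "finite (set_pmf p)"
    and pos: "\<And>x. x \<in> set_pmf p \<Longrightarrow> 0 < q x"
    and le1: "sum q (set_pmf p) \<le> 1"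
  shows gibbs_inequality: "pmf_entropy p \<le> expect p (\<lambda>x. - ln (q x))"
    and gibbs_equality: "expect p (\<lambda>x. - ln (q x)) \<le> pmf_entropy p \<Longrightarrow> x \<in> set_pmf p \<Longrightarrow> pmf p x = q x"
proof -
  \<comment> \<open>This is p x * (t - 1 - ln t) for t = q x / p x. Its sum is the relative entropy
    plus (sum of q) - 1, and a vanishing sum makes every t equal to 1.\<close>
  let ?g = "\<lambda>x. q x - pmf p x - pmf p x * (ln (q x) - ln (pmf p x))"
  have ln_eq: "pmf p x * (ln (q x) - ln (pmf p x)) = pmf p x * ln (q x / pmf p x)"
    and gap: "?g x = pmf p x * (q x / pmf p x - 1 - ln (q x / pmf p x))"
    and quot: "0 < q x / pmf p x" if "x \<in> set_pmf p" for x
    using pos[OF that] pmf_positive[OF that] by (auto simp: ln_div field_simps)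
  have g0: "?g x \<ge> 0" if "x \<in> set_pmf p" for x
    using gap[OF that] ln_le_minus_one[OF quot[OF that]] by simp
  have "sum ?g (set_pmf p) = sum q (set_pmf p) - 1 - (\<Sum>x\<in>set_pmf p. pmf p x * (ln (q x) - ln (pmf p x)))"
    using fin by (simp add: sum_subtractf sum_pmf_eq_1)
  also have "(\<Sum>x\<in>set_pmf p. pmf p x * (ln (q x) - ln (pmf p x)))
      = pmf_entropy p - expect p (\<lambda>x. - ln (q x))"
    unfolding pmf_entropy_def using fin
    by (simp add: expect_sum[of "set_pmf p"] right_diff_distrib sum_subtractf sum_negf)
  finally have s: "sum ?g (set_pmf p) = sum q (set_pmf p) - 1 - (pmf_entropy p - expect p (\<lambda>x. - ln (q x)))" .
  have "sum ?g (set_pmf p) \<ge> 0" by (intro sum_nonneg g0)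
  then show "pmf_entropy p \<le> expect p (\<lambda>x. - ln (q x))" using s le1 by simp
  assume "expect p (\<lambda>x. - ln (q x)) \<le> pmf_entropy p" and x: "x \<in> set_pmf p"
  then have "sum ?g (set_pmf p) \<le> 0" using s le1 by simp
  then have "sum ?g (set_pmf p) = 0" using \<open>sum ?g (set_pmf p) \<ge> 0\<close> by simp
  then have "?g x = 0" using x fin g0 by (subst (asm) sum_nonneg_eq_0_iff) auto
  then have "ln (q x / pmf p x) = q x / pmf p x - 1"
    using gap[OF x] pmf_positive[OF x] by simp
  then have "q x / pmf p x = 1" using quot[OF x] by (intro ln_eq_minus_one)
  then show "pmf p x = q x" using pmf_positive[OF x] by (simp add: field_simps)
qed

lemma sum_pmf_le_one:
  assumes "finite A"
  shows "sum (pmf p) A \<le> 1"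
  using measure_pmf.prob_le_1[of p A] by (simp only: measure_measure_pmf_finite[OF assms])

lemma gibbs_pmf:
  assumes "finite (set_pmf p)" "set_pmf p \<subseteq> set_pmf q"
  shows "pmf_entropy p \<le> expect p (\<lambda>x. - ln (pmf q x))"
  by (rule gibbs_inequality) (use assms sum_pmf_le_one[OF assms(1)] in \<open>auto intro!: pmf_positive\<close>)

lemma gibbs_pmf_eq:
  assumes "finite (set_pmf p)" "set_pmf p \<subseteq> set_pmf q"
    and "expect p (\<lambda>x. - ln (pmf q x)) \<le> pmf_entropy p"
  shows "p = q"
proof -
  have eq: "pmf p x = pmf q x" if "x \<in> set_pmf p" for x
    by (rule gibbs_equality[OF assms(1) _ sum_pmf_le_one[OF assms(1)] assms(3) that])
      (use assms in \<open>auto intro!: pmf_positive\<close>)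
  \<comment> \<open>Agreement on the support of p already gives q mass 1 there, so q has no further
    atoms.\<close>
  have "measure q (set_pmf p) = sum (pmf q) (set_pmf p)"
    using assms by (simp add: measure_measure_pmf_finite)
  also have "\<dots> = 1" using eq assms(1) sum_pmf_eq_1[of "set_pmf p" p] by simp
  finally have "AE x in q. x \<in> set_pmf p" by (simp add: measure_pmf.prob_eq_1)
  then have "set_pmf q \<subseteq> set_pmf p" by (auto simp: AE_measure_pmf_iff)
  then show ?thesis using eq assms(2) by (intro pmf_eqI) (metis pmf_eq_0_set_pmf subsetD)
qed

lemma pmf_entropy_map:
  "pmf_entropy (map_pmf f p) = expect p (\<lambda>x. - ln (pmf (map_pmf f p) (f x)))"
  by (simp add: pmf_entropy_def)

lemma pmf_entropy_map_inj:
  assumes "inj_on f (set_pmf p)"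
  shows "pmf_entropy (map_pmf f p) = pmf_entropy p"
  unfolding pmf_entropy_map unfolding pmf_entropy_def
  by (rule expect_cong) (simp add: pmf_map_inj[OF assms])

text \<open>The branches \<open>r m\<close> have disjoint supports, told apart by the label \<phi>,
  so a single term of the mixture survives.\<close>

lemma pmf_bind_disjoint:
  assumes "\<And>m b. m \<in> set_pmf q \<Longrightarrow> b \<in> set_pmf (r m) \<Longrightarrow> \<phi> b = m"
    and "\<phi> a \<in> set_pmf q"
  shows "pmf (bind_pmf q r) a = pmf q (\<phi> a) * pmf (r (\<phi> a)) a"
proof -
  have "pmf (bind_pmf q r) a = expect q (\<lambda>m. pmf (r m) a)" by (rule pmf_bind)
  also have "\<dots> = (\<Sum>m\<in>{\<phi> a}. pmf (r m) a * pmf q m)"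
    using assms by (intro integral_measure_pmf_real) (auto simp: pmf_eq_0_set_pmf)
  also have "\<dots> = pmf q (\<phi> a) * pmf (r (\<phi> a)) a"
    by simp
  finally show ?thesis .
qed

text \<open>The chain rule H(M, Z) = H(M) + H(Z|M) for M = \<phi>(Z) a function of Z, in which case
  H(M, Z) = H(Z).\<close>

lemma pmf_entropy_bind:
  assumes fin: "finite (set_pmf q)" "\<And>m. m \<in> set_pmf q \<Longrightarrow> finite (set_pmf (r m))"
    and disj: "\<And>m b. m \<in> set_pmf q \<Longrightarrow> b \<in> set_pmf (r m) \<Longrightarrow> \<phi> b = m"
  shows "pmf_entropy (bind_pmf q r) = pmf_entropy q + expect q (\<lambda>m. pmf_entropy (r m))"
proof -
  have "pmf_entropy (bind_pmf q r) = expect q (\<lambda>m. expect (r m) (\<lambda>a. - ln (pmf (bind_pmf q r) a)))"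
    unfolding pmf_entropy_def by (rule expect_bind) (use fin in auto)
  also have "\<dots> = expect q (\<lambda>m. expect (r m) (\<lambda>a. - ln (pmf q m) + (- ln (pmf (r m) a))))"
  proof (intro expect_cong)
    fix m a assume m: "m \<in> set_pmf q" and a: "a \<in> set_pmf (r m)"
    then have "\<phi> a = m" using disj by blast
    then have "pmf (bind_pmf q r) a = pmf q m * pmf (r m) a"
      using pmf_bind_disjoint[of q r \<phi> a] disj m by auto
    then show "- ln (pmf (bind_pmf q r) a) = - ln (pmf q m) + (- ln (pmf (r m) a))"
      using ln_mult_pos[OF pmf_positive[OF m] pmf_positive[OF a]] by simp
  qed
  also have "\<dots> = expect q (\<lambda>m. - ln (pmf q m) + pmf_entropy (r m))"
    by (intro expect_cong, subst expect_add) (use fin in \<open>auto simp: pmf_entropy_def\<close>)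
  also have "\<dots> = pmf_entropy q + expect q (\<lambda>m. pmf_entropy (r m))"
    by (subst expect_add) (use fin in \<open>auto simp: pmf_entropy_def\<close>)
  finally show ?thesis .
qed

lemma pmf_entropy_le_ln_card:
  assumes "finite A" "set_pmf p \<subseteq> A"
  shows "pmf_entropy p \<le> ln (real (card A))"
proof -
  have ne: "A \<noteq> {}" using assms(2) set_pmf_not_empty[of p] by auto
  have "pmf_entropy p \<le> expect p (\<lambda>x. - ln (1 / real (card A)))"
  proof (rule gibbs_inequality)
    show "finite (set_pmf p)" using assms finite_subset by blast
    have "card (set_pmf p) \<le> card A" using assms card_mono by blast
    then show "(\<Sum>x\<in>set_pmf p. 1 / real (card A)) \<le> 1"
      using ne assms by (auto simp: divide_le_eq card_gt_0_iff)
  qed (use ne assms in \<open>auto simp: card_gt_0_iff\<close>)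
  then show ?thesis using ne assms by (simp add: ln_div card_gt_0_iff)
qed

text \<open>Conditioning on z is finer than conditioning on \<open>f z\<close> and so leaves less
  entropy in \<open>g t\<close>. By Gibbs: the law of \<open>g t\<close> given z is compared with
  its law given \<open>f z\<close> only, that is, with the quotients
  \<open>pmf p (f z, s) / pmf (map_pmf f q) (f z)\<close>, whose expected logarithm is a difference
  of two entropies.\<close>

lemma pmf_entropy_chain_map:
  fixes f :: "'a \<Rightarrow> 'c" and g :: "'b \<Rightarrow> 'd"
  assumes q: "finite (set_pmf q)" and r: "\<And>z. z \<in> set_pmf q \<Longrightarrow> finite (set_pmf (r z))"
  shows "pmf_entropy (map_pmf f q) + expect q (\<lambda>z. pmf_entropy (map_pmf g (r z)))
    \<le> pmf_entropy (bind_pmf q (\<lambda>z. map_pmf (\<lambda>t. (f z, g t)) (r z)))"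
proof -
  define p where "p = bind_pmf q (\<lambda>z. map_pmf (\<lambda>t. (f z, g t)) (r z))"
  have fst_p: "map_pmf fst p = map_pmf f q"
    by (simp add: p_def map_bind_pmf map_pmf_comp map_pmf_const) (simp add: map_pmf_def)
  have setp: "set_pmf p = (\<Union>z\<in>set_pmf q. (\<lambda>t. (f z, g t)) ` set_pmf (r z))"
    by (auto simp: p_def)
  have finp: "finite (set_pmf p)" using q r by (auto simp: setp)
  have tower: "expect p h = expect q (\<lambda>z. expect (r z) (\<lambda>t. h (f z, g t)))" for h
    unfolding p_def by (subst expect_bind) (use q r in auto)
  have step: "pmf_entropy (map_pmf g (r z)) \<le> expect (r z) (\<lambda>t. - ln (pmf p (f z, g t))) + ln (pmf (map_pmf f q) (f z))"
    if z: "z \<in> set_pmf q" for z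
  proof -
    have fz: "0 < pmf (map_pmf f q) (f z)" using z by (intro pmf_positive) auto
    have "pmf_entropy (map_pmf g (r z)) \<le> expect (map_pmf g (r z)) (\<lambda>s. - ln (pmf p (f z, s) / pmf (map_pmf f q) (f z)))"
    proof (rule gibbs_inequality)
      show "finite (set_pmf (map_pmf g (r z)))" using r z by simp
      show "0 < pmf p (f z, s) / pmf (map_pmf f q) (f z)" if "s \<in> set_pmf (map_pmf g (r z))" for s
        using fz that z by (intro divide_pos_pos pmf_positive) (auto simp: setp)
      have "(\<Sum>s\<in>set_pmf (map_pmf g (r z)). pmf p (f z, s)) = sum (pmf p) (Pair (f z) ` set_pmf (map_pmf g (r z)))"
        by (subst sum.reindex) (auto simp: inj_on_def)
      also have "\<dots> = measure p (Pair (f z) ` set_pmf (map_pmf g (r z)))"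
        using r z by (subst measure_measure_pmf_finite) auto
      also have "\<dots> \<le> measure p (fst -` {f z})"
        by (intro measure_pmf.finite_measure_mono) auto
      also have "\<dots> = pmf (map_pmf f q) (f z)"
        by (simp add: fst_p[symmetric] pmf_map)
      finally show "(\<Sum>s\<in>set_pmf (map_pmf g (r z)). pmf p (f z, s) / pmf (map_pmf f q) (f z)) \<le> 1"
        using fz by (simp add: sum_divide_distrib[symmetric] divide_le_eq)
    qed
    also have "\<dots> = expect (r z) (\<lambda>t. - ln (pmf p (f z, g t)) + ln (pmf (map_pmf f q) (f z)))"
      unfolding integral_map_pmf
    proof (rule expect_cong)
      fix t assume "t \<in> set_pmf (r z)"
      then have "0 < pmf p (f z, g t)" using z by (intro pmf_positive) (auto simp: setp)
      then show "- ln (pmf p (f z, g t) / pmf (map_pmf f q) (f z)) = - ln (pmf p (f z, g t)) + ln (pmf (map_pmf f q) (f z))"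
        using fz by (simp add: ln_div)
    qed
    finally show ?thesis using r z by (subst (asm) expect_add) auto
  qed
  have "expect q (\<lambda>z. pmf_entropy (map_pmf g (r z)))
    \<le> expect q (\<lambda>z. expect (r z) (\<lambda>t. - ln (pmf p (f z, g t))) + ln (pmf (map_pmf f q) (f z)))"
    by (intro expect_mono q step)
  also have "\<dots> = expect q (\<lambda>z. expect (r z) (\<lambda>t. - ln (pmf p (f z, g t)))) - pmf_entropy (map_pmf f q)"
    using q by (subst expect_add) (auto simp: pmf_entropy_map)
  also have "expect q (\<lambda>z. expect (r z) (\<lambda>t. - ln (pmf p (f z, g t)))) = pmf_entropy p"
    unfolding pmf_entropy_def by (simp only: tower)
  finally show ?thesis by (simp add: p_def)
qed

section \<open>The hull of attainable entropy triples\<close>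

definition info_point :: "('y::finite \<times> 'x::finite) pmf \<Rightarrow> (real ^ ('y \<times> 'x)) \<times> real \<times> real \<times> real" where
  "info_point r = (\<chi> z. pmf r z, pmf_entropy r, pmf_entropy (map_pmf snd r), pmf_entropy (map_pmf fst r))"

text \<open>A point of the hull is a mean law together with H(Y,X|U), H(X|U) and H(Y|U), where U is
  the mixing variable. Supports stay inside that of P because \<open>ln 0 = 0\<close>: mass outside
  would contribute nothing to a cross entropy against P, where infinity is meant.\<close>

definition info_hull :: "('y::finite \<times> 'x::finite) pmf \<Rightarrow> ((real ^ ('y \<times> 'x)) \<times> real \<times> real \<times> real) set" where
  "info_hull P = convex hull (info_point ` {r. set_pmf r \<subseteq> set_pmf P})"

lemma info_hull_mix:
  assumes fin: "finite (set_pmf q)"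
    and k: "\<And>m. m \<in> set_pmf q \<Longrightarrow> (v m, h m, hX m, hY m) \<in> info_hull P"
  shows "(\<chi> z. expect q (\<lambda>m. v m $ z), expect q h, expect q hX, expect q hY) \<in> info_hull P"
proof -
  have "(\<Sum>m\<in>set_pmf q. pmf q m *\<^sub>R (v m, h m, hX m, hY m)) \<in> info_hull P"
    unfolding info_hull_def
    by (rule convex_sum) (use fin k sum_pmf_eq_1[of "set_pmf q" q] in \<open>auto simp: info_hull_def\<close>)
  moreover have "(\<chi> z. expect q (\<lambda>m. v m $ z), expect q h, expect q hX, expect q hY)
      = (\<Sum>m\<in>set_pmf q. pmf q m *\<^sub>R (v m, h m, hX m, hY m))"
    by (simp add: prod_eq_iff fst_sum snd_sum vec_eq_iff expect_sum[OF fin])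
  ultimately show ?thesis by simp
qed

lemma info_point_in_hull: "set_pmf r \<subseteq> set_pmf P \<Longrightarrow> info_point r \<in> info_hull P"
  unfolding info_hull_def by (rule hull_inc) auto

lemma ex_pmf_of_weights:
  fixes w :: "'a \<Rightarrow> real"
  assumes "finite A" "\<And>a. a \<in> A \<Longrightarrow> 0 \<le> w a" "sum w A = 1"
  shows "\<exists>q. set_pmf q \<subseteq> A \<and> (\<forall>a\<in>A. pmf q a = w a)"
proof -
  let ?f = "\<lambda>a. if a \<in> A then w a else 0"
  have "(\<integral>\<^sup>+a. ennreal (?f a) \<partial>count_space UNIV) = (\<Sum>a\<in>A. ennreal (?f a))"
    by (rule nn_integral_count_space') (use assms in auto)
  also have "\<dots> = ennreal (\<Sum>a\<in>A. ?f a)"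
    by (rule sum_ennreal) (use assms in auto)
  also have "(\<Sum>a\<in>A. ?f a) = 1" using assms by simp
  finally have "(\<integral>\<^sup>+a. ennreal (?f a) \<partial>count_space UNIV) = 1" by simp
  then have pmf: "pmf (embed_pmf ?f) a = ?f a" for a
    by (intro pmf_embed_pmf) (use assms in auto)
  show ?thesis
    by (rule exI[of _ "embed_pmf ?f"]) (auto simp: pmf set_pmf_eq)
qed

text \<open>The index of the finite convex combination serves as the auxiliary variable U, with law
  \<open>q\<close>, and \<open>r i\<close> is the law of the pair given U = i; this is why U lives
  on the natural numbers.\<close>

lemma info_hull_explicit:
  assumes "(v, h, hX, hY) \<in> info_hull P"
  obtains q :: "nat pmf" and r where "finite (set_pmf q)" "\<And>i. i \<in> set_pmf q \<Longrightarrow> set_pmf (r i) \<subseteq> set_pmf P"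
    "\<And>z. v $ z = expect q (\<lambda>i. pmf (r i) z)" "h = expect q (\<lambda>i. pmf_entropy (r i))"
    "hX = expect q (\<lambda>i. pmf_entropy (map_pmf snd (r i)))" "hY = expect q (\<lambda>i. pmf_entropy (map_pmf fst (r i)))"
proof -
  obtain k u x where x: "\<forall>i\<in>{1::nat..k}. 0 \<le> u i \<and> x i \<in> info_point ` {r. set_pmf r \<subseteq> set_pmf P}"
    and u: "sum u {1..k} = 1" and eq: "(\<Sum>i=1..k. u i *\<^sub>R x i) = (v, h, hX, hY)"
    using assms unfolding info_hull_def convex_hull_indexed by blast
  obtain q where q: "set_pmf q \<subseteq> {1..k}" "\<forall>i\<in>{1..k}. pmf q i = u i"
    using ex_pmf_of_weights[of "{1..k}" u] x u by auto
  from x have "\<forall>i\<in>{1..k}. \<exists>r. x i = info_point r \<and> set_pmf r \<subseteq> set_pmf P" by blast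
  then obtain r where r: "\<forall>i\<in>{1..k}. x i = info_point (r i) \<and> set_pmf (r i) \<subseteq> set_pmf P" by metis
  have E: "expect q f = (\<Sum>i=1..k. u i * f i)" for f
    using expect_sum[of "{1..k}" q f] q by simp
  have eq': "(\<Sum>i=1..k. u i *\<^sub>R info_point (r i)) = (v, h, hX, hY)"
    unfolding eq[symmetric] using r by (intro sum.cong) auto
  show ?thesis
  proof
    show "finite (set_pmf q)" using q finite_subset by blast
    show "\<And>i. i \<in> set_pmf q \<Longrightarrow> set_pmf (r i) \<subseteq> set_pmf P" using q r by auto
    show "v $ z = expect q (\<lambda>i. pmf (r i) z)" for z
      using arg_cong[OF eq', of "\<lambda>t. fst t $ z"] by (simp add: E fst_sum info_point_def)
    show "h = expect q (\<lambda>i. pmf_entropy (r i))"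
      using arg_cong[OF eq', of "\<lambda>t. fst (snd t)"] by (simp add: E fst_sum snd_sum info_point_def)
    show "hX = expect q (\<lambda>i. pmf_entropy (map_pmf snd (r i)))"
      using arg_cong[OF eq', of "\<lambda>t. fst (snd (snd t))"] by (simp add: E fst_sum snd_sum info_point_def)
    show "hY = expect q (\<lambda>i. pmf_entropy (map_pmf fst (r i)))"
      using arg_cong[OF eq', of "\<lambda>t. snd (snd (snd t))"] by (simp add: E fst_sum snd_sum info_point_def)
  qed
qed

section \<open>Continuity of entropy and compactness of the hull\<close>

definition vec_entropy :: "real ^ 'z::finite \<Rightarrow> real" where
  "vec_entropy v = (\<Sum>z\<in>UNIV. - (v $ z * ln (v $ z)))"

abbreviation cross_entropy :: "real ^ 'z::finite \<Rightarrow> ('z \<Rightarrow> real) \<Rightarrow> real" where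
  "cross_entropy v f \<equiv> (\<Sum>z\<in>UNIV. v $ z * - ln (f z))"

lemma pmf_entropy_vec: "pmf_entropy p = vec_entropy (\<chi> z. pmf p z)"
  unfolding pmf_entropy_def vec_entropy_def by (subst expect_sum[of UNIV]) auto

lemma continuous_on_x_ln_x: "continuous_on {0..} (\<lambda>x::real. x * ln x)"
proof -
  \<comment> \<open>The inequality ln t \<le> t - 1 at t = 1 / sqrt x bounds -ln x by 2 / sqrt x, so
    x ln x vanishes at 0 at least as fast as sqrt x.\<close>
  have bound: "\<bar>x * ln x\<bar> \<le> 2 * sqrt x" if "0 \<le> x" "x \<le> 1" for x :: real
  proof (cases "x = 0")
    case False
    then have x: "0 < x" using that by simp
    have "- ln x = 2 * ln (1 / sqrt x)" using x by (simp add: ln_div ln_sqrt)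
    also have "\<dots> \<le> 2 * (1 / sqrt x)" using ln_le_minus_one[of "1 / sqrt x"] x by simp
    finally have "x * (- ln x) \<le> x * (2 * (1 / sqrt x))" using x by (intro mult_left_mono) auto
    also have "\<dots> = 2 * (x / sqrt x)" by simp
    also have "\<dots> = 2 * sqrt x" using x by (simp add: real_div_sqrt)
    finally show ?thesis using x that by (auto simp: abs_mult)
  qed simp
  have "((\<lambda>x::real. x * ln x) \<longlongrightarrow> 0 * ln 0) (at 0 within {0..})"
  proof -
    have "((\<lambda>x::real. x * ln x) \<longlongrightarrow> 0) (at 0 within {0..})"
    proof (rule Lim_null_comparison)
      have "\<forall>\<^sub>F x in at 0 within {0..}. (x::real) \<in> {0..} \<and> x \<in> {..<1}"
        by (auto simp: eventually_at intro!: exI[of _ 1])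
      then show "\<forall>\<^sub>F x in at 0 within {0..}. norm (x * ln x) \<le> 2 * sqrt x"
        by eventually_elim (use bound in auto)
      have "continuous (at 0 within {0..}) (\<lambda>x::real. 2 * sqrt x)" by (intro continuous_intros)
      then show "((\<lambda>x::real. 2 * sqrt x) \<longlongrightarrow> 0) (at 0 within {0..})"
        by (simp add: continuous_within)
    qed
    then show ?thesis by simp
  qed
  moreover have "((\<lambda>x::real. x * ln x) \<longlongrightarrow> a * ln a) (at a within {0..})" if "a > 0" for a
    by (intro tendsto_intros) (use that in auto)
  ultimately show ?thesis unfolding continuous_on_def
    by (metis atLeast_iff order_le_less)
qed

lemma continuous_on_vec_entropy:
  assumes "\<And>z. continuous_on A (\<lambda>a. f a $ z)" "\<And>a z. a \<in> A \<Longrightarrow> 0 \<le> f a $ z"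
  shows "continuous_on A (\<lambda>a. vec_entropy (f a))"
  unfolding vec_entropy_def
proof (intro continuous_on_sum continuous_on_minus)
  fix z
  show "continuous_on A (\<lambda>a. f a $ z * ln (f a $ z))"
    by (rule continuous_on_compose2[OF continuous_on_x_ln_x assms(1)]) (use assms(2) in auto)
qed

lemma pmf_map_snd: "pmf (map_pmf snd r) x = (\<Sum>y\<in>UNIV. pmf r (y, x))" for r :: "('y::finite \<times> 'x) pmf"
proof -
  have "snd -` {x} = (\<lambda>y::'y. (y, x)) ` UNIV" by auto
  then show ?thesis
    by (simp add: pmf_map measure_measure_pmf_finite sum.reindex inj_on_def)
qed

lemma pmf_map_fst: "pmf (map_pmf fst r) y = (\<Sum>x\<in>UNIV. pmf r (y, x))" for r :: "('y \<times> 'x::finite) pmf"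
proof -
  have "fst -` {y} = (\<lambda>x::'x. (y, x)) ` UNIV" by auto
  then show ?thesis
    by (simp add: pmf_map measure_measure_pmf_finite sum.reindex inj_on_def)
qed

text \<open>The generators are the continuous image of a face of the probability simplex, and in
  finite dimension the convex hull of a compact set is compact.\<close>

lemma compact_info_hull: "compact (info_hull P)"
  for P :: "('y::finite \<times> 'x::finite) pmf"
proof -
  define D :: "(real ^ ('y \<times> 'x)) set" where
    "D = {v. (\<forall>z. 0 \<le> v $ z) \<and> (\<forall>z\<in>-set_pmf P. v $ z = 0) \<and> (\<Sum>z\<in>UNIV. v $ z) = 1}"
  define G :: "real ^ ('y \<times> 'x) \<Rightarrow> (real ^ ('y \<times> 'x)) \<times> real \<times> real \<times> real" where
    "G v = (v, vec_entropy v, vec_entropy (\<chi> x. \<Sum>y\<in>UNIV. v $ (y, x)), vec_entropy (\<chi> y. \<Sum>x\<in>UNIV. v $ (y, x)))" for v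
  have point: "info_point r = G (\<chi> z. pmf r z)" for r :: "('y \<times> 'x) pmf"
    by (simp add: info_point_def G_def pmf_entropy_vec pmf_map_fst pmf_map_snd)
  have "info_point ` {r. set_pmf r \<subseteq> set_pmf P} = G ` D"
  proof (intro subset_antisym subsetI)
    fix t assume "t \<in> info_point ` {r. set_pmf r \<subseteq> set_pmf P}"
    then obtain r where "set_pmf r \<subseteq> set_pmf P" "t = info_point r" by auto
    moreover from this have "(\<chi> z. pmf r z) \<in> D"
      by (auto simp: D_def sum_pmf_eq_1 set_pmf_eq)
    ultimately show "t \<in> G ` D" by (auto simp: point)
  next
    fix t assume "t \<in> G ` D"
    then obtain v where v: "v \<in> D" "t = G v" by auto
    then obtain r where r: "\<forall>z. pmf r z = v $ z"
      using ex_pmf_of_weights[of UNIV "\<lambda>z. v $ z"] by (auto simp: D_def)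
    then have "set_pmf r \<subseteq> set_pmf P" using v(1) by (force simp: D_def set_pmf_eq)
    moreover have "t = info_point r" by (simp add: v(2) point r)
    ultimately show "t \<in> info_point ` {r. set_pmf r \<subseteq> set_pmf P}" by auto
  qed
  moreover have "compact D"
  proof (rule compact_eq_bounded_closed[THEN iffD2], intro conjI)
    have "D \<subseteq> cbox 0 1"
    proof
      fix v assume v: "v \<in> D"
      have "v $ z \<le> 1" for z
        using v member_le_sum[of z UNIV "\<lambda>z. v $ z"] by (auto simp: D_def)
      then show "v \<in> cbox 0 1" using v by (auto simp: D_def mem_box_cart)
    qed
    then show "bounded D" using bounded_cbox bounded_subset by blast
    show "closed D" unfolding D_def Ball_def
      by (intro closed_Collect_conj closed_Collect_all closed_Collect_imp closed_Collect_le closed_Collect_eq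
          continuous_intros open_Collect_const)
  qed
  moreover have "continuous_on D G" unfolding G_def
    by (intro continuous_intros continuous_on_vec_entropy) (auto simp: D_def intro!: sum_nonneg continuous_intros)
  ultimately show ?thesis unfolding info_hull_def
    by (metis compact_convex_hull compact_continuous_image)
qed

section \<open>From block laws to single letters\<close>

lemma finite_set_pmf_lists:
  fixes p :: "'z::finite list pmf"
  assumes "\<And>zs. zs \<in> set_pmf p \<Longrightarrow> length zs = n"
  shows "finite (set_pmf p)"
  by (rule finite_subset[OF _ finite_lists_length_eq[of UNIV n]]) (use assms in auto)

lemma expect_sum_right:
  assumes "finite (set_pmf q)"
  shows "expect q (\<lambda>m. \<Sum>z\<in>A. g m z) = (\<Sum>z\<in>A. expect q (\<lambda>m. g m z))"
  using assms by (intro Bochner_Integration.integral_sum integrable_measure_pmf_finite)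

lemma info_hull_convex:
  assumes "(v, h, hX, hY) \<in> info_hull P" "(v', h', hX', hY') \<in> info_hull P" "0 \<le> a" "0 \<le> b" "a + b = 1"
  shows "(a *\<^sub>R v + b *\<^sub>R v', a * h + b * h', a * hX + b * hX', a * hY + b * hY') \<in> info_hull P"
  using convexD[OF convex_convex_hull assms(1)[unfolded info_hull_def] assms(2)[unfolded info_hull_def] assms(3-5)]
  by (simp add: info_hull_def)

text \<open>What an n-letter law hands to the hull: v is the average letter law, n h is the entropy
  exactly, while n hX and n hY bound the entropies of the marginal blocks from below. Behind the
  point stands the auxiliary variable made of a random position and the pairs before it; those pairs
  tell more about the next x (or y) than the earlier x (or y) alone, hence the inequalities.\<close>

abbreviation single_letter_point where
  "single_letter_point P n p v h hX hY \<equiv> (v, h, hX, hY) \<in> info_hull P \<and>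
    (\<forall>f. expect p (\<lambda>zs. sum_list (map f zs)) = real n * (\<Sum>z\<in>UNIV. v $ z * f z)) \<and>
    pmf_entropy p = real n * h \<and>
    real n * hX \<le> pmf_entropy (map_pmf (map snd) p) \<and>
    real n * hY \<le> pmf_entropy (map_pmf (map fst) p)"

text \<open>Induction by splitting off the leading letter: its law is a generator of the hull and
  gets weight 1/(n+1), and the points found for the tail given that letter are averaged over it and
  get weight n/(n+1).\<close>

lemma single_letterization:
  fixes p :: "('y::finite \<times> 'x::finite) list pmf"
  assumes "\<And>zs. zs \<in> set_pmf p \<Longrightarrow> length zs = n \<and> set zs \<subseteq> set_pmf P"
  shows "\<exists>v h hX hY. single_letter_point P n p v h hX hY"
  using assms
proof (induction n arbitrary: p)
  case 0
  then have "set_pmf p \<subseteq> {[]}" by auto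
  then have "p = return_pmf []" by (simp add: set_pmf_subset_singleton)
  \<comment> \<open>For n = 0 the coordinates are multiplied by 0, so any point of the hull
    serves.\<close>
  moreover have "info_point P \<in> info_hull P" by (rule info_point_in_hull) simp
  ultimately show ?case by (auto simp: info_point_def)
next
  case (Suc n)
  define q where "q = map_pmf hd p"
  define c where "c z = cond_pmf p {zs. hd zs = z}" for z
  define r where "r z = map_pmf tl (c z)" for z
  have finp: "finite (set_pmf p)" using Suc.prems by (intro finite_set_pmf_lists) auto
  then have finq: "finite (set_pmf q)" by (simp add: q_def)
  have p: "p = bind_pmf q c" unfolding q_def c_def by (rule bind_cond_pmf_fibre[symmetric])
  have setc: "set_pmf (c z) = set_pmf p \<inter> {zs. hd zs = z}" if "z \<in> set_pmf q" for z
    using that unfolding q_def c_def by (rule set_cond_pmf_fibre)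
  have cons: "zs = z # tl zs \<and> length zs = Suc n \<and> set zs \<subseteq> set_pmf P"
    if "z \<in> set_pmf q" "zs \<in> set_pmf (c z)" for z zs
    using setc[OF that(1)] that(2) Suc.prems[of zs] by (cases zs) auto
  have c: "c z = map_pmf ((#) z) (r z)" if z: "z \<in> set_pmf q" for z
    unfolding r_def map_pmf_comp using cons[OF z] by (intro map_pmf_idI[symmetric]) auto
  have finc: "finite (set_pmf (c z))" and finr: "finite (set_pmf (r z))" if "z \<in> set_pmf q" for z
    using setc[OF that] finp by (auto simp: r_def)
  define good where "good z v h hX hY \<longleftrightarrow> single_letter_point P n (r z) v h hX hY" for z v h hX hY
  have "\<forall>z\<in>set_pmf q. \<exists>v h hX hY. good z v h hX hY"
    unfolding good_def
  proof (intro ballI Suc.IH)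
    fix z zs assume "z \<in> set_pmf q" "zs \<in> set_pmf (r z)"
    then obtain zs' where "zs = tl zs'" "zs' \<in> set_pmf (c z)" "z \<in> set_pmf q" by (auto simp: r_def)
    with cons[of z zs'] show "length zs = n \<and> set zs \<subseteq> set_pmf P" by (metis diff_Suc_1 length_tl list.set_sel(2) subset_eq tl_Nil)
  qed
  then obtain v h hX hY where "\<And>z. z \<in> set_pmf q \<Longrightarrow> good z (v z) (h z) (hX z) (hY z)"
    by metis
  then have IH: "\<And>z. z \<in> set_pmf q \<Longrightarrow> (v z, h z, hX z, hY z) \<in> info_hull P"
    "\<And>z f. z \<in> set_pmf q \<Longrightarrow> expect (r z) (\<lambda>zs. sum_list (map f zs)) = real n * (\<Sum>w\<in>UNIV. v z $ w * f w)"
    "\<And>z. z \<in> set_pmf q \<Longrightarrow> pmf_entropy (r z) = real n * h z"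
    "\<And>z. z \<in> set_pmf q \<Longrightarrow> real n * hX z \<le> pmf_entropy (map_pmf (map snd) (r z))"
    "\<And>z. z \<in> set_pmf q \<Longrightarrow> real n * hY z \<le> pmf_entropy (map_pmf (map fst) (r z))"
    by (auto simp: good_def)
  have mix: "(\<chi> w. expect q (\<lambda>z. v z $ w), expect q h, expect q hX, expect q hY) \<in> info_hull P"
    by (rule info_hull_mix) (use finq IH in auto)
  have "set_pmf q \<subseteq> set_pmf P"
  proof
    fix z assume "z \<in> set_pmf q"
    then obtain zs where "zs \<in> set_pmf p" "z = hd zs" by (auto simp: q_def)
    then show "z \<in> set_pmf P" using Suc.prems[of zs] by (cases zs) auto
  qed
  then have pt: "((\<chi> w. pmf q w), pmf_entropy q, pmf_entropy (map_pmf snd q), pmf_entropy (map_pmf fst q)) \<in> info_hull P"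
    using info_point_in_hull[of q P] by (simp add: info_point_def)
  define N where "N = real (Suc n)"
  have N: "N > 0" "N = 1 + real n" by (auto simp: N_def)
  have ab: "0 \<le> 1 / N" "0 \<le> real n / N" "1 / N + real n / N = 1"
    using N by (auto simp: field_simps)
  \<comment> \<open>Used for both projections. Equality is lost because the tail is conditioned on
    the whole letter z and not only on \<open>f z\<close>.\<close>
  have bound: "pmf_entropy (map_pmf f q) + real n * expect q hf \<le> pmf_entropy (map_pmf (map f) p)"
    if hf: "\<And>z. z \<in> set_pmf q \<Longrightarrow> real n * hf z \<le> pmf_entropy (map_pmf (map f) (r z))" for f :: "('y \<times> 'x) \<Rightarrow> 'c" and hf
  proof -
    have "real n * expect q hf \<le> expect q (\<lambda>z. pmf_entropy (map_pmf (map f) (r z)))"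
      using expect_mono[OF finq hf] by simp
    moreover have "pmf_entropy (map_pmf f q) + expect q (\<lambda>z. pmf_entropy (map_pmf (map f) (r z)))
       \<le> pmf_entropy (bind_pmf q (\<lambda>z. map_pmf (\<lambda>t. (f z, map f t)) (r z)))"
      by (rule pmf_entropy_chain_map) (use finq finr in auto)
    moreover have "bind_pmf q (\<lambda>z. map_pmf (\<lambda>t. f z # map f t) (r z)) = map_pmf (map f) p"
      unfolding p map_bind_pmf by (intro bind_pmf_cong refl) (simp add: c map_pmf_comp)
    moreover have "pmf_entropy (map_pmf (\<lambda>(a, b). a # b) (bind_pmf q (\<lambda>z. map_pmf (\<lambda>t. (f z, map f t)) (r z))))
      = pmf_entropy (bind_pmf q (\<lambda>z. map_pmf (\<lambda>t. (f z, map f t)) (r z)))"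
      by (intro pmf_entropy_map_inj) (auto simp: inj_on_def)
    ultimately show ?thesis by (simp add: map_bind_pmf map_pmf_comp)
  qed
  let ?v = "(1 / N) *\<^sub>R (\<chi> w. pmf q w) + (real n / N) *\<^sub>R (\<chi> w. expect q (\<lambda>z. v z $ w))"
  let ?c = "\<lambda>a b. 1 / N * a + real n / N * b"
  have cN: "N * ?c a b = a + real n * b" for a b
    using N(1) by (simp add: distrib_left)
  show ?case unfolding N_def[symmetric]
  proof (intro exI conjI allI)
    show "(?v, ?c (pmf_entropy q) (expect q h), ?c (pmf_entropy (map_pmf snd q)) (expect q hX),
        ?c (pmf_entropy (map_pmf fst q)) (expect q hY)) \<in> info_hull P"
      by (rule info_hull_convex[OF pt mix ab])
    show "expect p (\<lambda>zs. sum_list (map f zs)) = N * (\<Sum>z\<in>UNIV. ?v $ z * f z)" for f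
    proof -
      have "expect p (\<lambda>zs. sum_list (map f zs)) = expect q (\<lambda>z. expect (c z) (\<lambda>zs. sum_list (map f zs)))"
        unfolding p by (rule expect_bind) (use finq finc in auto)
      also have "\<dots> = expect q (\<lambda>z. f z + real n * (\<Sum>w\<in>UNIV. v z $ w * f w))"
      proof (rule expect_cong)
        fix z assume z: "z \<in> set_pmf q"
        have "expect (c z) (\<lambda>zs. sum_list (map f zs)) = expect (r z) (\<lambda>zs. f z + sum_list (map f zs))"
          by (simp add: c[OF z])
        also have "\<dots> = f z + expect (r z) (\<lambda>zs. sum_list (map f zs))"
          by (subst expect_add) (use finr z in auto)
        finally show "expect (c z) (\<lambda>zs. sum_list (map f zs)) = f z + real n * (\<Sum>w\<in>UNIV. v z $ w * f w)"
          by (simp add: IH(2)[OF z])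
      qed
      also have "\<dots> = expect q f + real n * (\<Sum>w\<in>UNIV. expect q (\<lambda>z. v z $ w) * f w)"
        by (subst expect_add) (use finq in \<open>auto simp: expect_sum_right\<close>)
      also have "\<dots> = (\<Sum>w\<in>UNIV. (pmf q w + real n * expect q (\<lambda>z. v z $ w)) * f w)"
        by (subst (1) expect_sum[of UNIV]) (simp_all add: distrib_right sum.distrib sum_distrib_left mult.assoc)
      also have "\<dots> = (\<Sum>w\<in>UNIV. N * ?c (pmf q w) (expect q (\<lambda>z. v z $ w)) * f w)"
        by (simp only: cN)
      also have "\<dots> = N * (\<Sum>z\<in>UNIV. ?v $ z * f z)"
        by (simp add: sum_distrib_left mult.assoc)
      finally show ?thesis .
    qed
    show "pmf_entropy p = N * ?c (pmf_entropy q) (expect q h)"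
    proof -
      have "pmf_entropy p = pmf_entropy q + expect q (\<lambda>z. pmf_entropy (c z))"
        unfolding p by (rule pmf_entropy_bind[where \<phi> = hd]) (use finq finc setc in auto)
      also have "expect q (\<lambda>z. pmf_entropy (c z)) = expect q (\<lambda>z. real n * h z)"
        by (intro expect_cong) (simp add: c IH(3)[symmetric] pmf_entropy_map_inj)
      finally show ?thesis by (simp only: cN) simp
    qed
    show "N * ?c (pmf_entropy (map_pmf snd q)) (expect q hX) \<le> pmf_entropy (map_pmf (map snd) p)"
      unfolding cN by (rule bound) (rule IH)
    show "N * ?c (pmf_entropy (map_pmf fst q)) (expect q hY) \<le> pmf_entropy (map_pmf (map fst) p)"
      unfolding cN by (rule bound) (rule IH)
  qed
qed

section \<open>Mutual information and test channels\<close>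

lemma absolutely_continuous_pmf_iff:
  "absolutely_continuous (measure_pmf Q) (measure_pmf P) \<longleftrightarrow> set_pmf P \<subseteq> set_pmf Q"
proof -
  have null: "null_sets (measure_pmf M) = {A. set_pmf M \<inter> A = {}}" for M :: "'a pmf"
    by (auto simp: null_sets_def measure_pmf.emeasure_eq_measure measure_pmf_zero_iff)
  show ?thesis
    unfolding absolutely_continuous_def null
  proof (intro iffI)
    assume "{A. set_pmf Q \<inter> A = {}} \<subseteq> {A. set_pmf P \<inter> A = {}}"
    then have "- set_pmf Q \<in> {A. set_pmf P \<inter> A = {}}" by auto
    then show "set_pmf P \<subseteq> set_pmf Q" by auto
  qed auto
qed

lemma KL_divergence_pmf:
  fixes P Q :: "'a::countable pmf"
  assumes "set_pmf P \<subseteq> set_pmf Q"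
  shows "KL_divergence (exp 1) (measure_pmf Q) (measure_pmf P) = expect P (\<lambda>x. ln (pmf P x / pmf Q x))"
proof -
  interpret sigma_finite_measure "count_space (UNIV :: 'a set)"
    by (rule sigma_finite_measure_count_space)
  have "KL_divergence (exp 1) (density (count_space UNIV) (pmf Q)) (density (count_space UNIV) (pmf P))
    = (\<integral>x. pmf P x * log (exp 1) (pmf P x / pmf Q x) \<partial>count_space UNIV)"
    by (rule KL_density_density) (use assms in \<open>auto simp: AE_count_space set_pmf_eq\<close>)
  also have "\<dots> = expect P (\<lambda>x. ln (pmf P x / pmf Q x))"
    unfolding measure_pmf_eq_density[of P] by (subst integral_density) (auto simp: log_def)
  finally show ?thesis by (simp only: measure_pmf_eq_density[symmetric])
qed

lemma pair_measure_pmf: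
  fixes p :: "'a::countable pmf" and q :: "'b::countable pmf"
  shows "measure_pmf p \<Otimes>\<^sub>M measure_pmf q = measure_pmf (pair_pmf p q)"
proof (rule measure_eqI_countable[of _ UNIV])
  have "sets (measure_pmf p \<Otimes>\<^sub>M measure_pmf q) = sets (count_space UNIV \<Otimes>\<^sub>M count_space UNIV)"
    by (rule sets_pair_measure_cong) auto
  also have "count_space UNIV \<Otimes>\<^sub>M count_space UNIV = count_space (UNIV :: ('a \<times> 'b) set)"
    by (subst pair_measure_countable) auto
  finally show "sets (measure_pmf p \<Otimes>\<^sub>M measure_pmf q) = Pow UNIV" by simp
  fix z :: "'a \<times> 'b"
  obtain a b where z: "z = (a, b)" by (cases z)
  have "emeasure (measure_pmf p \<Otimes>\<^sub>M measure_pmf q) ({a} \<times> {b}) = emeasure p {a} * emeasure q {b}"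
    by (rule measure_pmf.emeasure_pair_measure_Times) auto
  then show "emeasure (measure_pmf p \<Otimes>\<^sub>M measure_pmf q) {z} = emeasure (pair_pmf p q) {z}"
    by (simp add: z emeasure_pmf_single pmf_pair ennreal_mult)
qed auto

lemma mutual_info_expect:
  fixes V :: "'c \<Rightarrow> 'a::countable" and W :: "'c \<Rightarrow> 'b::countable"
  shows "mutual_info J V W = expect J (\<lambda>c. ln (pmf (map_pmf (\<lambda>c. (V c, W c)) J) (V c, W c) /
    (pmf (map_pmf V J) (V c) * pmf (map_pmf W J) (W c))))"
proof -
  have "mutual_info J V W = KL_divergence (exp 1) (pair_pmf (map_pmf V J) (map_pmf W J)) (map_pmf (\<lambda>c. (V c, W c)) J)"
    unfolding mutual_info_def prob_space.mutual_information_def[OF measure_pmf.prob_space_axioms]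
    by (simp add: pair_measure_countable[OF countableI_type countableI_type] map_pmf_rep_eq[symmetric] pair_measure_pmf)
  also have "\<dots> = expect (map_pmf (\<lambda>c. (V c, W c)) J)
      (\<lambda>z. ln (pmf (map_pmf (\<lambda>c. (V c, W c)) J) z / pmf (pair_pmf (map_pmf V J) (map_pmf W J)) z))"
    by (rule KL_divergence_pmf) auto
  finally show ?thesis by (simp add: pmf_pair)
qed

lemma mutual_info_entropy:
  fixes V :: "'c \<Rightarrow> 'a::countable" and W :: "'c \<Rightarrow> 'b::countable"
  assumes fin: "finite (set_pmf J)"
  shows "mutual_info J V W = pmf_entropy (map_pmf V J) + pmf_entropy (map_pmf W J)
    - pmf_entropy (map_pmf (\<lambda>c. (V c, W c)) J)"
proof -
  have pos: "pmf (map_pmf f J) (f c) > 0" if "c \<in> set_pmf J" for f :: "'c \<Rightarrow> 'd" and c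
    using that by (intro pmf_positive) auto
  have "mutual_info J V W = expect J (\<lambda>c. - ln (pmf (map_pmf V J) (V c)) + (- ln (pmf (map_pmf W J) (W c)))
      - (- ln (pmf (map_pmf (\<lambda>c. (V c, W c)) J) (V c, W c))))"
    unfolding mutual_info_expect
  proof (rule expect_cong)
    fix c assume "c \<in> set_pmf J"
    from pos[OF this, of V] pos[OF this, of W] pos[OF this, of "\<lambda>c. (V c, W c)"]
    show "ln (pmf (map_pmf (\<lambda>c. (V c, W c)) J) (V c, W c) / (pmf (map_pmf V J) (V c) * pmf (map_pmf W J) (W c)))
      = - ln (pmf (map_pmf V J) (V c)) + (- ln (pmf (map_pmf W J) (W c))) - (- ln (pmf (map_pmf (\<lambda>c. (V c, W c)) J) (V c, W c)))"
      by (simp add: ln_div ln_mult)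
  qed
  also have "\<dots> = pmf_entropy (map_pmf V J) + pmf_entropy (map_pmf W J) - pmf_entropy (map_pmf (\<lambda>c. (V c, W c)) J)"
    unfolding pmf_entropy_map using fin by (subst expect_diff, simp, subst expect_add) auto
  finally show ?thesis .
qed

lemma rel_entropy_pmf:
  fixes P Q :: "'a::countable pmf"
  shows "rel_entropy P Q = (if set_pmf P \<subseteq> set_pmf Q then ereal (expect P (\<lambda>x. ln (pmf P x / pmf Q x))) else \<infinity>)"
  by (simp add: rel_entropy_def absolutely_continuous_pmf_iff KL_divergence_pmf)

section \<open>Test channels as mixtures, and mixtures as test channels\<close>

lemma finite_set_joint_YXU:
  fixes P :: "('y::finite \<times> 'x::finite) pmf"
  assumes "\<And>x. finite (set_pmf (W x))"
  shows "finite (set_pmf (joint_YXU P W))"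
  unfolding joint_YXU_def using assms by (auto simp: set_bind_pmf split: prod.splits)

lemma map_joint_YXU_fst: "map_pmf (\<lambda>(y, x, u). (y, x)) (joint_YXU P W) = P"
  by (simp add: joint_YXU_def map_bind_pmf map_pmf_comp case_prod_unfold map_pmf_const bind_return_pmf')

text \<open>Here \<open>r u\<close> is the law of (Y, X) given U = u, so the averages are H(X|U),
  H(Y|U) and H(Y,X|U). The last two equations expand H(Y,X,U) and H(X,U) with U drawn at the start;
  comparing them with the expansions that draw U at the end, through W, exposes the Markov
  property.\<close>

lemma info_of_mixture:
  fixes P :: "('y::finite \<times> 'x::finite) pmf" and q :: "nat pmf"
  assumes J: "joint_YXU P W = bind_pmf q (\<lambda>u. map_pmf (\<lambda>(y, x). (y, x, u)) (r u))"
    and q: "finite (set_pmf q)"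
  shows "info_UX P W = pmf_entropy (map_pmf snd P) - expect q (\<lambda>u. pmf_entropy (map_pmf snd (r u)))"
    and "info_YU P W = pmf_entropy (map_pmf fst P) - expect q (\<lambda>u. pmf_entropy (map_pmf fst (r u)))"
    and "pmf_entropy (joint_YXU P W) = pmf_entropy q + expect q (\<lambda>u. pmf_entropy (r u))"
    and "pmf_entropy (map_pmf (\<lambda>(y, x, u). (x, u)) (joint_YXU P W))
      = pmf_entropy q + expect q (\<lambda>u. pmf_entropy (map_pmf snd (r u)))"
proof -
  let ?J = "joint_YXU P W"
  have fin: "finite (set_pmf ?J)" unfolding J using q by simp
  have U: "map_pmf (\<lambda>(y, x, u). u) ?J = q"
    by (simp add: J map_bind_pmf map_pmf_comp case_prod_unfold map_pmf_const bind_return_pmf')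
  have ent: "pmf_entropy (map_pmf (\<lambda>(y, x, u). (u, f (y, x))) ?J) = pmf_entropy q + expect q (\<lambda>u. pmf_entropy (map_pmf f (r u)))"
    for f :: "'y \<times> 'x \<Rightarrow> 'b"
  proof -
    have "map_pmf (\<lambda>(y, x, u). (u, f (y, x))) ?J = bind_pmf q (\<lambda>u. map_pmf (Pair u) (map_pmf f (r u)))"
      by (simp add: J map_bind_pmf map_pmf_comp case_prod_unfold)
    also have "pmf_entropy \<dots> = pmf_entropy q + expect q (\<lambda>u. pmf_entropy (map_pmf (Pair u) (map_pmf f (r u))))"
      by (rule pmf_entropy_bind[where \<phi> = fst]) (use q in auto)
    also have "expect q (\<lambda>u. pmf_entropy (map_pmf (Pair u) (map_pmf f (r u)))) = expect q (\<lambda>u. pmf_entropy (map_pmf f (r u)))"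
      by (intro expect_cong pmf_entropy_map_inj) (auto simp: inj_on_def)
    finally show ?thesis .
  qed
  have X: "map_pmf (\<lambda>(y, x, u). x) ?J = map_pmf snd P" and Y: "map_pmf (\<lambda>(y, x, u). y) ?J = map_pmf fst P"
    by (subst (2) map_joint_YXU_fst[of P W, symmetric], simp add: map_pmf_comp case_prod_unfold)+
  have inj: "pmf_entropy (map_pmf (\<lambda>z. g (f z)) ?J) = pmf_entropy (map_pmf f ?J)" if "inj g" for f :: "_ \<Rightarrow> 'd" and g :: "'d \<Rightarrow> 'e"
    using pmf_entropy_map_inj[of g "map_pmf f ?J"] inj_on_subset[OF that] by (simp add: map_pmf_comp)
  show "info_UX P W = pmf_entropy (map_pmf snd P) - expect q (\<lambda>u. pmf_entropy (map_pmf snd (r u)))"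
    using ent[of snd] unfolding info_UX_def mutual_info_entropy[OF fin] X U by (simp add: case_prod_unfold)
  have "pmf_entropy (map_pmf (\<lambda>(y, x, u). (y, u)) ?J) = pmf_entropy (map_pmf (\<lambda>(y, x, u). (u, y)) ?J)"
    using inj[of prod.swap "\<lambda>(y, x, u). (u, y)"] by (simp add: case_prod_unfold)
  then show "info_YU P W = pmf_entropy (map_pmf fst P) - expect q (\<lambda>u. pmf_entropy (map_pmf fst (r u)))"
    using ent[of fst] unfolding info_YU_def mutual_info_entropy[OF fin] Y U by (simp add: case_prod_unfold)
  have "pmf_entropy ?J = pmf_entropy (map_pmf (\<lambda>(y, x, u). (u, y, x)) ?J)"
    using inj[of "\<lambda>(y, x, u). (u, y, x)" id] by (simp add: inj_def)
  then show "pmf_entropy ?J = pmf_entropy q + expect q (\<lambda>u. pmf_entropy (r u))"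
    using ent[of "\<lambda>z. z"] by (simp add: case_prod_unfold)
  have "pmf_entropy (map_pmf (\<lambda>(y, x, u). (x, u)) ?J) = pmf_entropy (map_pmf (\<lambda>(y, x, u). (u, x)) ?J)"
    using inj[of prod.swap "\<lambda>(y, x, u). (u, x)"] by (simp add: case_prod_unfold)
  then show "pmf_entropy (map_pmf (\<lambda>(y, x, u). (x, u)) ?J) = pmf_entropy q + expect q (\<lambda>u. pmf_entropy (map_pmf snd (r u)))"
    using ent[of snd] by (simp add: case_prod_unfold)
qed

text \<open>With h = H(Y,X|U) and hX = H(X|U) the last inequality is H(Y|X) \<le> H(Y|X,U), which
  says that Y - X - U is Markov. Then I(U;X) = I(U;Y,X), and this is the H(P) - h of the rate
  condition. All conditions are closed and affine in the point.\<close>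

definition info_region :: "('y::finite \<times> 'x::finite) pmf \<Rightarrow> real \<Rightarrow> ((real ^ ('y \<times> 'x)) \<times> real \<times> real \<times> real) set" where
  "info_region P R = {(v, h, hX, hY) \<in> info_hull P. v = (\<chi> z. pmf P z) \<and> pmf_entropy P - h \<le> R \<and>
     pmf_entropy P - pmf_entropy (map_pmf snd P) \<le> h - hX}"

text \<open>Drawing U through W adds the same average entropy of \<open>W x\<close> to H(Y,X) and to
  H(X), because U sees only x. It cancels in the difference: H(P) - H(PX) = h - hX, and H(P) - h =
  H(PX) - hX is I(U;X).\<close>

lemma info_region_of_channel:
  fixes P :: "('y::finite \<times> 'x::finite) pmf"
  assumes W: "feasible_channel P R W"
  shows "\<exists>v h hX hY. (v, h, hX, hY) \<in> info_region P R \<and> info_YU P W = pmf_entropy (map_pmf fst P) - hY"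
proof -
  let ?J = "joint_YXU P W"
  have finW: "\<And>x. finite (set_pmf (W x))" and R: "info_UX P W \<le> R"
    using W by (auto simp: feasible_channel_def)
  have finJ: "finite (set_pmf ?J)" by (rule finite_set_joint_YXU) (rule finW)
  define q where "q = map_pmf (\<lambda>(y, x, u). u) ?J"
  define c where "c u = cond_pmf ?J {t. (case t of (y, x, u) \<Rightarrow> u) = u}" for u
  define r where "r u = map_pmf (\<lambda>(y, x, u). (y, x)) (c u)" for u
  have finq: "finite (set_pmf q)" using finJ by (simp add: q_def)
  have J: "?J = bind_pmf q c" unfolding q_def c_def by (rule bind_cond_pmf_fibre[symmetric])
  have setc: "set_pmf (c u) = set_pmf ?J \<inter> {t. (case t of (y, x, u) \<Rightarrow> u) = u}" if "u \<in> set_pmf q" for u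
    using that unfolding q_def c_def by (rule set_cond_pmf_fibre)
  have "c u = map_pmf (\<lambda>(y, x). (y, x, u)) (r u)" if "u \<in> set_pmf q" for u
    unfolding r_def map_pmf_comp using setc[OF that] by (intro map_pmf_idI[symmetric]) auto
  then have J': "?J = bind_pmf q (\<lambda>u. map_pmf (\<lambda>(y, x). (y, x, u)) (r u))"
    unfolding J by (intro bind_pmf_cong refl) auto
  have P: "P = bind_pmf q r"
    by (subst map_joint_YXU_fst[of P W, symmetric]) (simp add: J' map_bind_pmf map_pmf_comp case_prod_unfold)
  have setr: "set_pmf (r u) \<subseteq> set_pmf P" if "u \<in> set_pmf q" for u
    by (subst P) (use that in auto)
  have "((\<chi> z. expect q (\<lambda>u. (\<chi> z. pmf (r u) z) $ z)), expect q (\<lambda>u. pmf_entropy (r u)),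
     expect q (\<lambda>u. pmf_entropy (map_pmf snd (r u))), expect q (\<lambda>u. pmf_entropy (map_pmf fst (r u)))) \<in> info_hull P"
    by (rule info_hull_mix[OF finq]) (use info_point_in_hull[OF setr] in \<open>auto simp: info_point_def\<close>)
  moreover have "expect q (\<lambda>u. pmf (r u) z) = pmf P z" for z
    by (subst P) (rule pmf_bind[symmetric])
  moreover note mix = info_of_mixture[OF J' finq]
  moreover have "pmf_entropy ?J = pmf_entropy P + expect P (\<lambda>(y, x). pmf_entropy (W x))"
  proof -
    have "pmf_entropy ?J = pmf_entropy P + expect P (\<lambda>z. pmf_entropy (case z of (y, x) \<Rightarrow> map_pmf (\<lambda>u. (y, x, u)) (W x)))"
      unfolding joint_YXU_def by (rule pmf_entropy_bind[where \<phi> = "\<lambda>(y, x, u). (y, x)"]) (use finW in \<open>auto split: prod.splits\<close>)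
    also have "expect P (\<lambda>z. pmf_entropy (case z of (y, x) \<Rightarrow> map_pmf (\<lambda>u. (y, x, u)) (W x))) = expect P (\<lambda>(y, x). pmf_entropy (W x))"
      by (intro expect_cong) (auto intro!: pmf_entropy_map_inj simp: inj_on_def)
    finally show ?thesis .
  qed
  moreover have "pmf_entropy (map_pmf (\<lambda>(y, x, u). (x, u)) ?J) = pmf_entropy (map_pmf snd P) + expect P (\<lambda>(y, x). pmf_entropy (W x))"
  proof -
    have "map_pmf (\<lambda>(y, x, u). (x, u)) ?J = bind_pmf (map_pmf snd P) (\<lambda>x. map_pmf (Pair x) (W x))"
      by (simp add: joint_YXU_def map_bind_pmf bind_map_pmf map_pmf_comp case_prod_unfold)
    also have "pmf_entropy \<dots> = pmf_entropy (map_pmf snd P) + expect (map_pmf snd P) (\<lambda>x. pmf_entropy (map_pmf (Pair x) (W x)))"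
      by (rule pmf_entropy_bind[where \<phi> = fst]) (use finW in auto)
    also have "expect (map_pmf snd P) (\<lambda>x. pmf_entropy (map_pmf (Pair x) (W x))) = expect P (\<lambda>(y, x). pmf_entropy (W x))"
      unfolding integral_map_pmf by (intro expect_cong) (auto intro!: pmf_entropy_map_inj simp: inj_on_def)
    finally show ?thesis .
  qed
  ultimately show ?thesis using R unfolding info_region_def
    by (intro exI[of _ "\<chi> z. pmf P z"] exI[of _ "expect q (\<lambda>u. pmf_entropy (r u))"]
       exI[of _ "expect q (\<lambda>u. pmf_entropy (map_pmf snd (r u)))"]
       exI[of _ "expect q (\<lambda>u. pmf_entropy (map_pmf fst (r u)))"]) auto
qed

text \<open>Given U = i the pair has law \<open>r i\<close>; let \<open>s i\<close> have the same
  X-marginal, but with y drawn given x as under P. The Markov inequality says that the average of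
  D(r i || s i) is at most 0, so \<open>r i = s i\<close> for every i of positive weight, and W is
  read off by Bayes' rule.\<close>

lemma channel_of_info_region:
  fixes P :: "('y::finite \<times> 'x::finite) pmf"
  assumes k: "(v, h, hX, hY) \<in> info_region P R"
  shows "\<exists>W. feasible_channel P R W \<and> info_YU P W = pmf_entropy (map_pmf fst P) - hY"
proof -
  let ?PX = "map_pmf snd P"
  from k have k: "(v, h, hX, hY) \<in> info_hull P" "v = (\<chi> z. pmf P z)" "pmf_entropy P - h \<le> R"
    "pmf_entropy P - pmf_entropy ?PX \<le> h - hX" by (auto simp: info_region_def)
  obtain q :: "nat pmf" and r where q: "finite (set_pmf q)"
    and r: "\<And>i. i \<in> set_pmf q \<Longrightarrow> set_pmf (r i) \<subseteq> set_pmf P"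
    and vq: "\<And>z. v $ z = expect q (\<lambda>i. pmf (r i) z)" and hq: "h = expect q (\<lambda>i. pmf_entropy (r i))"
    and hXq: "hX = expect q (\<lambda>i. pmf_entropy (map_pmf snd (r i)))"
    and hYq: "hY = expect q (\<lambda>i. pmf_entropy (map_pmf fst (r i)))"
    using info_hull_explicit[OF k(1)] by blast
  have P: "P = bind_pmf q r"
    by (rule pmf_eqI) (use vq k(2) in \<open>simp add: pmf_bind\<close>)
  have EP: "expect P f = expect q (\<lambda>i. expect (r i) f)" for f
    by (subst (1) P, rule expect_bind) (use q in auto)
  \<comment> \<open>The channel from X to Y under P, kept as a law on pairs so that it can be
    attached to any law of x.\<close>
  define K where "K x = cond_pmf P {z. snd z = x}" for x
  have setK: "set_pmf (K x) = set_pmf P \<inter> {z. snd z = x}" if "x \<in> set_pmf ?PX" for x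
    using that unfolding K_def by (rule set_cond_pmf_fibre)
  have pmfK: "pmf (K (snd z)) z = pmf P z / pmf ?PX (snd z)" if "snd z \<in> set_pmf ?PX" for z
  proof -
    have "set_pmf P \<inter> {w. snd w = snd z} \<noteq> {}" using that by auto
    then show ?thesis by (simp add: K_def pmf_cond pmf_map vimage_def)
  qed
  define rX where "rX i = map_pmf snd (r i)" for i
  define s where "s i = bind_pmf (rX i) K" for i
  have rX: "set_pmf (rX i) \<subseteq> set_pmf ?PX" if "i \<in> set_pmf q" for i
    using r[OF that] by (auto simp: rX_def)
  have pmfs: "pmf (s i) z = pmf (rX i) (snd z) * (pmf P z / pmf ?PX (snd z))" if i: "i \<in> set_pmf q" for i z
  proof (cases "snd z \<in> set_pmf (rX i)")
    case True
    have "snd b = m" if "m \<in> set_pmf (rX i)" "b \<in> set_pmf (K m)" for m b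
      using setK[of m] rX[OF i] that by blast
    then
    have "pmf (s i) z = pmf (rX i) (snd z) * pmf (K (snd z)) z"
      unfolding s_def by (rule pmf_bind_disjoint) (use True in auto)
    moreover have "snd z \<in> set_pmf ?PX" using rX[OF i] True by blast
    ultimately show ?thesis using pmfK[of z] by simp
  next
    case False
    have "z \<notin> set_pmf (s i)"
    proof
      assume "z \<in> set_pmf (s i)"
      then obtain m where m: "m \<in> set_pmf (rX i)" "z \<in> set_pmf (K m)" by (auto simp: s_def)
      then have "snd z = m" using setK[OF subsetD[OF rX[OF i] m(1)]] by blast
      then show False using m False by simp
    qed
    then show ?thesis using False by (simp add: set_pmf_iff)
  qed
  let ?V = "\<lambda>z. pmf P z / pmf ?PX (snd z)"
  \<comment> \<open>This is D(r i || s i): the logarithm of \<open>s i\<close> splits into those of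
    \<open>?V\<close> and of \<open>rX i\<close>, and the mean of -ln of the latter is the entropy
    of \<open>rX i\<close>.\<close>
  define D where "D i = expect (r i) (\<lambda>z. - ln (?V z)) - pmf_entropy (r i) + pmf_entropy (rX i)" for i
  have ex: "expect (r i) (\<lambda>z. - ln (pmf (s i) z)) = expect (r i) (\<lambda>z. - ln (?V z)) + pmf_entropy (rX i)"
    and sub: "set_pmf (r i) \<subseteq> set_pmf (s i)" if i: "i \<in> set_pmf q" for i
  proof -
    have pos: "0 < pmf (rX i) (snd z)" "0 < ?V z" if "z \<in> set_pmf (r i)" for z
      using that r[OF i] by (auto simp: rX_def intro!: divide_pos_pos pmf_positive)
    then show "set_pmf (r i) \<subseteq> set_pmf (s i)"
      using pmfs[OF i] by (force simp: set_pmf_iff)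
    have "expect (r i) (\<lambda>z. - ln (pmf (s i) z)) = expect (r i) (\<lambda>z. - ln (?V z) + (- ln (pmf (rX i) (snd z))))"
    proof (rule expect_cong)
      fix z assume "z \<in> set_pmf (r i)"
      from pos[OF this] show "- ln (pmf (s i) z) = - ln (?V z) + (- ln (pmf (rX i) (snd z)))"
        unfolding pmfs[OF i] by (simp only: ln_mult_pos)
    qed
    also have "\<dots> = expect (r i) (\<lambda>z. - ln (?V z)) + pmf_entropy (rX i)"
      unfolding rX_def pmf_entropy_map by (rule expect_add) simp
    finally show "expect (r i) (\<lambda>z. - ln (pmf (s i) z)) = expect (r i) (\<lambda>z. - ln (?V z)) + pmf_entropy (rX i)" .
  qed
  have D0: "0 \<le> D i" if "i \<in> set_pmf q" for i
    using gibbs_pmf[of "r i" "s i"] ex[OF that] sub[OF that] by (simp add: D_def)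
  have "expect q D = expect P (\<lambda>z. - ln (?V z)) - h + hX"
    unfolding D_def hq hXq EP rX_def[symmetric] using q by (subst expect_add, simp, subst expect_diff) auto
  also have "expect P (\<lambda>z. - ln (?V z)) = expect P (\<lambda>z. - ln (pmf P z) - (- ln (pmf ?PX (snd z))))"
    by (intro expect_cong) (auto simp: ln_div pmf_eq_0_set_pmf)
  also have "\<dots> = pmf_entropy P - pmf_entropy ?PX"
    unfolding pmf_entropy_map unfolding pmf_entropy_def by (rule expect_diff) simp
  finally have eD: "(\<Sum>i\<in>set_pmf q. pmf q i * D i) = pmf_entropy P - pmf_entropy ?PX - h + hX"
    using expect_sum[OF q subset_refl, of D] by simp
  moreover have "0 \<le> (\<Sum>i\<in>set_pmf q. pmf q i * D i)"
    by (intro sum_nonneg mult_nonneg_nonneg D0) auto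
  ultimately have e0: "(\<Sum>i\<in>set_pmf q. pmf q i * D i) = 0" using k(4) by linarith
  then have "\<forall>i\<in>set_pmf q. pmf q i * D i = 0"
    by (subst (asm) sum_nonneg_eq_0_iff) (use q D0 in \<open>auto intro!: mult_nonneg_nonneg\<close>)
  then have Dz: "D i = 0" if "i \<in> set_pmf q" for i using that pmf_positive[OF that] by force
  have rs: "r i = s i" if "i \<in> set_pmf q" for i
    using ex[OF that] sub[OF that] Dz[OF that] by (intro gibbs_pmf_eq) (auto simp: D_def)
  \<comment> \<open>Bayes' rule for U given X = x. Off the support of X a point mass is taken, since
    a feasible channel has finite support at every x.\<close>
  have "\<exists>W. \<forall>x. finite (set_pmf (W x)) \<and>
    (x \<in> set_pmf ?PX \<longrightarrow> (\<forall>i. pmf (W x) i = pmf q i * pmf (rX i) x / pmf ?PX x))"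
  proof (intro choice allI)
    fix x
    show "\<exists>w. finite (set_pmf w) \<and> (x \<in> set_pmf ?PX \<longrightarrow> (\<forall>i. pmf w i = pmf q i * pmf (rX i) x / pmf ?PX x))"
    proof (cases "x \<in> set_pmf ?PX")
    case True
    have "?PX = bind_pmf q rX" by (subst P) (simp add: map_bind_pmf rX_def[abs_def])
    then have "pmf ?PX x = expect q (\<lambda>i. pmf (rX i) x)" by (simp add: pmf_bind)
    then have "(\<Sum>i\<in>set_pmf q. pmf q i * pmf (rX i) x) = pmf ?PX x"
      by (simp add: expect_sum[OF q subset_refl])
    then have "(\<Sum>i\<in>set_pmf q. pmf q i * pmf (rX i) x / pmf ?PX x) = 1"
      using pmf_positive[OF True] by (simp add: sum_divide_distrib[symmetric])
    then obtain w where w: "set_pmf w \<subseteq> set_pmf q" "\<forall>i\<in>set_pmf q. pmf w i = pmf q i * pmf (rX i) x / pmf ?PX x"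
      using ex_pmf_of_weights[OF q, of "\<lambda>i. pmf q i * pmf (rX i) x / pmf ?PX x"] by auto
    have "pmf w i = pmf q i * pmf (rX i) x / pmf ?PX x" for i
      using w by (cases "i \<in> set_pmf q") (auto simp: set_pmf_iff)
    then show ?thesis using w(1) q finite_subset by blast
    qed (auto intro!: exI[of _ "return_pmf 0"])
  qed
  then obtain W where W0: "\<forall>x. finite (set_pmf (W x)) \<and>
    (x \<in> set_pmf ?PX \<longrightarrow> (\<forall>i. pmf (W x) i = pmf q i * pmf (rX i) x / pmf ?PX x))"
    by (rule exE)
  have finW: "finite (set_pmf (W x))" for x
    by (rule conjunct1[OF spec[OF W0, of x]])
  have W: "pmf (W x) i = pmf q i * pmf (rX i) x / pmf ?PX x" if "x \<in> set_pmf ?PX" for x i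
    by (rule mp[OF conjunct2[OF spec[OF W0, of x]] that, THEN spec, of i])
  \<comment> \<open>At (y, x, i) the left side is P(y, x) times the Bayes quotient, which is q i
    times \<open>s i\<close> at (y, x); since \<open>s i\<close> equals \<open>r i\<close> this is
    the right side.\<close>
  have J: "joint_YXU P W = bind_pmf q (\<lambda>u. map_pmf (\<lambda>(y, x). (y, x, u)) (r u))"
  proof (rule pmf_eqI, clarify)
    fix y x i
    have L: "pmf (joint_YXU P W) (y, x, i) = pmf P (y, x) * pmf (W x) i"
    proof (cases "(y, x) \<in> set_pmf P")
      case True
      have "pmf (joint_YXU P W) (y, x, i) = pmf P (y, x) * pmf (map_pmf (\<lambda>u. (y, x, u)) (W x)) (y, x, i)"
        unfolding joint_YXU_def
        by (subst pmf_bind_disjoint[where \<phi> = "\<lambda>(y, x, u). (y, x)"]) (use True in auto)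
      also have "pmf (map_pmf (\<lambda>u. (y, x, u)) (W x)) (y, x, i) = pmf (W x) i"
        using pmf_map_inj'[of "\<lambda>u. (y, x, u)" "W x" i] by (simp add: inj_def)
      finally show ?thesis .
    next
      case False
      then have "(y, x, i) \<notin> set_pmf (joint_YXU P W)" by (auto simp: joint_YXU_def)
      then show ?thesis using False by (simp add: set_pmf_iff)
    qed
    have M: "pmf (bind_pmf q (\<lambda>u. map_pmf (\<lambda>(y, x). (y, x, u)) (r u))) (y, x, i) = pmf q i * pmf (r i) (y, x)"
    proof (cases "i \<in> set_pmf q")
      case True
      have "pmf (bind_pmf q (\<lambda>u. map_pmf (\<lambda>(y, x). (y, x, u)) (r u))) (y, x, i)
        = pmf q i * pmf (map_pmf (\<lambda>(y, x). (y, x, i)) (r i)) (y, x, i)"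
        by (subst pmf_bind_disjoint[where \<phi> = "\<lambda>(y, x, u). u"]) (use True in auto)
      also have "pmf (map_pmf (\<lambda>(y, x). (y, x, i)) (r i)) (y, x, i) = pmf (r i) (y, x)"
        using pmf_map_inj'[of "\<lambda>(y, x). (y, x, i)" "r i" "(y, x)"] by (simp add: inj_def)
      finally show ?thesis .
    next
      case False
      then have "(y, x, i) \<notin> set_pmf (bind_pmf q (\<lambda>u. map_pmf (\<lambda>(y, x). (y, x, u)) (r u)))" by auto
      then show ?thesis using False by (simp add: set_pmf_iff del: set_bind_pmf set_map_pmf)
    qed
    have "pmf P (y, x) * pmf (W x) i = pmf q i * pmf (r i) (y, x)"
    proof (cases "i \<in> set_pmf q")
      case i: True
      show ?thesis
      proof (cases "x \<in> set_pmf ?PX")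
        case True
        then show ?thesis unfolding W[OF True] rs[OF i] pmfs[OF i] by simp
      next
        case False
        then have "(y, x) \<notin> set_pmf P" by force
        then show ?thesis using r[OF i] by (auto simp: set_pmf_iff subset_iff)
      qed
    next
      case False
      then show ?thesis using W[of x i] by (cases "x \<in> set_pmf ?PX") (force simp: set_pmf_iff)+
    qed
    then show "pmf (joint_YXU P W) (y, x, i) = pmf (bind_pmf q (\<lambda>u. map_pmf (\<lambda>(y, x). (y, x, u)) (r u))) (y, x, i)"
      by (simp only: L M)
  qed
  note mix = info_of_mixture[OF J q]
  have "info_UX P W \<le> R" using mix(1) k(3) eD e0 hXq by (simp add: rX_def)
  then have "feasible_channel P R W" using finW by (simp add: feasible_channel_def)
  then show ?thesis using mix(2) hYq by auto
qed

text \<open>Maximising I(Y;U) means minimising hY on a compact set. The bound covers all points of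
  the region besides feasible channels, because the converse produces points.\<close>

lemma ex_max_channel:
  fixes P :: "('y::finite \<times> 'x::finite) pmf"
  assumes R: "0 \<le> R"
  shows "\<exists>W. is_arg_max (info_YU P) (feasible_channel P R) W \<and>
    (\<forall>(v, h, hX, hY)\<in>info_region P R. pmf_entropy (map_pmf fst P) - hY \<le> info_YU P W)"
proof -
  have eq: "info_region P R = info_hull P \<inter> {k. fst k = (\<chi> z. pmf P z) \<and> pmf_entropy P - fst (snd k) \<le> R \<and>
     pmf_entropy P - pmf_entropy (map_pmf snd P) \<le> fst (snd k) - fst (snd (snd k))}"
    by (auto simp: info_region_def)
  have cl: "closed {k :: (real ^ ('y \<times> 'x)) \<times> real \<times> real \<times> real. fst k = (\<chi> z. pmf P z) \<and> pmf_entropy P - fst (snd k) \<le> R \<and>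
     pmf_entropy P - pmf_entropy (map_pmf snd P) \<le> fst (snd k) - fst (snd (snd k))}"
    by (intro closed_Collect_conj closed_Collect_eq closed_Collect_le continuous_intros)
  have cpt: "compact (info_region P R)"
    unfolding eq by (rule compact_Int_closed[OF compact_info_hull cl])
  \<comment> \<open>The constant auxiliary variable, which has rate 0; here R \<ge> 0
    enters.\<close>
  have "info_point P \<in> info_region P R"
    using R info_point_in_hull[of P P] by (simp add: info_region_def info_point_def)
  then have ne: "info_region P R \<noteq> {}" by auto
  have "continuous_on (info_region P R) (\<lambda>k. snd (snd (snd k)))" by (intro continuous_intros)
  from continuous_attains_inf[OF cpt ne this] obtain k0 where k0: "k0 \<in> info_region P R"
    "\<forall>k\<in>info_region P R. snd (snd (snd k0)) \<le> snd (snd (snd k))" by blast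
  obtain v h hX hY where "k0 = (v, h, hX, hY)" by (cases k0)
  with k0 have k: "(v, h, hX, hY) \<in> info_region P R"
    and min: "\<And>k. k \<in> info_region P R \<Longrightarrow> hY \<le> snd (snd (snd k))" by auto
  obtain W where W: "feasible_channel P R W" "info_YU P W = pmf_entropy (map_pmf fst P) - hY"
    using channel_of_info_region[OF k] by blast
  have "info_YU P W' \<le> info_YU P W" if "feasible_channel P R W'" for W'
    using info_region_of_channel[OF that] min W(2) by fastforce
  moreover have "\<forall>(v, h, hX, hY)\<in>info_region P R. pmf_entropy (map_pmf fst P) - hY \<le> info_YU P W"
    using min W(2) by fastforce
  ultimately show ?thesis using W(1) by (intro exI[of _ W]) (auto simp: is_arg_max_def not_less)
qed

section \<open>Strong converse for one block\<close>

lemma map_replicate_pmf: "map_pmf (map f) (replicate_pmf n p) = replicate_pmf n (map_pmf f p)"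
proof (induction n)
  case (Suc n)
  then show ?case by (simp add: Suc[symmetric] bind_map_pmf map_bind_pmf)
qed simp

lemma pmf_replicate_Cons:
  "pmf (replicate_pmf (Suc n) p) (x # xs) = pmf p x * pmf (replicate_pmf n p) xs"
proof -
  have "replicate_pmf (Suc n) p = map_pmf (\<lambda>(x, xs). x # xs) (pair_pmf p (replicate_pmf n p))"
    by (simp add: pair_pmf_def map_pmf_def bind_assoc_pmf bind_return_pmf)
  moreover have "pmf (map_pmf (\<lambda>(x, xs). x # xs) (pair_pmf p (replicate_pmf n p))) ((\<lambda>(x, xs). x # xs) (x, xs))
      = pmf (pair_pmf p (replicate_pmf n p)) (x, xs)"
    by (rule pmf_map_inj') (auto simp: inj_def)
  ultimately show ?thesis by (simp add: pmf_pair)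
qed

lemma pmf_replicate:
  "length xs = n \<Longrightarrow> pmf (replicate_pmf n p) xs = prod_list (map (pmf p) xs)"
  by (induction xs arbitrary: n) (auto simp: pmf_replicate_Cons simp del: replicate_pmf.simps(2))

lemma neg_ln_pmf_replicate:
  assumes "xs \<in> set_pmf (replicate_pmf n p)"
  shows "- ln (pmf (replicate_pmf n p) xs) = (\<Sum>x\<leftarrow>xs. - ln (pmf p x))"
proof -
  have "length xs = n" "set xs \<subseteq> set_pmf p" using assms by (auto simp: set_replicate_pmf)
  then show ?thesis
  proof (induction xs arbitrary: n)
    case (Cons x xs)
    then have "0 < pmf p x" "0 < pmf (replicate_pmf (length xs) p) xs"
      by (auto intro!: pmf_positive simp: set_replicate_pmf)
    then show ?case using Cons.IH[of "length xs"] Cons.prems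
      by (auto simp: pmf_replicate_Cons ln_mult simp del: replicate_pmf.simps(2))
  qed simp
qed

lemma finite_set_replicate_pmf: "finite (set_pmf p) \<Longrightarrow> finite (set_pmf (replicate_pmf n p))"
  using finite_lists_length_eq[of "set_pmf p" n] by (simp add: set_replicate_pmf lists_eq_set)

lemma measure_cond_pmf:
  assumes "set_pmf p \<inter> A \<noteq> {}"
  shows "measure (cond_pmf p A) B = measure p (A \<inter> B) / measure p A"
  using assms unfolding cond_pmf.rep_eq[OF assms]
  by (subst measure_uniform_measure) (auto simp: measure_pmf.emeasure_eq_measure measure_pmf_zero_iff)

text \<open>All estimates are made under P to the n conditioned on acceptance, whose relative
  entropy to the unconditioned law is exactly -ln a. In order they concern the rate, the violation
  of the Markov condition, the divergence of the letter average v from P, and the exponent. The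
  auxiliary variable is the message with a random position and the pairs before it.\<close>

lemma converse_block:
  fixes P :: "('y::finite \<times> 'x::finite) pmf" and \<phi> :: "'x list \<Rightarrow> 'm" and A :: "('y list \<times> 'm) set"
  defines "PY \<equiv> map_pmf fst P" and "PX \<equiv> map_pmf snd P"
  assumes n: "0 < n"
    and M: "finite M" "\<phi> \<in> {xs. length xs = n} \<rightarrow> M"
    and a: "0 < a" "a = measure (replicate_pmf n P) {zs. (map fst zs, \<phi> (map snd zs)) \<in> A}"
    and \<beta>: "\<beta> = measure (pair_pmf (replicate_pmf n PY) (map_pmf \<phi> (replicate_pmf n PX))) A"
  shows "\<exists>v h hX hY. (v, h, hX, hY) \<in> info_hull P \<and>
    real n * (cross_entropy v (pmf P) - h) \<le> ln (real (card M)) - ln a \<and>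
    real n * (cross_entropy v (pmf P) - cross_entropy v (\<lambda>z. pmf PX (snd z)) - (h - hX)) \<le> - ln a \<and>
    real n * (cross_entropy v (pmf P) - vec_entropy v) \<le> - ln a \<and>
    0 < \<beta> \<and> - ln \<beta> \<le> real n * (cross_entropy v (\<lambda>z. pmf PY (fst z)) - hY) - ln a"
proof -
  define Pn where "Pn = replicate_pmf n P"
  define \<psi> where "\<psi> zs = \<phi> (map snd zs)" for zs :: "('y \<times> 'x) list"
  define acc where "acc = {zs. (map fst zs, \<psi> zs) \<in> A}"
  define Pt where "Pt = cond_pmf Pn acc"
  define q where "q = map_pmf \<psi> Pt"
  define r where "r m = cond_pmf Pt {zs. \<psi> zs = m}" for m
  have a': "a = measure Pn acc" by (simp add: a(2) Pn_def acc_def \<psi>_def)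
  then have ne: "set_pmf Pn \<inter> acc \<noteq> {}" using a(1) measure_pmf_zero_iff[of Pn acc] by auto
  have setPn: "length zs = n \<and> set zs \<subseteq> set_pmf P" if "zs \<in> set_pmf Pn" for zs
    using that by (auto simp: Pn_def set_replicate_pmf)
  have setPt: "set_pmf Pt = set_pmf Pn \<inter> acc" unfolding Pt_def using ne by (rule set_cond_pmf)
  have len: "length zs = n \<and> set zs \<subseteq> set_pmf P" if "zs \<in> set_pmf Pt" for zs
    using that setPt setPn by auto
  have finPt: "finite (set_pmf Pt)" using len by (intro finite_set_pmf_lists) auto
  then have finq: "finite (set_pmf q)" by (simp add: q_def)
  have Pt: "Pt = bind_pmf q r" unfolding q_def r_def by (rule bind_cond_pmf_fibre[symmetric])
  have setr: "set_pmf (r m) = set_pmf Pt \<inter> {zs. \<psi> zs = m}" if "m \<in> set_pmf q" for m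
    using that unfolding q_def r_def by (rule set_cond_pmf_fibre)
  have finr: "finite (set_pmf (r m))" if "m \<in> set_pmf q" for m using setr[OF that] finPt by auto
  define good where "good m v h hX hY \<longleftrightarrow> single_letter_point P n (r m) v h hX hY" for m v h hX hY
  have "\<forall>m\<in>set_pmf q. \<exists>v h hX hY. good m v h hX hY"
    unfolding good_def by (intro ballI single_letterization) (use setr len in auto)
  then obtain v h hX hY where "\<And>m. m \<in> set_pmf q \<Longrightarrow> good m (v m) (h m) (hX m) (hY m)"
    by metis
  then have G: "\<And>m. m \<in> set_pmf q \<Longrightarrow> (v m, h m, hX m, hY m) \<in> info_hull P"
    "\<And>m f. m \<in> set_pmf q \<Longrightarrow> expect (r m) (\<lambda>zs. sum_list (map f zs)) = real n * (\<Sum>w\<in>UNIV. v m $ w * f w)"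
    "\<And>m. m \<in> set_pmf q \<Longrightarrow> pmf_entropy (r m) = real n * h m"
    "\<And>m. m \<in> set_pmf q \<Longrightarrow> real n * hX m \<le> pmf_entropy (map_pmf (map snd) (r m))"
    "\<And>m. m \<in> set_pmf q \<Longrightarrow> real n * hY m \<le> pmf_entropy (map_pmf (map fst) (r m))"
    by (auto simp: good_def)
  define v' where "v' = (\<chi> z. expect q (\<lambda>m. v m $ z))"
  have mix: "(v', expect q h, expect q hX, expect q hY) \<in> info_hull P"
    unfolding v'_def by (rule info_hull_mix) (use finq G in auto)
  define S where "S f = (\<Sum>z\<in>UNIV. v' $ z * f z)" for f :: "'y \<times> 'x \<Rightarrow> real"
  have ES: "expect Pt (\<lambda>zs. sum_list (map f zs)) = real n * S f" for f
  proof -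
    have "expect Pt (\<lambda>zs. sum_list (map f zs)) = expect q (\<lambda>m. expect (r m) (\<lambda>zs. sum_list (map f zs)))"
      unfolding Pt by (rule expect_bind) (use finq finr in auto)
    also have "\<dots> = expect q (\<lambda>m. real n * (\<Sum>w\<in>UNIV. v m $ w * f w))"
      by (intro expect_cong G)
    also have "\<dots> = real n * S f"
      using finq by (simp add: expect_sum_right S_def v'_def)
    finally show ?thesis .
  qed
  \<comment> \<open>The density of the conditioned law with respect to P to the n is constantly 1/a
    on its support, so this is an identity and not just a bound.\<close>
  have entPt: "real n * S (\<lambda>z. - ln (pmf P z)) = pmf_entropy Pt - ln a"
  proof -
    have "pmf_entropy Pt = expect Pt (\<lambda>zs. (\<Sum>z\<leftarrow>zs. - ln (pmf P z)) + ln a)"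
      unfolding pmf_entropy_def
    proof (rule expect_cong)
      fix zs assume "zs \<in> set_pmf Pt"
      then have zs: "zs \<in> set_pmf Pn" "zs \<in> acc" using setPt by auto
      then have "pmf Pt zs = pmf Pn zs / a" by (simp add: Pt_def pmf_cond[OF ne] a')
      then have "- ln (pmf Pt zs) = - ln (pmf Pn zs) + ln a"
        using pmf_positive[OF zs(1)] a(1) by (simp add: ln_div)
      then show "- ln (pmf Pt zs) = (\<Sum>z\<leftarrow>zs. - ln (pmf P z)) + ln a"
        using neg_ln_pmf_replicate[of zs n P] zs(1) unfolding Pn_def by simp
    qed
    also have "\<dots> = real n * S (\<lambda>z. - ln (pmf P z)) + ln a"
      by (subst expect_add) (use finPt ES in auto)
    finally show ?thesis by simp
  qed
  have chain: "pmf_entropy Pt = pmf_entropy q + real n * expect q h"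
  proof -
    have "pmf_entropy Pt = pmf_entropy q + expect q (\<lambda>m. pmf_entropy (r m))"
      unfolding Pt by (rule pmf_entropy_bind[where \<phi> = \<psi>]) (use finq finr setr in auto)
    also have "expect q (\<lambda>m. pmf_entropy (r m)) = expect q (\<lambda>m. real n * h m)"
      by (intro expect_cong G)
    finally show ?thesis by simp
  qed
  \<comment> \<open>The message is a function of the x-block, so adjoining it changes no entropy.
    For the y-block it has to stay as a second component.\<close>
  have chainX: "pmf_entropy q + real n * expect q hX \<le> pmf_entropy (map_pmf (map snd) Pt)"
  proof -
    have "real n * expect q hX \<le> expect q (\<lambda>m. pmf_entropy (map_pmf (map snd) (r m)))"
      using expect_mono[OF finq G(4)] by simp
    moreover have "pmf_entropy (bind_pmf q (\<lambda>m. map_pmf (map snd) (r m)))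
        = pmf_entropy q + expect q (\<lambda>m. pmf_entropy (map_pmf (map snd) (r m)))"
      by (rule pmf_entropy_bind[where \<phi> = \<phi>]) (use finq finr setr in \<open>auto simp: \<psi>_def\<close>)
    ultimately show ?thesis by (simp add: Pt map_bind_pmf)
  qed
  define law where "law = map_pmf (\<lambda>zs. (map fst zs, \<psi> zs)) Pt"
  have chainY: "pmf_entropy q + real n * expect q hY \<le> pmf_entropy law"
  proof -
    have "real n * expect q hY \<le> expect q (\<lambda>m. pmf_entropy (map_pmf (map fst) (r m)))"
      using expect_mono[OF finq G(5)] by simp
    also have "\<dots> = expect q (\<lambda>m. pmf_entropy (map_pmf (\<lambda>ys. (ys, m)) (map_pmf (map fst) (r m))))"
      by (intro expect_cong pmf_entropy_map_inj[symmetric]) (auto simp: inj_on_def)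
    finally have "pmf_entropy q + real n * expect q hY
      \<le> pmf_entropy (bind_pmf q (\<lambda>m. map_pmf (\<lambda>ys. (ys, m)) (map_pmf (map fst) (r m))))"
      by (subst pmf_entropy_bind[where \<phi> = snd]) (use finq finr in auto)
    also have "bind_pmf q (\<lambda>m. map_pmf (\<lambda>ys. (ys, m)) (map_pmf (map fst) (r m))) = law"
      unfolding law_def Pt map_bind_pmf map_pmf_comp
      by (intro bind_pmf_cong map_pmf_cong refl) (use setr in auto)
    finally show ?thesis .
  qed
  have gX: "pmf_entropy (map_pmf (map snd) Pt) \<le> real n * S (\<lambda>z. - ln (pmf PX (snd z)))"
  proof -
    have sub: "set_pmf (map_pmf (map snd) Pt) \<subseteq> set_pmf (replicate_pmf n PX)"
      using len by (force simp: set_replicate_pmf PX_def)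
    have "pmf_entropy (map_pmf (map snd) Pt) \<le> expect Pt (\<lambda>zs. - ln (pmf (replicate_pmf n PX) (map snd zs)))"
      using gibbs_pmf[OF _ sub] finPt by simp
    also have "\<dots> = expect Pt (\<lambda>zs. sum_list (map (\<lambda>z. - ln (pmf PX (snd z))) zs))"
      by (intro expect_cong, subst neg_ln_pmf_replicate) (use sub in \<open>auto simp: comp_def\<close>)
    finally show ?thesis by (simp only: ES)
  qed
  have entq: "pmf_entropy q \<le> ln (real (card M))"
    by (rule pmf_entropy_le_ln_card) (use M len in \<open>auto simp: q_def \<psi>_def\<close>)
  \<comment> \<open>The entropy of a block is at most n times the entropy of the average letter law:
    Gibbs against the product of \<open>rbar\<close>, whose weights are v'. A letter of weight 0
    never occurs in the block, as its expected number of occurrences is 0.\<close>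
  have gv: "pmf_entropy Pt \<le> real n * vec_entropy v'"
  proof -
    obtain qq :: "nat pmf" and rr where "\<And>z. v' $ z = expect qq (\<lambda>i. pmf (rr i) z)"
      by (rule info_hull_explicit[OF mix]) (rule that, assumption)
    then have rb: "pmf (bind_pmf qq rr) z = v' $ z" for z by (simp add: pmf_bind)
    define rbar where "rbar = bind_pmf qq rr"
    have "z \<in> set_pmf rbar" if zs: "zs \<in> set_pmf Pt" "z \<in> set zs" for zs z
    proof (rule ccontr)
      assume "z \<notin> set_pmf rbar"
      then have "pmf rbar z = 0" by (simp add: set_pmf_iff)
      then have "v' $ z = 0" using rb[of z] by (simp only: rbar_def)
      then have "S (indicator {z}) = 0"
        unfolding S_def by (intro sum.neutral) (auto simp: indicator_def)
      then have "(\<Sum>zs\<in>set_pmf Pt. pmf Pt zs * sum_list (map (indicator {z}) zs)) = 0"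
        using ES[of "indicator {z}"] expect_sum[OF finPt subset_refl] by simp
      then have "pmf Pt zs * sum_list (map (indicator {z} :: _ \<Rightarrow> real) zs) = 0"
        using zs(1) finPt by (subst (asm) sum_nonneg_eq_0_iff) (auto intro!: mult_nonneg_nonneg sum_list_nonneg)
      then have "sum_list (map (indicator {z} :: _ \<Rightarrow> real) zs) = 0" using pmf_positive[OF zs(1)] by simp
      then have "\<forall>x\<in>set (map (indicator {z} :: _ \<Rightarrow> real) zs). x = 0"
        by (subst (asm) sum_list_nonneg_eq_0_iff) auto
      then show False using zs(2) by force
    qed
    then have sub: "set_pmf Pt \<subseteq> set_pmf (replicate_pmf n rbar)"
      using len by (auto simp: set_replicate_pmf)
    have "pmf_entropy Pt \<le> expect Pt (\<lambda>zs. - ln (pmf (replicate_pmf n rbar) zs))"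
      by (rule gibbs_pmf) (use finPt sub in auto)
    also have "\<dots> = expect Pt (\<lambda>zs. sum_list (map (\<lambda>z. - ln (v' $ z)) zs))"
      by (intro expect_cong, subst neg_ln_pmf_replicate) (use sub rb in \<open>auto simp: rbar_def\<close>)
    also have "\<dots> = real n * vec_entropy v'"
      by (simp only: ES) (simp add: S_def vec_entropy_def)
    finally show ?thesis .
  qed
  define PYn where "PYn = replicate_pmf n PY"
  define PM where "PM = map_pmf \<phi> (replicate_pmf n PX)"
  have fY: "map fst zs \<in> set_pmf PYn" and fM: "\<psi> zs \<in> set_pmf PM" if "zs \<in> set_pmf Pt" for zs
    using len[OF that] by (force simp: PYn_def PM_def set_replicate_pmf \<psi>_def PY_def PX_def)+
  have finlaw: "finite (set_pmf law)" using finPt by (simp add: law_def)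
  have lawA: "set_pmf law \<subseteq> A" using setPt by (auto simp: law_def acc_def)
  have \<beta>': "\<beta> = measure (pair_pmf PYn PM) A" by (simp add: \<beta> PYn_def PM_def)
  have sumlaw: "sum (pmf (pair_pmf PYn PM)) (set_pmf law) \<le> \<beta>"
    unfolding \<beta>' measure_measure_pmf_finite[OF finlaw, symmetric]
    by (intro measure_pmf.finite_measure_mono lawA) auto
  have poslaw: "0 < pmf (pair_pmf PYn PM) t" if "t \<in> set_pmf law" for t
    using that fY fM by (auto simp: law_def intro!: pmf_positive)
  have "0 < sum (pmf (pair_pmf PYn PM)) (set_pmf law)"
    using finlaw poslaw set_pmf_not_empty[of law] by (intro sum_pos) auto
  then have \<beta>0: "0 < \<beta>" using sumlaw by simp
  \<comment> \<open>The conditioned law of (y, message) lives on A, to which the product reference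
    gives mass \<beta>. The masses divided by \<beta> are admissible weights in Gibbs' inequality,
    and this bounds the relative entropy below by -ln \<beta>.\<close>
  have "pmf_entropy law \<le> expect law (\<lambda>t. - ln (pmf (pair_pmf PYn PM) t / \<beta>))"
    by (rule gibbs_inequality)
      (use finlaw poslaw \<beta>0 sumlaw in \<open>auto simp: sum_divide_distrib[symmetric]\<close>)
  also have "\<dots> = expect Pt (\<lambda>zs. - ln (pmf PYn (map fst zs)) + - ln (pmf PM (\<psi> zs)) + ln \<beta>)"
    unfolding law_def integral_map_pmf
  proof (rule expect_cong)
    fix zs assume "zs \<in> set_pmf Pt"
    then have "0 < pmf PYn (map fst zs)" "0 < pmf PM (\<psi> zs)" using fY fM by (auto intro!: pmf_positive)
    then show "- ln (pmf (pair_pmf PYn PM) (map fst zs, \<psi> zs) / \<beta>)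
      = - ln (pmf PYn (map fst zs)) + - ln (pmf PM (\<psi> zs)) + ln \<beta>"
      using \<beta>0 by (simp add: pmf_pair ln_div ln_mult)
  qed
  also have "\<dots> = expect Pt (\<lambda>zs. - ln (pmf PYn (map fst zs))) + expect Pt (\<lambda>zs. - ln (pmf PM (\<psi> zs))) + ln \<beta>"
    by (subst expect_add, rule finPt, subst expect_add, rule finPt) simp
  also have "expect Pt (\<lambda>zs. - ln (pmf PYn (map fst zs))) = expect Pt (\<lambda>zs. sum_list (map (\<lambda>z. - ln (pmf PY (fst z))) zs))"
    unfolding PYn_def
    by (intro expect_cong, subst neg_ln_pmf_replicate) (use fY in \<open>auto simp: comp_def PYn_def\<close>)
  \<comment> \<open>Conditioning on an event of probability a raises the probability of a message by
    a factor of at most 1/a; trading its unconditioned law for the conditioned one costs a single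
    -ln a.\<close>
  also have "expect Pt (\<lambda>zs. - ln (pmf PM (\<psi> zs))) \<le> expect Pt (\<lambda>zs. - ln (pmf q (\<psi> zs)) + - ln a)"
  proof (intro expect_mono finPt)
    fix zs assume zs: "zs \<in> set_pmf Pt"
    have q0: "0 < pmf q (\<psi> zs)" using zs by (intro pmf_positive) (auto simp: q_def)
    have "pmf q (\<psi> zs) = measure Pn (acc \<inter> \<psi> -` {\<psi> zs}) / a"
      by (simp add: q_def pmf_map Pt_def measure_cond_pmf[OF ne] a')
    also have "\<dots> \<le> measure Pn (\<psi> -` {\<psi> zs}) / a"
      using a(1) by (intro divide_right_mono measure_pmf.finite_measure_mono) auto
    also have "measure Pn (\<psi> -` {\<psi> zs}) = pmf PM (\<psi> zs)"
    proof -
      have "map_pmf \<psi> Pn = PM"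
        by (simp add: PM_def PX_def Pn_def map_replicate_pmf[symmetric] map_pmf_comp \<psi>_def[abs_def])
      then show ?thesis by (simp add: pmf_map[symmetric])
    qed
    finally have "pmf q (\<psi> zs) * a \<le> pmf PM (\<psi> zs)" using a(1) by (simp add: field_simps)
    then have "ln (pmf q (\<psi> zs) * a) \<le> ln (pmf PM (\<psi> zs))"
      using q0 a(1) by (intro ln_mono) auto
    then show "- ln (pmf PM (\<psi> zs)) \<le> - ln (pmf q (\<psi> zs)) + - ln a"
      using q0 a(1) by (simp add: ln_mult)
  qed
  also have "\<dots> = pmf_entropy q - ln a"
    by (subst expect_add) (use finPt in \<open>auto simp: q_def pmf_entropy_map\<close>)
  finally have gY: "pmf_entropy law \<le> real n * S (\<lambda>z. - ln (pmf PY (fst z))) + (pmf_entropy q - ln a) + ln \<beta>"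
    by (simp only: ES)
  have "real n * (S (\<lambda>z. - ln (pmf P z)) - expect q h) \<le> ln (real (card M)) - ln a"
    using entPt chain entq by (simp add: right_diff_distrib)
  moreover have "real n * (S (\<lambda>z. - ln (pmf P z)) - S (\<lambda>z. - ln (pmf PX (snd z))) - (expect q h - expect q hX)) \<le> - ln a"
    using entPt chain chainX gX by (simp add: right_diff_distrib)
  moreover have "real n * (S (\<lambda>z. - ln (pmf P z)) - vec_entropy v') \<le> - ln a"
    using entPt gv by (simp add: right_diff_distrib)
  moreover have "- ln \<beta> \<le> real n * (S (\<lambda>z. - ln (pmf PY (fst z))) - expect q hY) - ln a"
    using gY chainY by (simp add: right_diff_distrib)
  ultimately show ?thesis using mix \<beta>0 unfolding S_def by blast
qed

section \<open>Concentration of log-likelihood ratios\<close>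

lemma pmf_markov_inequality:
  assumes "finite (set_pmf p)" "\<And>x. x \<in> set_pmf p \<Longrightarrow> 0 \<le> g x" "0 < t"
  shows "measure p {x. t \<le> g x} \<le> expect p g / t"
proof -
  have "measure p {x. t \<le> g x} = expect p (indicator {x. t \<le> g x})" by simp
  also have "\<dots> \<le> expect p (\<lambda>x. g x / t)"
    by (rule expect_mono) (use assms in \<open>auto simp: indicator_def\<close>)
  finally show ?thesis by simp
qed

lemma replicate_pmf_Suc_map:
  "replicate_pmf (Suc n) p = bind_pmf p (\<lambda>x. map_pmf ((#) x) (replicate_pmf n p))"
  by (simp add: map_pmf_def)

text \<open>Induction on the leading coordinate: the variance is the mean conditional variance given
  x plus the variance of the conditional mean \<open>h x\<close>. Changing x moves
  \<open>h x\<close> by at most c, so \<open>h x\<close> stays within c of its average.\<close>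

lemma bounded_differences_variance:
  fixes p :: "'a pmf" and f :: "'a list \<Rightarrow> real"
  assumes fin: "finite (set_pmf p)"
    and diff: "\<And>us a b vs. length us + length vs + 1 = n \<Longrightarrow> set us \<union> {a, b} \<union> set vs \<subseteq> set_pmf p
      \<Longrightarrow> \<bar>f (us @ a # vs) - f (us @ b # vs)\<bar> \<le> c"
  shows "expect (replicate_pmf n p) (\<lambda>xs. (f xs - expect (replicate_pmf n p) f)\<^sup>2) \<le> real n * c\<^sup>2"
  using diff
proof (induction n arbitrary: f)
  case (Suc n)
  let ?r = "replicate_pmf n p"
  have finr: "finite (set_pmf ?r)" using fin by (rule finite_set_replicate_pmf)
  have E: "expect (replicate_pmf (Suc n) p) F = expect p (\<lambda>x. expect ?r (\<lambda>xs. F (x # xs)))" for F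
    unfolding replicate_pmf_Suc_map by (subst expect_bind) (use fin finr in auto)
  define h where "h x = expect ?r (\<lambda>xs. f (x # xs))" for x
  define m where "m = expect p h"
  have m: "expect (replicate_pmf (Suc n) p) f = m" by (simp only: E m_def h_def[abs_def])
  have inner: "expect ?r (\<lambda>xs. (f (x # xs) - m)\<^sup>2) \<le> real n * c\<^sup>2 + c\<^sup>2" if x: "x \<in> set_pmf p" for x
  proof -
    have "expect ?r (\<lambda>xs. (f (x # xs) - m)\<^sup>2)
      = expect ?r (\<lambda>xs. (f (x # xs) - h x)\<^sup>2 + (2 * (h x - m) * (f (x # xs) - h x) + (h x - m)\<^sup>2))"
      by (intro expect_cong) (simp add: power2_eq_square algebra_simps)
    also have "\<dots> = expect ?r (\<lambda>xs. (f (x # xs) - h x)\<^sup>2) + (h x - m)\<^sup>2"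
    proof -
      have "expect ?r (\<lambda>xs. f (x # xs) - h x) = 0"
        by (subst expect_diff[OF finr]) (simp add: h_def)
      then have "expect ?r (\<lambda>xs. 2 * (h x - m) * (f (x # xs) - h x)) = 0" by simp
      then show ?thesis by (subst expect_add[OF finr], subst expect_add[OF finr]) simp
    qed
    also have "expect ?r (\<lambda>xs. (f (x # xs) - h x)\<^sup>2) \<le> real n * c\<^sup>2"
      unfolding h_def
    proof (rule Suc.IH)
      fix us a b vs
      assume "length us + length vs + 1 = n" "set us \<union> {a, b} \<union> set vs \<subseteq> set_pmf p"
      then show "\<bar>f (x # us @ a # vs) - f (x # us @ b # vs)\<bar> \<le> c"
        using Suc.prems[of "x # us" vs a b] x by simp
    qed
    also have "(h x - m)\<^sup>2 \<le> c\<^sup>2"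
    proof -
      have hh: "\<bar>h x - h x'\<bar> \<le> c" if x': "x' \<in> set_pmf p" for x'
      proof -
        have dd: "\<bar>f (x # xs) - f (x' # xs)\<bar> \<le> c" if "xs \<in> set_pmf ?r" for xs
          using Suc.prems[of "[]" xs x x'] that x x' by (force simp: set_replicate_pmf)
        have "f (x # xs) - f (x' # xs) \<le> c" "- c \<le> f (x # xs) - f (x' # xs)" if "xs \<in> set_pmf ?r" for xs
          using dd[OF that] by linarith+
        then have "expect ?r (\<lambda>xs. f (x # xs) - f (x' # xs)) \<le> c" "- c \<le> expect ?r (\<lambda>xs. f (x # xs) - f (x' # xs))"
          using expect_mono[OF finr, of "\<lambda>xs. f (x # xs) - f (x' # xs)" "\<lambda>_. c"]
            expect_mono[OF finr, of "\<lambda>_. - c" "\<lambda>xs. f (x # xs) - f (x' # xs)"] by auto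
        then show ?thesis by (simp add: h_def expect_diff[OF finr])
      qed
      then have "h x - h x' \<le> c" "- c \<le> h x - h x'" if "x' \<in> set_pmf p" for x'
        using hh[OF that] by linarith+
      note hh = this
      have "h x - m = expect p (\<lambda>x'. h x - h x')"
        by (subst expect_diff[OF fin]) (simp add: m_def)
      then have "h x - m \<le> c" "- c \<le> h x - m"
        using expect_mono[OF fin, of "\<lambda>x'. h x - h x'" "\<lambda>_. c"]
          expect_mono[OF fin, of "\<lambda>_. - c" "\<lambda>x'. h x - h x'"] hh by auto
      then have "\<bar>h x - m\<bar> \<le> \<bar>c\<bar>" by simp
      then show ?thesis by (simp only: abs_le_square_iff)
    qed
    finally show ?thesis by simp
  qed
  have "expect (replicate_pmf (Suc n) p) (\<lambda>xs. (f xs - m)\<^sup>2) \<le> expect p (\<lambda>_. real n * c\<^sup>2 + c\<^sup>2)"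
    unfolding E by (rule expect_mono[OF fin inner])
  then show ?case unfolding m by (simp add: algebra_simps)
qed simp

lemma bounded_differences_concentration:
  fixes p :: "'a pmf" and f :: "'a list \<Rightarrow> real"
  assumes fin: "finite (set_pmf p)"
    and diff: "\<And>us a b vs. length us + length vs + 1 = n \<Longrightarrow> set us \<union> {a, b} \<union> set vs \<subseteq> set_pmf p
      \<Longrightarrow> \<bar>f (us @ a # vs) - f (us @ b # vs)\<bar> \<le> c"
    and n: "0 < n" and \<delta>: "0 < \<delta>"
  shows "measure (replicate_pmf n p) {xs. real n * \<delta> \<le> \<bar>f xs - expect (replicate_pmf n p) f\<bar>} \<le> c\<^sup>2 / (real n * \<delta>\<^sup>2)"
proof -
  let ?r = "replicate_pmf n p" and ?m = "expect (replicate_pmf n p) f"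
  have "{xs. real n * \<delta> \<le> \<bar>f xs - ?m\<bar>} = {xs. (real n * \<delta>)\<^sup>2 \<le> (f xs - ?m)\<^sup>2}"
    using n \<delta> by (auto simp: abs_le_square_iff[symmetric])
  then have "measure ?r {xs. real n * \<delta> \<le> \<bar>f xs - ?m\<bar>} \<le> expect ?r (\<lambda>xs. (f xs - ?m)\<^sup>2) / (real n * \<delta>)\<^sup>2"
    using n \<delta> by (simp, intro pmf_markov_inequality finite_set_replicate_pmf fin) auto
  also have "\<dots> \<le> (real n * c\<^sup>2) / (real n * \<delta>)\<^sup>2"
    by (intro divide_right_mono bounded_differences_variance[OF fin]) (use diff in auto)
  also have "\<dots> = c\<^sup>2 / (real n * \<delta>\<^sup>2)"
    using n by (simp add: power2_eq_square)
  finally show ?thesis .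
qed

lemma expect_sum_list_replicate:
  assumes fin: "finite (set_pmf p)"
  shows "expect (replicate_pmf n p) (\<lambda>xs. sum_list (map f xs)) = real n * expect p f"
proof (induction n)
  case (Suc n)
  have finr: "finite (set_pmf (replicate_pmf n p))" using fin by (rule finite_set_replicate_pmf)
  have "expect (replicate_pmf (Suc n) p) (\<lambda>xs. sum_list (map f xs))
    = expect p (\<lambda>x. expect (replicate_pmf n p) (\<lambda>xs. f x + sum_list (map f xs)))"
    unfolding replicate_pmf_Suc_map by (subst expect_bind) (use fin finr in auto)
  also have "\<dots> = expect p (\<lambda>x. f x + real n * expect p f)"
    by (subst expect_add[OF finr]) (simp add: Suc)
  also have "\<dots> = real (Suc n) * expect p f"
    by (subst expect_add[OF fin]) (simp add: algebra_simps)
  finally show ?case .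
qed simp

lemma iid_concentration:
  fixes f :: "'a \<Rightarrow> real"
  assumes fin: "finite (set_pmf p)"
  shows "\<exists>C>0. \<forall>n \<delta>. 0 < n \<longrightarrow> 0 < \<delta> \<longrightarrow>
    measure (replicate_pmf n p) {xs. real n * \<delta> \<le> \<bar>sum_list (map f xs) - real n * expect p f\<bar>} \<le> C / (real n * \<delta>\<^sup>2)"
proof -
  define B where "B = (\<Sum>x\<in>set_pmf p. \<bar>f x\<bar>)"
  have B: "\<bar>f x\<bar> \<le> B" if "x \<in> set_pmf p" for x
    unfolding B_def by (rule member_le_sum) (use that fin in auto)
  have "measure (replicate_pmf n p) {xs. real n * \<delta> \<le> \<bar>sum_list (map f xs) - real n * expect p f\<bar>}
     \<le> ((2 * B)\<^sup>2 + 1) / (real n * \<delta>\<^sup>2)" if "0 < n" "0 < \<delta>" for n \<delta>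
  proof -
    have "measure (replicate_pmf n p) {xs. real n * \<delta> \<le> \<bar>sum_list (map f xs) - expect (replicate_pmf n p) (\<lambda>xs. sum_list (map f xs))\<bar>}
       \<le> (2 * B)\<^sup>2 / (real n * \<delta>\<^sup>2)"
    proof (rule bounded_differences_concentration[OF fin])
      fix us a b and vs :: "'a list" assume "set us \<union> {a, b} \<union> set vs \<subseteq> set_pmf p"
      then show "\<bar>sum_list (map f (us @ a # vs)) - sum_list (map f (us @ b # vs))\<bar> \<le> 2 * B"
        using B[of a] B[of b] by auto
    qed (use that in auto)
    also have "\<dots> \<le> ((2 * B)\<^sup>2 + 1) / (real n * \<delta>\<^sup>2)" by (intro divide_right_mono) auto
    finally show ?thesis by (simp only: expect_sum_list_replicate[OF fin])
  qed
  \<comment> \<open>The added 1 keeps the constant positive even when f vanishes on the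
    support.\<close>
  moreover have "0 < (2 * B)\<^sup>2 + 1" by (smt (verit) zero_le_power2)
  ultimately show ?thesis by blast
qed

section \<open>Log-likelihood ratios against Markov references\<close>

definition markov_marginals :: "nat \<Rightarrow> ('a list \<Rightarrow> 'a pmf) \<Rightarrow> (nat \<Rightarrow> 'a list pmf) \<Rightarrow> bool" where
  "markov_marginals k T Q \<longleftrightarrow> (\<forall>n. \<forall>xs\<in>set_pmf (Q n). length xs = n) \<and>
     (\<forall>n\<ge>k. \<forall>xs a. length xs = n \<longrightarrow> pmf (Q (Suc n)) (xs @ [a]) = pmf (Q n) xs * pmf (T (drop (n - k) xs)) a)"

lemma replicate_pmf_snoc:
  "replicate_pmf (Suc n) p = bind_pmf (replicate_pmf n p) (\<lambda>xs. map_pmf (\<lambda>x. xs @ [x]) p)"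
  using replicate_pmf_distrib[of n 1 p]
  by (simp add: map_pmf_def bind_assoc_pmf bind_return_pmf)

lemma map_drop_replicate_pmf:
  assumes "k \<le> n"
  shows "map_pmf (drop (n - k)) (replicate_pmf n p) = replicate_pmf k p"
proof -
  have "map_pmf (drop (n - k)) (replicate_pmf ((n - k) + k) p)
    = bind_pmf (replicate_pmf (n - k) p) (\<lambda>xs. bind_pmf (replicate_pmf k p) (\<lambda>ys. return_pmf (drop (n - k) (xs @ ys))))"
    by (simp only: replicate_pmf_distrib map_bind_pmf map_return_pmf)
  also have "\<dots> = bind_pmf (replicate_pmf (n - k) p) (\<lambda>xs. bind_pmf (replicate_pmf k p) return_pmf)"
    by (intro bind_pmf_cong refl) (auto simp: set_replicate_pmf)
  finally show ?thesis using assms by (simp add: bind_return_pmf')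
qed

lemma pmf_replicate_snoc:
  assumes "length xs = n"
  shows "pmf (replicate_pmf (Suc n) p) (xs @ [a]) = pmf (replicate_pmf n p) xs * pmf p a"
  using assms by (simp add: pmf_replicate del: replicate_pmf.simps)

text \<open>Beyond length k each further letter adds to the log ratio a term g of the last k letters
  and the new one; its mean is a, since under P to the n the last k letters are again i.i.d. These
  terms overlap and are dependent, but a single letter enters only k + 1 of them besides the initial
  block, so bounded differences apply with a constant that does not grow with n.\<close>

lemma log_ratio_concentration:
  fixes P :: "'a::finite pmf"
  assumes Q: "markov_marginals k T Q" and ac: "\<And>n. set_pmf (replicate_pmf n P) \<subseteq> set_pmf (Q n)"
  defines "a \<equiv> expect (replicate_pmf k P) (\<lambda>w. expect P (\<lambda>x. ln (pmf P x / pmf (T w) x)))"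
  shows "n \<ge> k \<Longrightarrow> rel_entropy_increment P Q n = ereal a"
    and "0 < \<delta> \<Longrightarrow> (\<lambda>n. measure (replicate_pmf n P)
      {xs. real n * \<delta> \<le> \<bar>ln (pmf (replicate_pmf n P) xs / pmf (Q n) xs) - real n * a\<bar>}) \<longlonglongrightarrow> 0"
proof -
  define R where "R n = replicate_pmf n P" for n
  define L :: "nat \<Rightarrow> 'a list \<Rightarrow> real" where "L n xs = ln (pmf (R n) xs / pmf (Q n) xs)" for n xs
  define D where "D n = expect (R n) (L n)" for n
  define g where "g w x = ln (pmf P x / pmf (T w) x)" for w x
  have finP: "finite (set_pmf P)" and finR: "finite (set_pmf (R n))" for n
    by (auto simp: R_def intro: finite_set_replicate_pmf)
  have setR: "xs \<in> set_pmf (R n) \<longleftrightarrow> length xs = n \<and> set xs \<subseteq> set_pmf P" for n xs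
    by (auto simp: R_def set_replicate_pmf)
  have step: "L (Suc n) (xs @ [x]) = L n xs + g (drop (n - k) xs) x"
    if "k \<le> n" and xs: "xs \<in> set_pmf (R n)" and x: "x \<in> set_pmf P" for n xs x
  proof -
    have len: "length xs = n" using xs setR by auto
    \<comment> \<open>By absolute continuity the longer block has positive mass under Q, hence so do
      both of its factors, and the logarithm may be split.\<close>
    have "xs @ [x] \<in> set_pmf (R (Suc n))" using xs x by (auto simp: setR)
    then have "0 < pmf (Q (Suc n)) (xs @ [x])" using ac unfolding R_def by (intro pmf_positive) blast
    moreover have q: "pmf (Q (Suc n)) (xs @ [x]) = pmf (Q n) xs * pmf (T (drop (n - k) xs)) x"
      using Q that len by (auto simp: markov_marginals_def)
    ultimately have "0 < pmf (Q n) xs" "0 < pmf (T (drop (n - k) xs)) x"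
      using pmf_nonneg[of "Q n" xs] pmf_nonneg[of "T (drop (n - k) xs)" x] by (auto simp: zero_less_mult_iff)
    then show ?thesis using pmf_positive[OF xs] pmf_positive[OF x]
      unfolding L_def q g_def by (simp add: R_def pmf_replicate_snoc[OF len] ln_div ln_mult del: replicate_pmf.simps)
  qed
  have Dstep: "D (Suc n) = D n + a" if "k \<le> n" for n
  proof -
    have "D (Suc n) = expect (R n) (\<lambda>xs. expect P (\<lambda>x. L (Suc n) (xs @ [x])))"
      unfolding D_def R_def replicate_pmf_snoc
      by (subst expect_bind) (use finR[of n] in \<open>auto simp: R_def\<close>)
    also have "\<dots> = expect (R n) (\<lambda>xs. L n xs + expect P (g (drop (n - k) xs)))"
      by (intro expect_cong, subst expect_add[OF finP, of "\<lambda>_. _", simplified expect_const, symmetric])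
        (intro expect_cong step that)
    also have "\<dots> = D n + expect (R n) (\<lambda>xs. expect P (g (drop (n - k) xs)))"
      unfolding D_def by (rule expect_add[OF finR])
    also have "expect (R n) (\<lambda>xs. expect P (g (drop (n - k) xs))) = expect (map_pmf (drop (n - k)) (R n)) (\<lambda>w. expect P (g w))"
      by simp
    also have "\<dots> = a"
      unfolding R_def map_drop_replicate_pmf[OF that] a_def g_def[abs_def] ..
    finally show ?thesis .
  qed
  have rel: "rel_entropy (R n) (Q n) = ereal (D n)" for n
    using ac[of n] by (simp add: rel_entropy_pmf D_def L_def[abs_def] R_def)
  show "rel_entropy_increment P Q n = ereal a" if "n \<ge> k"
    using rel[of n] rel[of "Suc n"] Dstep[OF that] unfolding rel_entropy_increment_def R_def by simp
  have Dn: "D n = D k + real (n - k) * a" if "k \<le> n" for n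
    using that by (induction n rule: dec_induct) (auto simp: Dstep Suc_diff_le algebra_simps)
  have Lsum: "L n xs = L k (take k xs) + (\<Sum>j=k..<n. g (drop (j - k) (take j xs)) (xs ! j))"
    if "k \<le> n" "xs \<in> set_pmf (R n)" for n xs
    using that
  proof (induction n arbitrary: xs rule: dec_induct)
    case base
    then show ?case by (simp add: setR)
  next
    case (step n)
    then obtain ys x where xs: "xs = ys @ [x]" "length ys = n"
      by (metis setR length_Suc_conv_rev)
    then have ys: "ys \<in> set_pmf (R n)" "x \<in> set_pmf P" using step.prems by (auto simp: setR)
    have "L (Suc n) xs = L n ys + g (drop (n - k) ys) x"
      unfolding xs(1) by (rule \<open>\<And>n xs x. _ \<Longrightarrow> _ \<Longrightarrow> _ \<Longrightarrow> L (Suc n) (xs @ [x]) = _\<close>) (use step ys in auto)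
    also have "L n ys = L k (take k xs) + (\<Sum>j=k..<n. g (drop (j - k) (take j xs)) (xs ! j))"
      using step.IH[OF ys(1)] step.hyps xs by (simp add: nth_append)
    finally show ?case using step.hyps xs nth_append_length[of ys x "[]"] by simp
  qed
  define G where "G = (\<Sum>w\<in>set_pmf (R k). \<Sum>x\<in>set_pmf P. \<bar>g w x\<bar>)"
  have G: "\<bar>g w x\<bar> \<le> G" if "w \<in> set_pmf (R k)" "x \<in> set_pmf P" for w x
  proof -
    have "\<bar>g w x\<bar> \<le> (\<Sum>x\<in>set_pmf P. \<bar>g w x\<bar>)" by (rule member_le_sum) (use that finP in auto)
    also have "\<dots> \<le> G" unfolding G_def
      by (rule member_le_sum[of w _ "\<lambda>w. \<Sum>x\<in>set_pmf P. \<bar>g w x\<bar>"]) (use that finR in \<open>auto intro: sum_nonneg\<close>)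
    finally show ?thesis .
  qed
  define G0 where "G0 = (\<Sum>w\<in>set_pmf (R k). \<bar>L k w\<bar>)"
  have G0: "\<bar>L k w\<bar> \<le> G0" if "w \<in> set_pmf (R k)" for w
    unfolding G0_def by (rule member_le_sum) (use that finR in auto)
  have Gnn: "0 \<le> G" unfolding G_def by (intro sum_nonneg) auto
  \<comment> \<open>2 G0 for the initial block, and 2 G for each of the k + 1 terms that see the
    changed letter, either as their new letter or among the k letters before it.\<close>
  define c where "c = 2 * G0 + real (k + 1) * (2 * G)"
  have diff: "\<bar>L n (us @ b # vs) - L n (us @ b' # vs)\<bar> \<le> c"
    if kn: "k \<le> n" and len: "length us + length vs + 1 = n" and sub: "set us \<union> {b, b'} \<union> set vs \<subseteq> set_pmf P"
    for n us b b' vs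
  proof -
    let ?xs = "us @ b # vs" and ?ys = "us @ b' # vs"
    let ?t = "\<lambda>xs j. g (drop (j - k) (take j xs)) (xs ! j)"
    have xs: "?xs \<in> set_pmf (R n)" "?ys \<in> set_pmf (R n)" using len sub by (auto simp: setR)
    have tk: "take k xs \<in> set_pmf (R k)" if "xs \<in> set_pmf (R n)" for xs
      using that kn set_take_subset[of k xs] by (auto simp: setR)
    have tb: "\<bar>?t xs j\<bar> \<le> G" if "xs \<in> set_pmf (R n)" "j \<in> {k..<n}" for xs j
      using that set_drop_subset[of "j - k" "take j xs"] set_take_subset[of j xs]
      by (intro G) (auto simp: setR)
    have same: "?t ?xs j = ?t ?ys j" if "j \<in> {k..<n}" "j \<notin> {length us..length us + k}" for j
    proof (cases "j < length us")
      case True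
      then show ?thesis by (simp add: nth_append)
    next
      case False
      then have j: "length us + k < j" using that by auto
      then have "drop (j - k) (take j ?xs) = drop (j - k) (take j ?ys)"
        by (simp add: drop_take drop_Cons' Suc_diff_le)
      moreover have "?xs ! j = ?ys ! j" using j by (simp add: nth_append nth_Cons')
      ultimately show ?thesis by simp
    qed
    have "\<bar>\<Sum>j=k..<n. ?t ?xs j - ?t ?ys j\<bar> \<le> (\<Sum>j=k..<n. \<bar>?t ?xs j - ?t ?ys j\<bar>)" by (rule sum_abs)
    also have "\<dots> = (\<Sum>j\<in>{k..<n} \<inter> {length us..length us + k}. \<bar>?t ?xs j - ?t ?ys j\<bar>)"
      by (rule sum.mono_neutral_right) (use same in auto)
    also have "\<dots> \<le> (\<Sum>j\<in>{k..<n} \<inter> {length us..length us + k}. 2 * G)"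
    proof (rule sum_mono)
      fix j assume "j \<in> {k..<n} \<inter> {length us..length us + k}"
      then have "j \<in> {k..<n}" by simp
      from tb[OF xs(1) this] tb[OF xs(2) this] show "\<bar>?t ?xs j - ?t ?ys j\<bar> \<le> 2 * G" by linarith
    qed
    also have "\<dots> = real (card ({k..<n} \<inter> {length us..length us + k})) * (2 * G)" by simp
    also have "\<dots> \<le> real (k + 1) * (2 * G)"
    proof (intro mult_right_mono)
      have "card ({k..<n} \<inter> {length us..length us + k}) \<le> card {length us..length us + k}"
        by (intro card_mono) auto
      then show "real (card ({k..<n} \<inter> {length us..length us + k})) \<le> real (k + 1)" by simp
    qed (use Gnn in auto)
    finally have "\<bar>(\<Sum>j=k..<n. ?t ?xs j) - (\<Sum>j=k..<n. ?t ?ys j)\<bar> \<le> real (k + 1) * (2 * G)"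
      by (simp only: sum_subtractf)
    then show ?thesis
      using G0[OF tk[OF xs(1)]] G0[OF tk[OF xs(2)]]
      unfolding Lsum[OF kn xs(1)] Lsum[OF kn xs(2)] c_def by linarith
  qed
  show "(\<lambda>n. measure (replicate_pmf n P)
      {xs. real n * \<delta> \<le> \<bar>ln (pmf (replicate_pmf n P) xs / pmf (Q n) xs) - real n * a\<bar>}) \<longlonglongrightarrow> 0"
    if \<delta>: "0 < \<delta>"
  proof (rule Lim_null_comparison)
    \<comment> \<open>The mean of the log ratio is n a plus the fixed offset
      \<open>D k - real k * a\<close>. From \<open>n0\<close> on this offset is at most n \<delta> /
      2, which leaves \<delta> / 2 for the deviation from the mean.\<close>
    define n0 where "n0 = nat \<lceil>2 * \<bar>D k - real k * a\<bar> / \<delta>\<rceil> + k + 1"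
    show "\<forall>\<^sub>F n in sequentially. norm (measure (replicate_pmf n P)
      {xs. real n * \<delta> \<le> \<bar>ln (pmf (replicate_pmf n P) xs / pmf (Q n) xs) - real n * a\<bar>}) \<le> c\<^sup>2 / (real n * (\<delta> / 2)\<^sup>2)"
      using eventually_ge_at_top[of n0]
    proof eventually_elim
      case (elim n)
      have n: "k \<le> n" "0 < n" using elim by (auto simp: n0_def)
      have "2 * \<bar>D k - real k * a\<bar> / \<delta> \<le> real n" using elim by (simp add: n0_def) linarith
      then have "\<bar>D k - real k * a\<bar> \<le> real n * (\<delta> / 2)" using \<delta> by (simp add: field_simps)
      moreover have "D n - real n * a = D k - real k * a"
        using n by (simp add: Dn[OF n(1)] of_nat_diff algebra_simps)
      ultimately have Dna: "\<bar>D n - real n * a\<bar> \<le> real n * (\<delta> / 2)" by simp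
      have "measure (R n) {xs. real n * \<delta> \<le> \<bar>L n xs - real n * a\<bar>}
        \<le> measure (R n) {xs. real n * (\<delta> / 2) \<le> \<bar>L n xs - expect (R n) (L n)\<bar>}"
        unfolding D_def[symmetric]
      proof (intro measure_pmf.finite_measure_mono subsetI CollectI)
        fix xs assume "xs \<in> {xs. real n * \<delta> \<le> \<bar>L n xs - real n * a\<bar>}"
        then have "real n * \<delta> \<le> \<bar>L n xs - real n * a\<bar>" by simp
        moreover have "real n * \<delta> = 2 * (real n * (\<delta> / 2))" by simp
        ultimately show "real n * (\<delta> / 2) \<le> \<bar>L n xs - D n\<bar>" using Dna by linarith
      qed simp
      also have "\<dots> \<le> c\<^sup>2 / (real n * (\<delta> / 2)\<^sup>2)"
        unfolding R_def by (rule bounded_differences_concentration[OF finP, where f = "L n"])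
          (assumption | rule diff[OF n(1)] n half_gt_zero \<delta>)+
      finally show ?case by (simp add: R_def L_def)
    qed
    have "(\<lambda>n. (c\<^sup>2 / (\<delta> / 2)\<^sup>2) * inverse (real n)) \<longlonglongrightarrow> (c\<^sup>2 / (\<delta> / 2)\<^sup>2) * 0"
      by (intro tendsto_mult tendsto_const lim_inverse_n)
    then show "(\<lambda>n. c\<^sup>2 / (real n * (\<delta> / 2)\<^sup>2)) \<longlonglongrightarrow> 0"
      by (simp add: field_simps)
  qed
qed

section \<open>Covering codes\<close>

lemma measure_expect: "measure (measure_pmf p) A = expect p (indicator A)"
  by simp

lemma measure_pmf_sum:
  assumes "finite (set_pmf p)"
  shows "measure p A = (\<Sum>x\<in>set_pmf p \<inter> A. pmf p x)"
  using assms by (metis finite_Int inf_commute measure_Int_set_pmf measure_measure_pmf_finite)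

lemma measure_pmf_mono_on:
  assumes "\<And>x. x \<in> set_pmf p \<Longrightarrow> x \<in> A \<Longrightarrow> x \<in> B"
  shows "measure (measure_pmf p) A \<le> measure p B"
proof -
  have "measure p A = measure p (A \<inter> set_pmf p)" by (simp add: measure_Int_set_pmf)
  also have "\<dots> \<le> measure p B" by (intro measure_pmf.finite_measure_mono) (use assms in auto)
  finally show ?thesis .
qed

lemma ex_le_expect:
  assumes "finite (set_pmf p)"
  shows "\<exists>x\<in>set_pmf p. f x \<le> expect p f"
proof (rule ccontr)
  assume "\<not> ?thesis"
  then have gt: "expect p f < f x" if "x \<in> set_pmf p" for x using that by force
  have "(\<Sum>x\<in>set_pmf p. pmf p x * expect p f) < (\<Sum>x\<in>set_pmf p. pmf p x * f x)"
    using assms set_pmf_not_empty[of p] gt by (intro sum_strict_mono mult_strict_left_mono) (auto intro: pmf_positive)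
  then show False
    using assms by (simp add: sum_distrib_right[symmetric] sum_pmf_eq_1 expect_sum[OF assms subset_refl])
qed

lemma expect_swap:
  assumes "finite (set_pmf p)" "finite (set_pmf q)"
  shows "expect p (\<lambda>a. expect q (\<lambda>b. f a b)) = expect q (\<lambda>b. expect p (\<lambda>a. f a b))"
  by (simp add: expect_sum[OF assms(1) subset_refl] expect_sum[OF assms(2) subset_refl] sum_distrib_left
      sum.swap[of _ "set_pmf p"] mult_ac)

text \<open>The code is chosen greedily: each new word is drawn so that the potential
  \<open>\<Sum>x. a x * (1 - p x) ^ (words left)\<close>, summed over the points not yet covered, does not increase.\<close>

lemma covering_code:
  fixes G :: "('x \<times> 'u) set" and a :: "'x \<Rightarrow> real"
  assumes fin: "finite (set_pmf p)" and A: "finite A"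
  shows "\<exists>c :: nat \<Rightarrow> 'u. (\<forall>i. c i \<in> set_pmf p) \<and>
    (\<Sum>x\<in>A. if \<exists>i<M. (x, c i) \<in> G then 0 else a x) \<le> (\<Sum>x\<in>A. a x * (1 - measure p {u. (x, u) \<in> G}) ^ M)"
proof (induction M arbitrary: a)
  case 0
  obtain u where "u \<in> set_pmf p" using set_pmf_not_empty[of p] by auto
  then show ?case by (intro exI[of _ "\<lambda>_. u"]) simp
next
  case (Suc M)
  let ?m = "\<lambda>x. measure p {u. (x, u) \<in> G}"
  let ?a = "\<lambda>u x. if (x, u) \<in> G then 0 else a x"
  have "expect p (\<lambda>u. \<Sum>x\<in>A. ?a u x * (1 - ?m x) ^ M) = (\<Sum>x\<in>A. expect p (\<lambda>u. ?a u x * (1 - ?m x) ^ M))"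
    by (rule expect_sum_right[OF fin])
  also have "\<dots> = (\<Sum>x\<in>A. a x * (1 - ?m x) ^ Suc M)"
  proof (rule sum.cong[OF refl])
    fix x
    have "expect p (\<lambda>u. ?a u x * (1 - ?m x) ^ M) = expect p (\<lambda>u. a x * (1 - ?m x) ^ M * (1 - indicator {u. (x, u) \<in> G} u))"
      by (intro expect_cong) (auto simp: indicator_def)
    also have "\<dots> = a x * (1 - ?m x) ^ M * expect p (\<lambda>u. 1 - indicator {u. (x, u) \<in> G} u)"
      by simp
    also have "expect p (\<lambda>u. 1 - indicator {u. (x, u) \<in> G} u) = 1 - ?m x"
      by (subst expect_diff[OF fin]) simp
    finally show "expect p (\<lambda>u. ?a u x * (1 - ?m x) ^ M) = a x * (1 - ?m x) ^ Suc M" by simp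
  qed
  finally obtain u where u: "u \<in> set_pmf p" "(\<Sum>x\<in>A. ?a u x * (1 - ?m x) ^ M) \<le> (\<Sum>x\<in>A. a x * (1 - ?m x) ^ Suc M)"
    using ex_le_expect[OF fin, of "\<lambda>u. \<Sum>x\<in>A. ?a u x * (1 - ?m x) ^ M"] by auto
  obtain c where c: "\<forall>i. c i \<in> set_pmf p"
    "(\<Sum>x\<in>A. if \<exists>i<M. (x, c i) \<in> G then 0 else ?a u x) \<le> (\<Sum>x\<in>A. ?a u x * (1 - ?m x) ^ M)"
    using Suc.IH[of "?a u"] by blast
  define c' where "c' i = (case i of 0 \<Rightarrow> u | Suc j \<Rightarrow> c j)" for i
  have "(\<exists>i<Suc M. (x, c' i) \<in> G) \<longleftrightarrow> (x, u) \<in> G \<or> (\<exists>i<M. (x, c i) \<in> G)" for x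
    by (simp add: Ex_less_Suc2 c'_def)
  then have "(\<Sum>x\<in>A. if \<exists>i<Suc M. (x, c' i) \<in> G then 0 else a x) = (\<Sum>x\<in>A. if \<exists>i<M. (x, c i) \<in> G then 0 else ?a u x)"
    by (intro sum.cong) auto
  moreover have "\<forall>i. c' i \<in> set_pmf p" using c(1) u(1) by (auto simp: c'_def split: nat.splits)
  ultimately show ?case using c(2) u(2) by (intro exI[of _ c']) auto
qed

text \<open>(1 - p)^M is at most exp (- M g / K), and by convexity exp lies below its chord from 0
  to -M/K at the point with weight g. The result is affine in g with a remainder free of g, so it
  can be averaged over x.\<close>

lemma one_minus_power_le:
  fixes p :: real
  assumes "0 \<le> g" "g \<le> 1" "g / K \<le> p" "p \<le> 1" "0 < K"
  shows "(1 - p) ^ M \<le> 1 - g + exp (- (real M / K))"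
proof -
  have "(1 - p) ^ M \<le> exp (- p) ^ M"
    using assms exp_ge_add_one_self[of "- p"] by (intro power_mono) auto
  also have "\<dots> = exp (- (real M * p))" by (simp add: exp_of_nat_mult[symmetric])
  also have "\<dots> \<le> exp (- (real M * (g / K)))"
    using mult_left_mono[OF assms(3), of "real M"] by simp
  also have "\<dots> = exp ((1 - g) * 0 + g * (- (real M / K)))" by simp
  also have "\<dots> \<le> (1 - g) * exp 0 + g * exp (- (real M / K))"
    using convex_onD[OF exp_convex, of g 0 "- (real M / K)"] assms by simp
  also have "\<dots> \<le> 1 - g + exp (- (real M / K))"
    using mult_right_mono[OF assms(2), of "exp (- (real M / K))"] by simp
  finally show ?thesis .
qed

lemma measure_bind_expect:
  assumes "finite (set_pmf p)" "\<And>x. x \<in> set_pmf p \<Longrightarrow> finite (set_pmf (r x))"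
  shows "measure (bind_pmf p r) A = expect p (\<lambda>x. measure (r x) A)"
  unfolding measure_expect by (rule expect_bind) (use assms in auto)

text \<open>A covering argument with a conditional requirement on y. A word u is good for x if
  \<open>W x\<close> weighs it at most K times as much as PU does, so that PU finds it often enough,
  and if given x the pair (y, u) leaves B with probability at most \<eta>. The encoder picks u from
  x alone, so y keeps its conditional law given x and the second property bounds the failure at the
  decoder. Index 0 announces that no word of the code is good.\<close>

lemma one_shot_code:
  fixes P :: "('y \<times> 'x) pmf" and W :: "'x \<Rightarrow> 'u pmf" and B :: "('y \<times> 'u) set"
  defines "PU \<equiv> bind_pmf (map_pmf snd P) W" and "J \<equiv> joint_YXU P W"
  assumes finP: "finite (set_pmf P)" and finW: "\<And>x. x \<in> set_pmf (map_pmf snd P) \<Longrightarrow> finite (set_pmf (W x))"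
    and K: "0 < K" and \<eta>: "0 < \<eta>"
  shows "\<exists>c e. (\<forall>i. c i \<in> set_pmf PU) \<and> (\<forall>x. e x \<le> M) \<and>
    measure P {z. e (snd z) = 0 \<or> (fst z, c (e (snd z) - 1)) \<notin> B}
     \<le> measure J {t. \<not> pmf (W (fst (snd t))) (snd (snd t)) \<le> K * pmf PU (snd (snd t))}
        + measure J {t. (fst t, snd (snd t)) \<notin> B} / \<eta> + exp (- (real M / K)) + \<eta>"
proof -
  define PX where "PX = map_pmf snd P"
  have finPX: "finite (set_pmf PX)" using finP by (simp add: PX_def)
  define \<kappa> where "\<kappa> x = cond_pmf P {z. snd z = x}" for x
  have P: "P = bind_pmf PX \<kappa>" unfolding PX_def \<kappa>_def by (rule bind_cond_pmf_fibre[symmetric])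
  have set\<kappa>: "set_pmf (\<kappa> x) = set_pmf P \<inter> {z. snd z = x}" if "x \<in> set_pmf PX" for x
    using that unfolding PX_def \<kappa>_def by (rule set_cond_pmf_fibre)
  have fin\<kappa>: "finite (set_pmf (\<kappa> x))" if "x \<in> set_pmf PX" for x using set\<kappa>[OF that] finP by simp
  have finW': "finite (set_pmf (W x))" if "x \<in> set_pmf PX" for x using that finW by (simp add: PX_def)
  have finPU: "finite (set_pmf PU)" unfolding PU_def PX_def[symmetric] using finPX finW' by simp
  define b where "b x u = measure (\<kappa> x) {z. (fst z, u) \<notin> B}" for x u
  define T where "T = {(x, u). pmf (W x) u \<le> K * pmf PU u}"
  define G where "G = {(x, u). (x, u) \<in> T \<and> b x u \<le> \<eta>}"
  define g where "g x = measure (W x) {u. (x, u) \<in> G}" for x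
  \<comment> \<open>Given x, the draws of y and u are independent; this makes it possible to
    exchange the two averages for B below.\<close>
  have J: "measure J A = expect PX (\<lambda>x. expect (\<kappa> x) (\<lambda>z. measure (W x) {u. (fst z, x, u) \<in> A}))" for A
  proof -
    have "J = bind_pmf PX (\<lambda>x. bind_pmf (\<kappa> x) (\<lambda>z. map_pmf (\<lambda>u. (fst z, snd z, u)) (W (snd z))))"
      unfolding J_def joint_YXU_def by (subst P) (simp add: bind_assoc_pmf case_prod_unfold)
    also have "\<dots> = bind_pmf PX (\<lambda>x. bind_pmf (\<kappa> x) (\<lambda>z. map_pmf (\<lambda>u. (fst z, x, u)) (W x)))"
      by (intro bind_pmf_cong refl) (use set\<kappa> in auto)
    also have "measure \<dots> A = expect PX (\<lambda>x. measure (bind_pmf (\<kappa> x) (\<lambda>z. map_pmf (\<lambda>u. (fst z, x, u)) (W x))) A)"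
      by (rule measure_bind_expect) (use finPX fin\<kappa> finW' in auto)
    also have "\<dots> = expect PX (\<lambda>x. expect (\<kappa> x) (\<lambda>z. measure (map_pmf (\<lambda>u. (fst z, x, u)) (W x)) A))"
      by (intro expect_cong measure_bind_expect) (use fin\<kappa> finW' in auto)
    finally show ?thesis by (simp add: measure_map_pmf vimage_def)
  qed
  have JT: "measure J {t. (fst (snd t), snd (snd t)) \<notin> T} = expect PX (\<lambda>x. measure (W x) {u. (x, u) \<notin> T})"
    unfolding J by simp
  have JB: "measure J {t. (fst t, snd (snd t)) \<notin> B} = expect PX (\<lambda>x. expect (W x) (b x))"
    unfolding J
  proof (rule expect_cong)
    fix x assume x: "x \<in> set_pmf PX"
    have "expect (\<kappa> x) (\<lambda>z. measure (W x) {u. (fst z, u) \<notin> B})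
        = expect (\<kappa> x) (\<lambda>z. expect (W x) (\<lambda>u. indicator {(z, u). (fst z, u) \<notin> B} (z, u)))"
      unfolding measure_expect by (intro expect_cong) (auto simp: indicator_def)
    also have "\<dots> = expect (W x) (\<lambda>u. expect (\<kappa> x) (\<lambda>z. indicator {(z, u). (fst z, u) \<notin> B} (z, u)))"
      by (rule expect_swap) (use x fin\<kappa> finW' in auto)
    also have "\<dots> = expect (W x) (b x)"
      unfolding b_def measure_expect by (intro expect_cong) (auto simp: indicator_def)
    finally show "expect (\<kappa> x) (\<lambda>z. measure (W x) {u. (fst z, x, u) \<in> {t. (fst t, snd (snd t)) \<notin> B}}) = expect (W x) (b x)"
      by simp
  qed
  have g1: "1 - g x \<le> measure (W x) {u. (x, u) \<notin> T} + expect (W x) (b x) / \<eta>" if x: "x \<in> set_pmf PX" for x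
  proof -
    have "1 - g x = measure (W x) {u. (x, u) \<notin> G}"
      using measure_pmf.prob_compl[of "{u. (x, u) \<in> G}" "W x"] by (simp add: g_def Collect_neg_eq Compl_eq_Diff_UNIV)
    also have "\<dots> \<le> measure (W x) ({u. (x, u) \<notin> T} \<union> {u. \<eta> \<le> b x u})"
      by (intro measure_pmf.finite_measure_mono) (auto simp: G_def)
    also have "\<dots> \<le> measure (W x) {u. (x, u) \<notin> T} + measure (W x) {u. \<eta> \<le> b x u}"
      by (rule measure_Un_le) auto
    also have "measure (W x) {u. \<eta> \<le> b x u} \<le> expect (W x) (b x) / \<eta>"
      by (rule pmf_markov_inequality) (use x finW' \<eta> in \<open>auto simp: b_def\<close>)
    finally show ?thesis by simp
  qed
  \<comment> \<open>Change of measure: on G the law \<open>W x\<close> is at most K times PU, so PU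
    hits a good word with probability at least g x / K.\<close>
  have gp: "g x / K \<le> measure PU {u. (x, u) \<in> G}" if x: "x \<in> set_pmf PX" for x
  proof -
    have "g x = (\<Sum>u\<in>set_pmf (W x) \<inter> {u. (x, u) \<in> G}. pmf (W x) u)"
      unfolding g_def by (rule measure_pmf_sum) (use x finW' in auto)
    also have "\<dots> \<le> (\<Sum>u\<in>set_pmf (W x) \<inter> {u. (x, u) \<in> G}. K * pmf PU u)"
      by (intro sum_mono) (auto simp: G_def T_def)
    also have "\<dots> = K * measure PU (set_pmf (W x) \<inter> {u. (x, u) \<in> G})"
      using finW'[OF x] by (simp add: sum_distrib_left measure_measure_pmf_finite)
    also have "\<dots> \<le> K * measure PU {u. (x, u) \<in> G}"
      using K by (intro mult_left_mono measure_pmf.finite_measure_mono) auto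
    finally show ?thesis using K by (simp add: field_simps)
  qed
  obtain c where c: "\<forall>i. c i \<in> set_pmf PU"
    "(\<Sum>x\<in>set_pmf PX. if \<exists>i<M. (x, c i) \<in> G then 0 else pmf PX x)
      \<le> (\<Sum>x\<in>set_pmf PX. pmf PX x * (1 - measure PU {u. (x, u) \<in> G}) ^ M)"
    using covering_code[OF finPU finPX] by blast
  \<comment> \<open>The shift by \<open>Suc\<close> reserves index 0 for uncovered x, so the word
    belonging to index i is \<open>c (i - 1)\<close>.\<close>
  define e where "e x = (if \<exists>i<M. (x, c i) \<in> G then Suc (SOME i. i < M \<and> (x, c i) \<in> G) else 0)" for x
  have e: "e x \<le> M \<and> (x, c (e x - 1)) \<in> G" if "\<exists>i<M. (x, c i) \<in> G" for x
    using someI_ex[OF that] that by (auto simp: e_def)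
  let ?bad = "{z. e (snd z) = 0 \<or> (fst z, c (e (snd z) - 1)) \<notin> B}"
  let ?unc = "\<lambda>x. if \<exists>i<M. (x, c i) \<in> G then 0 else 1 :: real"
  have "measure P ?bad = expect PX (\<lambda>x. measure (\<kappa> x) ?bad)"
    by (subst P, rule measure_bind_expect) (use finPX fin\<kappa> in auto)
  also have "\<dots> \<le> expect PX (\<lambda>x. ?unc x + \<eta>)"
  proof (rule expect_mono[OF finPX])
    fix x assume x: "x \<in> set_pmf PX"
    show "measure (\<kappa> x) ?bad \<le> ?unc x + \<eta>"
    proof (cases "\<exists>i<M. (x, c i) \<in> G")
      case True
      have "measure (\<kappa> x) ?bad \<le> measure (\<kappa> x) {z. (fst z, c (e x - 1)) \<notin> B}"
        by (rule measure_pmf_mono_on) (use True set\<kappa>[OF x] in \<open>auto simp: e_def\<close>)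
      also have "\<dots> \<le> \<eta>" using e[OF True] by (simp add: G_def b_def)
      finally show ?thesis using True by simp
    next
      case False
      then have "?unc x = 1" by (rule if_not_P)
      then show ?thesis using \<eta> measure_pmf.prob_le_1[of "\<kappa> x" ?bad] by linarith
    qed
  qed
  also have "\<dots> = expect PX ?unc + \<eta>" by (subst expect_add[OF finPX]) simp
  also have "expect PX ?unc = (\<Sum>x\<in>set_pmf PX. if \<exists>i<M. (x, c i) \<in> G then 0 else pmf PX x)"
    unfolding expect_sum[OF finPX subset_refl] by (intro sum.cong) auto
  also have "\<dots> \<le> expect PX (\<lambda>x. (1 - measure PU {u. (x, u) \<in> G}) ^ M)"
    using c(2) by (simp add: expect_sum[OF finPX subset_refl])
  also have "\<dots> \<le> expect PX (\<lambda>x. measure (W x) {u. (x, u) \<notin> T} + expect (W x) (b x) / \<eta> + exp (- (real M / K)))"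
  proof (rule expect_mono[OF finPX])
    fix x assume x: "x \<in> set_pmf PX"
    have "(1 - measure PU {u. (x, u) \<in> G}) ^ M \<le> 1 - g x + exp (- (real M / K))"
      by (rule one_minus_power_le) (use gp[OF x] K in \<open>auto simp: g_def\<close>)
    then show "(1 - measure PU {u. (x, u) \<in> G}) ^ M
      \<le> measure (W x) {u. (x, u) \<notin> T} + expect (W x) (b x) / \<eta> + exp (- (real M / K))"
      using g1[OF x] by linarith
  qed
  also have "\<dots> = measure J {t. (fst (snd t), snd (snd t)) \<notin> T} + measure J {t. (fst t, snd (snd t)) \<notin> B} / \<eta> + exp (- (real M / K))"
    unfolding JT JB by (subst expect_add[OF finPX], subst expect_add[OF finPX]) simp
  finally have "measure P ?bad \<le> measure J {t. (fst (snd t), snd (snd t)) \<notin> T}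
    + measure J {t. (fst t, snd (snd t)) \<notin> B} / \<eta> + exp (- (real M / K)) + \<eta>" by simp
  moreover have "\<forall>x. e x \<le> M" using e by (auto simp: e_def)
  ultimately show ?thesis using c(1) unfolding T_def by (intro exI[of _ c] exI[of _ e]) (simp add: case_prod_unfold)
qed

section \<open>Memoryless extension to blocks\<close>

primrec prod_channel :: "('x \<Rightarrow> 'u pmf) \<Rightarrow> 'x list \<Rightarrow> 'u list pmf" where
  "prod_channel W [] = return_pmf []"
| "prod_channel W (x # xs) = bind_pmf (W x) (\<lambda>u. map_pmf ((#) u) (prod_channel W xs))"

lemma finite_set_prod_channel: "(\<And>x. finite (set_pmf (W x))) \<Longrightarrow> finite (set_pmf (prod_channel W xs))"
  by (induction xs) auto

lemma pmf_prod_channel_Cons: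
  "pmf (prod_channel W (x # xs)) (u # us) = pmf (W x) u * pmf (prod_channel W xs) us"
proof -
  have "prod_channel W (x # xs) = map_pmf (\<lambda>(u, us). u # us) (pair_pmf (W x) (prod_channel W xs))"
    by (simp add: pair_pmf_def map_pmf_def bind_assoc_pmf bind_return_pmf)
  moreover have "pmf (map_pmf (\<lambda>(u, us). u # us) (pair_pmf (W x) (prod_channel W xs))) ((\<lambda>(u, us). u # us) (u, us))
      = pmf (pair_pmf (W x) (prod_channel W xs)) (u, us)"
    by (rule pmf_map_inj') (auto simp: inj_def)
  ultimately show ?thesis by (simp add: pmf_pair)
qed

text \<open>The channel acts letter by letter, so the draw of one u commutes with the draws of the
  later pairs. The joint law of a block is thus an i.i.d. sequence of triples, and the law of large
  numbers for information densities applies to it.\<close>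

lemma joint_YXU_replicate:
  "joint_YXU (map_pmf (\<lambda>zs. (map fst zs, map snd zs)) (replicate_pmf n P)) (prod_channel W)
    = map_pmf (\<lambda>ts. (map fst ts, map (\<lambda>t. fst (snd t)) ts, map (\<lambda>t. snd (snd t)) ts)) (replicate_pmf n (joint_YXU P W))"
proof (induction n)
  case 0
  show ?case by (simp add: joint_YXU_def bind_return_pmf)
next
  case (Suc n)
  let ?cons = "\<lambda>y x u t. (y # fst t, x # fst (snd t), u # snd (snd t))"
  have "joint_YXU (map_pmf (\<lambda>zs. (map fst zs, map snd zs)) (replicate_pmf (Suc n) P)) (prod_channel W)
    = bind_pmf P (\<lambda>z. bind_pmf (replicate_pmf n P) (\<lambda>zs. bind_pmf (W (snd z)) (\<lambda>u.
        map_pmf (\<lambda>us. (fst z # map fst zs, snd z # map snd zs, u # us)) (prod_channel W (map snd zs)))))"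
    by (simp add: joint_YXU_def bind_map_pmf bind_assoc_pmf map_bind_pmf map_pmf_comp bind_return_pmf)
  also have "\<dots> = bind_pmf P (\<lambda>z. bind_pmf (W (snd z)) (\<lambda>u. bind_pmf (replicate_pmf n P) (\<lambda>zs.
        map_pmf (\<lambda>us. (fst z # map fst zs, snd z # map snd zs, u # us)) (prod_channel W (map snd zs)))))"
    by (intro bind_pmf_cong refl bind_commute_pmf)
  also have "\<dots> = bind_pmf P (\<lambda>z. bind_pmf (W (snd z)) (\<lambda>u. map_pmf (?cons (fst z) (snd z) u)
        (joint_YXU (map_pmf (\<lambda>zs. (map fst zs, map snd zs)) (replicate_pmf n P)) (prod_channel W))))"
    by (simp add: joint_YXU_def bind_map_pmf map_bind_pmf map_pmf_comp)
  also have "\<dots> = map_pmf (\<lambda>ts. (map fst ts, map (\<lambda>t. fst (snd t)) ts, map (\<lambda>t. snd (snd t)) ts)) (replicate_pmf (Suc n) (joint_YXU P W))"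
    unfolding Suc replicate_pmf_Suc_map
    by (simp add: joint_YXU_def bind_assoc_pmf map_bind_pmf bind_map_pmf map_pmf_comp case_prod_unfold)
  finally show ?case .
qed

text \<open>An information density in multiplied form: it adds up along a block without any quotient
  of block masses being formed, so points of mass 0 cause no case distinction.\<close>

lemma pmf_replicate_exp_factor:
  assumes "\<And>t. t \<in> set ts \<Longrightarrow> pmf p (F t) = exp (f t) * pmf q (G t) * pmf r (H t)"
  shows "pmf (replicate_pmf (length ts) p) (map F ts)
    = exp (sum_list (map f ts)) * pmf (replicate_pmf (length ts) q) (map G ts) * pmf (replicate_pmf (length ts) r) (map H ts)"
  using assms by (induction ts) (simp_all add: pmf_replicate_Cons exp_add mult_ac del: replicate_pmf.simps(2))

lemma pmf_prod_channel_exp_factor: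
  assumes "\<And>t. t \<in> set ts \<Longrightarrow> pmf (W (G t)) (F t) = exp (f t) * pmf q (F t)"
  shows "pmf (prod_channel W (map G ts)) (map F ts) = exp (sum_list (map f ts)) * pmf (replicate_pmf (length ts) q) (map F ts)"
  using assms
  by (induction ts) (simp_all add: pmf_replicate_Cons pmf_prod_channel_Cons exp_add mult_ac
      del: replicate_pmf.simps(2) prod_channel.simps(2))

text \<open>For fixed \<open>us\<close> the quotients of \<open>pmf p (zip ys us)\<close> by the
  mass of \<open>us\<close> sum to at most 1 over ys, and on the tested set each is at least exp t
  times the mass of ys under q.\<close>

lemma measure_density_test_le:
  assumes us: "us \<in> set_pmf (replicate_pmf n (map_pmf snd p))" and fin: "finite (set_pmf q)"
  shows "measure (replicate_pmf n q) {ys. exp t * pmf (replicate_pmf n q) ys * pmf (replicate_pmf n (map_pmf snd p)) us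
      \<le> pmf (replicate_pmf n p) (zip ys us)} \<le> exp (- t)"
proof -
  let ?A = "{ys. exp t * pmf (replicate_pmf n q) ys * pmf (replicate_pmf n (map_pmf snd p)) us
      \<le> pmf (replicate_pmf n p) (zip ys us)}"
  let ?q = "replicate_pmf n q" and ?p = "replicate_pmf n p" and ?u = "replicate_pmf n (map_pmf snd p)"
  have len: "length us = n" using us by (auto simp: set_replicate_pmf)
  have u0: "0 < pmf ?u us" using us by (rule pmf_positive)
  have finq: "finite (set_pmf ?q)" using fin by (rule finite_set_replicate_pmf)
  have inj: "inj_on (\<lambda>ys. zip ys us) (set_pmf ?q)"
    by (rule inj_on_inverseI[where g = "map fst"]) (auto simp: set_replicate_pmf len)
  have "(\<Sum>ys\<in>set_pmf ?q. pmf ?p (zip ys us)) = sum (pmf ?p) ((\<lambda>ys. zip ys us) ` set_pmf ?q)"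
    by (simp add: sum.reindex[OF inj])
  also have "\<dots> = measure ?p ((\<lambda>ys. zip ys us) ` set_pmf ?q)"
    using finq by (simp add: measure_measure_pmf_finite)
  also have "\<dots> \<le> measure ?p (map snd -` {us})"
    by (intro measure_pmf.finite_measure_mono) (auto simp: set_replicate_pmf len)
  also have "\<dots> = pmf ?u us" by (simp add: map_replicate_pmf[symmetric] pmf_map)
  finally have le: "(\<Sum>ys\<in>set_pmf ?q. pmf ?p (zip ys us)) \<le> pmf ?u us" .
  have "exp t * pmf ?u us * measure ?q ?A = (\<Sum>ys\<in>set_pmf ?q \<inter> ?A. exp t * pmf ?q ys * pmf ?u us)"
    by (simp add: measure_pmf_sum[OF finq] sum_distrib_left mult_ac)
  also have "\<dots> \<le> (\<Sum>ys\<in>set_pmf ?q \<inter> ?A. pmf ?p (zip ys us))" by (intro sum_mono) auto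
  also have "\<dots> \<le> (\<Sum>ys\<in>set_pmf ?q. pmf ?p (zip ys us))" using finq by (intro sum_mono2) auto
  also note le
  finally have "exp t * measure ?q ?A * pmf ?u us \<le> 1 * pmf ?u us" by (simp add: mult_ac)
  then have "exp t * measure ?q ?A \<le> 1" using u0 by (subst (asm) mult_le_cancel_right) auto
  then show ?thesis by (simp add: exp_minus field_simps)
qed

text \<open>Message 0 is always rejected. The bound is asked of each message separately: under the
  product of the marginals the message is independent of y, so the second error is an average of
  these probabilities.\<close>

abbreviation index_code where
  "index_code q n M E e A \<equiv> (\<forall>xs. e xs \<le> M) \<and> (\<forall>ys. (ys, 0) \<notin> A) \<and>
    (\<forall>m. measure (replicate_pmf n q) {ys. (ys, m) \<in> A} \<le> exp (- (real n * E)))"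

abbreviation miss_prob where
  "miss_prob P n e A \<equiv> measure (replicate_pmf n P) {zs. (map fst zs, e (map snd zs)) \<notin> A}"

text \<open>\<open>one_shot_code\<close> on blocks with K = exp (n (R + \<delta>')), where B
  collects the pairs whose information density is at least n (I(Y;U) - \<delta>). The constant C
  comes from the variances of the densities \<open>iX\<close> and \<open>iY\<close> and is chosen
  before n, M, \<delta>' and \<eta>, which are thereby free to vary together.\<close>

lemma block_code:
  fixes P :: "('y::finite \<times> 'x::finite) pmf"
  assumes W: "feasible_channel P R W" and \<delta>: "0 < \<delta>"
  shows "\<exists>C>0. \<forall>n M. \<forall>\<delta>'>0. \<forall>\<eta>>0. 0 < n \<longrightarrow>
    (\<exists>e A. index_code (map_pmf fst P) n M (info_YU P W - \<delta>) e A \<and>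
      miss_prob P n e A
       \<le> C / (real n * \<delta>'\<^sup>2) + C / (real n * \<delta>\<^sup>2) / \<eta> + exp (- (real M / exp (real n * (R + \<delta>')))) + \<eta>)"
proof -
  have finW: "\<And>x. finite (set_pmf (W x))" and R: "info_UX P W \<le> R" using W by (auto simp: feasible_channel_def)
  define J where "J = joint_YXU P W"
  have finJ: "finite (set_pmf J)" unfolding J_def by (rule finite_set_joint_YXU) (rule finW)
  define PX where "PX = map_pmf snd P"
  define PY where "PY = map_pmf fst P"
  define PU where "PU = map_pmf (\<lambda>(y, x, u). u) J"
  define JYU where "JYU = map_pmf (\<lambda>(y, x, u). (y, u)) J"
  define JUX where "JUX = map_pmf (\<lambda>(y, x, u). (u, x)) J"
  define iX :: "'y \<times> 'x \<times> nat \<Rightarrow> real" where "iX = (\<lambda>(y, x, u). ln (pmf JUX (u, x) / (pmf PU u * pmf PX x)))"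
  define iY :: "'y \<times> 'x \<times> nat \<Rightarrow> real" where "iY = (\<lambda>(y, x, u). ln (pmf JYU (y, u) / (pmf PY y * pmf PU u)))"
  have X: "map_pmf (\<lambda>(y, x, u). x) J = PX" and Y: "map_pmf (\<lambda>(y, x, u). y) J = PY"
    unfolding PX_def PY_def J_def
    by (subst (2) map_joint_YXU_fst[of P W, symmetric], simp add: map_pmf_comp case_prod_unfold)+
  have PU_bind: "PU = bind_pmf PX W"
    by (simp add: PU_def PX_def J_def joint_YXU_def map_bind_pmf bind_map_pmf map_pmf_comp case_prod_unfold)
  have EX: "expect J iX = info_UX P W"
    unfolding info_UX_def J_def[symmetric] mutual_info_expect X PU_def[symmetric]
    by (intro expect_cong) (auto simp: iX_def JUX_def case_prod_unfold)
  have EY: "expect J iY = info_YU P W"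
    unfolding info_YU_def J_def[symmetric] mutual_info_expect Y PU_def[symmetric]
    by (intro expect_cong) (auto simp: iY_def JYU_def case_prod_unfold)
  have pos: "0 < pmf PX x" "0 < pmf PY y" "0 < pmf PU u" "0 < pmf JYU (y, u)" "0 < pmf JUX (u, x)"
    if "(y, x, u) \<in> set_pmf J" for y x u
    using that unfolding X[symmetric] Y[symmetric] PU_def JYU_def JUX_def
    by (force intro!: pmf_positive)+
  have JUXW: "pmf JUX (u, x) = pmf PX x * pmf (W x) u" if "x \<in> set_pmf PX" for x u
  proof -
    have "JUX = bind_pmf PX (\<lambda>x. map_pmf (\<lambda>u. (u, x)) (W x))"
      by (simp add: JUX_def J_def PX_def joint_YXU_def map_bind_pmf bind_map_pmf map_pmf_comp case_prod_unfold)
    then have "pmf JUX (u, x) = pmf PX x * pmf (map_pmf (\<lambda>u. (u, x)) (W x)) (u, x)"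
      by (simp only:) (subst pmf_bind_disjoint[where \<phi> = snd], use that in auto)
    also have "pmf (map_pmf (\<lambda>u. (u, x)) (W x)) (u, x) = pmf (W x) u"
      using pmf_map_inj'[of "\<lambda>u. (u, x)" "W x" u] by (simp add: inj_def)
    finally show ?thesis .
  qed
  have WX: "pmf (W (fst (snd t))) (snd (snd t)) = exp (iX t) * pmf PU (snd (snd t))"
    and WY: "pmf JYU (fst t, snd (snd t)) = exp (iY t) * pmf PY (fst t) * pmf PU (snd (snd t))"
    if "t \<in> set_pmf J" for t
  proof -
    obtain y x u where t: "t = (y, x, u)" by (cases t)
    with that have p: "0 < pmf PX x" "0 < pmf PY y" "0 < pmf PU u" "0 < pmf JYU (y, u)" "0 < pmf JUX (u, x)"
      using pos[of y x u] by auto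
    then have "x \<in> set_pmf PX" by (simp add: set_pmf_iff)
    then show "pmf (W (fst (snd t))) (snd (snd t)) = exp (iX t) * pmf PU (snd (snd t))"
      using p JUXW[of x u] by (simp add: t iX_def zero_less_mult_iff)
    show "pmf JYU (fst t, snd (snd t)) = exp (iY t) * pmf PY (fst t) * pmf PU (snd (snd t))"
      using p by (simp add: t iY_def)
  qed
  obtain CX where CX: "0 < CX" "\<And>n \<delta>. 0 < n \<Longrightarrow> 0 < \<delta> \<Longrightarrow>
    measure (replicate_pmf n J) {ts. real n * \<delta> \<le> \<bar>sum_list (map iX ts) - real n * info_UX P W\<bar>} \<le> CX / (real n * \<delta>\<^sup>2)"
    using iid_concentration[OF finJ, of iX] unfolding EX by blast
  obtain CY where CY: "0 < CY" "\<And>n \<delta>. 0 < n \<Longrightarrow> 0 < \<delta> \<Longrightarrow>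
    measure (replicate_pmf n J) {ts. real n * \<delta> \<le> \<bar>sum_list (map iY ts) - real n * info_YU P W\<bar>} \<le> CY / (real n * \<delta>\<^sup>2)"
    using iid_concentration[OF finJ, of iY] unfolding EY by blast
  have "\<exists>e A. index_code PY n M (info_YU P W - \<delta>) e A \<and>
      miss_prob P n e A
       \<le> (CX + CY) / (real n * \<delta>'\<^sup>2) + (CX + CY) / (real n * \<delta>\<^sup>2) / \<eta> + exp (- (real M / exp (real n * (R + \<delta>')))) + \<eta>"
    if \<delta>': "0 < \<delta>'" and \<eta>: "0 < \<eta>" and n: "0 < n" for n M :: nat and \<delta>' \<eta> :: real
  proof -
    let ?Pn = "map_pmf (\<lambda>zs. (map fst zs, map snd zs)) (replicate_pmf n P)"
    let ?Wn = "prod_channel W"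
    let ?Jn = "joint_YXU ?Pn ?Wn"
    let ?K = "exp (real n * (R + \<delta>'))"
    let ?PUn = "replicate_pmf n PU"
    let ?tri = "\<lambda>ts. (map fst ts, map (\<lambda>t. fst (snd t)) ts, map (\<lambda>t. snd (snd t)) ts)"
    define B where "B = {(ys, us). exp (real n * (info_YU P W - \<delta>)) * pmf (replicate_pmf n PY) ys * pmf ?PUn us
        \<le> pmf (replicate_pmf n JYU) (zip ys us)}"
    have Jn: "?Jn = map_pmf ?tri (replicate_pmf n J)"
      unfolding J_def by (rule joint_YXU_replicate)
    have PUn: "bind_pmf (map_pmf snd ?Pn) ?Wn = ?PUn"
    proof -
      have "bind_pmf (map_pmf snd ?Pn) ?Wn = map_pmf (\<lambda>t. snd (snd t)) ?Jn"
        by (simp add: joint_YXU_def bind_map_pmf map_bind_pmf map_pmf_comp)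
      also have "\<dots> = map_pmf (map (\<lambda>t. snd (snd t))) (replicate_pmf n J)"
        unfolding Jn by (simp add: map_pmf_comp)
      also have "\<dots> = ?PUn" by (simp add: map_replicate_pmf PU_def case_prod_unfold)
      finally show ?thesis .
    qed
    have fin1: "finite (set_pmf ?Pn)" by (simp add: finite_set_replicate_pmf)
    obtain c e where ce: "\<forall>i. c i \<in> set_pmf ?PUn" "\<forall>x. e x \<le> M"
      "measure ?Pn {z. e (snd z) = 0 \<or> (fst z, c (e (snd z) - 1)) \<notin> B}
       \<le> measure ?Jn {t. \<not> pmf (?Wn (fst (snd t))) (snd (snd t)) \<le> ?K * pmf ?PUn (snd (snd t))}
        + measure ?Jn {t. (fst t, snd (snd t)) \<notin> B} / \<eta> + exp (- (real M / ?K)) + \<eta>"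
      using one_shot_code[where P = ?Pn and W = ?Wn and K = ?K and \<eta> = \<eta> and M = M and B = B,
          OF fin1 finite_set_prod_channel[OF finW] exp_gt_zero \<eta>]
      unfolding PUn by (elim exE conjE) (rule that)
    define A where "A = {(ys, m). m \<noteq> 0 \<and> (ys, c (m - 1)) \<in> B}"
    have type2: "measure (replicate_pmf n PY) {ys. (ys, m) \<in> A} \<le> exp (- (real n * (info_YU P W - \<delta>)))" for m
    proof -
      have snd: "map_pmf snd JYU = PU" by (simp add: JYU_def PU_def map_pmf_comp case_prod_unfold)
      have "measure (replicate_pmf n PY) {ys. (ys, m) \<in> A}
        \<le> measure (replicate_pmf n PY) {ys. exp (real n * (info_YU P W - \<delta>)) * pmf (replicate_pmf n PY) ys
            * pmf (replicate_pmf n (map_pmf snd JYU)) (c (m - 1)) \<le> pmf (replicate_pmf n JYU) (zip ys (c (m - 1)))}"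
        by (intro measure_pmf.finite_measure_mono) (auto simp: A_def B_def snd)
      also have "\<dots> \<le> exp (- (real n * (info_YU P W - \<delta>)))"
        by (rule measure_density_test_le) (use ce(1) in \<open>auto simp: snd\<close>)
      finally show ?thesis .
    qed
    have inJ: "length ts = n \<and> (\<forall>t\<in>set ts. t \<in> set_pmf J)" if "ts \<in> set_pmf (replicate_pmf n J)" for ts
      using that by (auto simp: set_replicate_pmf)
    have T: "measure ?Jn {t. \<not> pmf (?Wn (fst (snd t))) (snd (snd t)) \<le> ?K * pmf ?PUn (snd (snd t))} \<le> CX / (real n * \<delta>'\<^sup>2)"
    proof -
      have "measure ?Jn {t. \<not> pmf (?Wn (fst (snd t))) (snd (snd t)) \<le> ?K * pmf ?PUn (snd (snd t))}
        = measure (replicate_pmf n J) {ts. \<not> pmf (?Wn (map (\<lambda>t. fst (snd t)) ts)) (map (\<lambda>t. snd (snd t)) ts) \<le> ?K * pmf ?PUn (map (\<lambda>t. snd (snd t)) ts)}"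
        unfolding Jn by (simp add: measure_map_pmf vimage_def)
      also have "\<dots> \<le> measure (replicate_pmf n J) {ts. real n * \<delta>' \<le> \<bar>sum_list (map iX ts) - real n * info_UX P W\<bar>}"
      proof (rule measure_pmf_mono_on, rule CollectI)
        fix ts assume ts: "ts \<in> set_pmf (replicate_pmf n J)"
          "ts \<in> {ts. \<not> pmf (?Wn (map (\<lambda>t. fst (snd t)) ts)) (map (\<lambda>t. snd (snd t)) ts) \<le> ?K * pmf ?PUn (map (\<lambda>t. snd (snd t)) ts)}"
        have eq: "pmf (?Wn (map (\<lambda>t. fst (snd t)) ts)) (map (\<lambda>t. snd (snd t)) ts) = exp (sum_list (map iX ts)) * pmf ?PUn (map (\<lambda>t. snd (snd t)) ts)"
          using pmf_prod_channel_exp_factor[of ts W "\<lambda>t. fst (snd t)" "\<lambda>t. snd (snd t)" iX PU] WX inJ[OF ts(1)] by auto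
        have "real n * (R + \<delta>') \<le> sum_list (map iX ts)"
        proof (rule ccontr)
          assume "\<not> real n * (R + \<delta>') \<le> sum_list (map iX ts)"
          then have "exp (sum_list (map iX ts)) * pmf ?PUn (map (\<lambda>t. snd (snd t)) ts) \<le> ?K * pmf ?PUn (map (\<lambda>t. snd (snd t)) ts)"
            by (intro mult_right_mono) auto
          then show False using ts(2) eq by simp
        qed
        moreover have "real n * info_UX P W \<le> real n * R" using R by (simp add: mult_left_mono)
        ultimately show "real n * \<delta>' \<le> \<bar>sum_list (map iX ts) - real n * info_UX P W\<bar>"
          by (simp add: distrib_left)
      qed
      also have "\<dots> \<le> CX / (real n * \<delta>'\<^sup>2)" by (rule CX(2)[OF n \<delta>'])
      finally show ?thesis .
    qed
    have BY: "measure ?Jn {t. (fst t, snd (snd t)) \<notin> B} \<le> CY / (real n * \<delta>\<^sup>2)"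
    proof -
      have "measure ?Jn {t. (fst t, snd (snd t)) \<notin> B}
        = measure (replicate_pmf n J) {ts. (map fst ts, map (\<lambda>t. snd (snd t)) ts) \<notin> B}"
        unfolding Jn by (simp add: measure_map_pmf vimage_def)
      also have "\<dots> \<le> measure (replicate_pmf n J) {ts. real n * \<delta> \<le> \<bar>sum_list (map iY ts) - real n * info_YU P W\<bar>}"
      proof (rule measure_pmf_mono_on, rule CollectI)
        fix ts assume ts: "ts \<in> set_pmf (replicate_pmf n J)" "ts \<in> {ts. (map fst ts, map (\<lambda>t. snd (snd t)) ts) \<notin> B}"
        have eq: "pmf (replicate_pmf n JYU) (zip (map fst ts) (map (\<lambda>t. snd (snd t)) ts))
          = exp (sum_list (map iY ts)) * pmf (replicate_pmf n PY) (map fst ts) * pmf ?PUn (map (\<lambda>t. snd (snd t)) ts)"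
          using pmf_replicate_exp_factor[of ts JYU "\<lambda>t. (fst t, snd (snd t))" iY PY fst PU "\<lambda>t. snd (snd t)"] WY inJ[OF ts(1)]
          by (auto simp: zip_map_map zip_same_conv_map comp_def)
        have "sum_list (map iY ts) \<le> real n * (info_YU P W - \<delta>)"
        proof (rule ccontr)
          assume "\<not> sum_list (map iY ts) \<le> real n * (info_YU P W - \<delta>)"
          then have "exp (real n * (info_YU P W - \<delta>)) * pmf (replicate_pmf n PY) (map fst ts) * pmf ?PUn (map (\<lambda>t. snd (snd t)) ts)
            \<le> exp (sum_list (map iY ts)) * pmf (replicate_pmf n PY) (map fst ts) * pmf ?PUn (map (\<lambda>t. snd (snd t)) ts)"
            by (intro mult_right_mono) auto
          then show False using ts(2) eq by (simp add: B_def)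
        qed
        then show "real n * \<delta> \<le> \<bar>sum_list (map iY ts) - real n * info_YU P W\<bar>"
          by (simp add: right_diff_distrib)
      qed
      also have "\<dots> \<le> CY / (real n * \<delta>\<^sup>2)" by (rule CY(2)[OF n \<delta>])
      finally show ?thesis .
    qed
    have "miss_prob P n e A
       = measure ?Pn {z. e (snd z) = 0 \<or> (fst z, c (e (snd z) - 1)) \<notin> B}"
      by (simp add: measure_map_pmf vimage_def A_def)
    also note ce(3)
    also have "measure ?Jn {t. \<not> pmf (?Wn (fst (snd t))) (snd (snd t)) \<le> ?K * pmf ?PUn (snd (snd t))}
        + measure ?Jn {t. (fst t, snd (snd t)) \<notin> B} / \<eta> + exp (- (real M / ?K)) + \<eta>
      \<le> (CX + CY) / (real n * \<delta>'\<^sup>2) + (CX + CY) / (real n * \<delta>\<^sup>2) / \<eta> + exp (- (real M / ?K)) + \<eta>"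
    proof -
      have "CX / (real n * \<delta>'\<^sup>2) \<le> (CX + CY) / (real n * \<delta>'\<^sup>2)"
        using CY(1) by (intro divide_right_mono) auto
      moreover have "measure ?Jn {t. (fst t, snd (snd t)) \<notin> B} / \<eta> \<le> (CX + CY) / (real n * \<delta>\<^sup>2) / \<eta>"
      proof (rule divide_right_mono)
        have "CY / (real n * \<delta>\<^sup>2) \<le> (CX + CY) / (real n * \<delta>\<^sup>2)"
          using CX(1) by (intro divide_right_mono) auto
        then show "measure ?Jn {t. (fst t, snd (snd t)) \<notin> B} \<le> (CX + CY) / (real n * \<delta>\<^sup>2)" using BY by linarith
      qed (use \<eta> in auto)
      ultimately show ?thesis using T by linarith
    qed
    finally show ?thesis using ce(2) type2 by (intro exI[of _ e] exI[of _ A]) (auto simp: A_def)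
  qed
  then show ?thesis using CX(1) CY(1) unfolding PY_def by (intro exI[of _ "CX + CY"]) auto
qed

text \<open>With t = n^(1/4), the choices \<delta>' = 1/t, \<eta> = 1/t^2 and M about exp (n (R +
  2/t)) make all four error terms of order 1/t^2: n \<delta>'^2 = t^2, n \<eta> = t^2, and M / K is
  at least exp (t^3). The excess rate 2/t tends to 0, while \<delta>, which only affects the
  exponent, stays fixed.\<close>

lemma code_sequence:
  fixes P :: "('y::finite \<times> 'x::finite) pmf"
  assumes W: "feasible_channel P R W" and R: "0 \<le> R" and \<delta>: "0 < \<delta>"
  shows "\<exists>M e A. (\<forall>n>0. index_code (map_pmf fst P) n (M n) (info_YU P W - \<delta>) (e n) (A n)) \<and>
    (\<lambda>n. miss_prob P n (e n) (A n)) \<longlonglongrightarrow> 0 \<and>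
    (\<exists>s. s \<longlonglongrightarrow> 0 \<and> (\<forall>n>0. 1 / real n * ln (real (M n + 1)) \<le> R + s n))"
proof -
  obtain C where C: "0 < C" "\<forall>n M. \<forall>\<delta>'>0. \<forall>\<eta>>0. 0 < n \<longrightarrow>
    (\<exists>e A. index_code (map_pmf fst P) n M (info_YU P W - \<delta>) e A \<and>
      miss_prob P n e A
       \<le> C / (real n * \<delta>'\<^sup>2) + C / (real n * \<delta>\<^sup>2) / \<eta> + exp (- (real M / exp (real n * (R + \<delta>')))) + \<eta>)"
    using block_code[OF W \<delta>] by (elim exE conjE) (rule that)
  define t where "t n = sqrt (sqrt (real n))" for n
  have t2: "(t n)\<^sup>2 = sqrt (real n)" and t4: "(t n) ^ 4 = real n" for n
  proof -
    show t2: "(t n)\<^sup>2 = sqrt (real n)" by (simp add: t_def)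
    have "(t n) ^ 4 = ((t n)\<^sup>2)\<^sup>2" by (simp add: power_mult[symmetric])
    then show "(t n) ^ 4 = real n" by (simp add: t2)
  qed
  have t1: "1 \<le> t n" if "0 < n" for n using that by (simp add: t_def)
  define M where "M n = nat \<lceil>exp (real n * (R + 2 / t n))\<rceil>" for n
  define good where "good n e A \<longleftrightarrow> index_code (map_pmf fst P) n (M n) (info_YU P W - \<delta>) e A \<and>
      miss_prob P n e A
       \<le> (C + C / \<delta>\<^sup>2 + 2) * inverse ((t n)\<^sup>2)" for n e and A :: "('y list \<times> nat) set"
  have "\<exists>e A. 0 < n \<longrightarrow> good n e A" for n
  proof (cases "0 < n")
    case n: True
    have tn: "0 < t n" "1 \<le> t n" using t1[OF n] by auto
    let ?e = "C / (real n * (1 / t n)\<^sup>2) + C / (real n * \<delta>\<^sup>2) / (1 / (t n)\<^sup>2) + exp (- (real (M n) / exp (real n * (R + 1 / t n)))) + 1 / (t n)\<^sup>2"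
    have "C / (real n * (1 / t n)\<^sup>2) = C * inverse ((t n)\<^sup>2)"
      unfolding t4[of n, symmetric] using tn by (simp add: field_simps power2_eq_square power4_eq_xxxx)
    moreover have "C / (real n * \<delta>\<^sup>2) / (1 / (t n)\<^sup>2) = C / \<delta>\<^sup>2 * inverse ((t n)\<^sup>2)"
      unfolding t4[of n, symmetric] using tn \<delta> by (simp add: field_simps power2_eq_square power4_eq_xxxx)
    moreover have "exp (- (real (M n) / exp (real n * (R + 1 / t n)))) \<le> inverse ((t n)\<^sup>2)"
    proof -
      have nt: "real n * (1 / t n) = (t n) ^ 3"
        unfolding t4[of n, symmetric] using tn by (simp add: power3_eq_cube power4_eq_xxxx)
      have "(t n)\<^sup>2 \<le> (t n) ^ 3" using tn(2) by (intro power_increasing) auto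
      also have "\<dots> \<le> exp ((t n) ^ 3)" using exp_ge_add_one_self[of "(t n) ^ 3"] by linarith
      also have "\<dots> = exp (real n * (R + 2 / t n)) / exp (real n * (R + 1 / t n))"
        unfolding exp_diff[symmetric] nt[symmetric] by (simp add: algebra_simps)
      also have "\<dots> \<le> real (M n) / exp (real n * (R + 1 / t n))"
        unfolding M_def by (intro divide_right_mono real_nat_ceiling_ge) auto
      finally have le: "(t n)\<^sup>2 \<le> real (M n) / exp (real n * (R + 1 / t n))" .
      have "exp (- (real (M n) / exp (real n * (R + 1 / t n)))) \<le> exp (- (t n)\<^sup>2)" using le by simp
      also have "\<dots> = inverse (exp ((t n)\<^sup>2))" by (rule exp_minus)
      also have "\<dots> \<le> inverse ((t n)\<^sup>2)"
        by (rule le_imp_inverse_le) (use exp_ge_add_one_self[of "(t n)\<^sup>2"] in linarith, use tn in simp)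
      finally show ?thesis .
    qed
    moreover have "1 / (t n)\<^sup>2 = inverse ((t n)\<^sup>2)" by (simp add: inverse_eq_divide)
    ultimately have "?e \<le> (C + C / \<delta>\<^sup>2 + 2) * inverse ((t n)\<^sup>2)" by (simp add: algebra_simps)
    moreover obtain e A where "index_code (map_pmf fst P) n (M n) (info_YU P W - \<delta>) e A \<and>
      miss_prob P n e A \<le> ?e"
      using C(2)[rule_format, of "1 / t n" "1 / (t n)\<^sup>2" n "M n"] tn n by auto
    ultimately have "good n e A" unfolding good_def by - (elim conjE, intro conjI, assumption, assumption, assumption, linarith)
    then show ?thesis by blast
  qed auto
  then obtain e A where "\<And>n. 0 < n \<Longrightarrow> good n (e n) (A n)"
    by metis
  then have eA: "\<And>n. 0 < n \<Longrightarrow> index_code (map_pmf fst P) n (M n) (info_YU P W - \<delta>) (e n) (A n) \<and>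
      miss_prob P n (e n) (A n)
       \<le> (C + C / \<delta>\<^sup>2 + 2) * inverse ((t n)\<^sup>2)"
    unfolding good_def .
  have sq: "(\<lambda>n. inverse (sqrt (real n))) \<longlonglongrightarrow> 0"
    by (intro tendsto_inverse_0_at_top filterlim_compose[OF sqrt_at_top filterlim_real_sequentially])
  have tt: "(\<lambda>n. inverse (t n)) \<longlonglongrightarrow> 0"
    unfolding t_def
    by (intro tendsto_inverse_0_at_top filterlim_compose[OF sqrt_at_top] filterlim_real_sequentially)
  have "(\<lambda>n. miss_prob P n (e n) (A n)) \<longlonglongrightarrow> 0"
  proof (rule Lim_null_comparison)
    show "\<forall>\<^sub>F n in sequentially. norm (miss_prob P n (e n) (A n))
        \<le> (C + C / \<delta>\<^sup>2 + 2) * inverse (sqrt (real n))"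
      using eventually_gt_at_top[of 0] by eventually_elim (use eA t2 in auto)
    show "(\<lambda>n. (C + C / \<delta>\<^sup>2 + 2) * inverse (sqrt (real n))) \<longlonglongrightarrow> 0"
      using tendsto_mult[OF tendsto_const sq] by simp
  qed
  moreover define s where "s n = 2 * inverse (t n) + ln 3 * inverse (real n)" for n
  have "s \<longlonglongrightarrow> 0"
    unfolding s_def using tendsto_add[OF tendsto_mult[OF tendsto_const tt] tendsto_mult[OF tendsto_const lim_inverse_n]] by simp
  moreover have "1 / real n * ln (real (M n + 1)) \<le> R + s n" if n: "0 < n" for n
  proof -
    have tn: "0 < t n" using t1[OF n] by auto
    let ?a = "real n * (R + 2 / t n)"
    have a: "0 \<le> ?a" using R tn by simp
    \<comment> \<open>One unit for rounding up and one for message 0.\<close>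
    have "real (M n + 1) \<le> exp ?a + 2" unfolding M_def using exp_gt_zero[of ?a] by linarith
    also have "\<dots> \<le> 3 * exp ?a" using exp_ge_add_one_self[of ?a] a by linarith
    finally have "ln (real (M n + 1)) \<le> ln (3 * exp ?a)" by (intro ln_mono) auto
    also have "\<dots> = ln 3 + ?a" by (simp add: ln_mult)
    finally have "1 / real n * ln (real (M n + 1)) \<le> 1 / real n * (ln 3 + ?a)" by (intro mult_left_mono) auto
    also have "\<dots> = R + s n" using n tn by (simp add: s_def field_simps)
    finally show ?thesis .
  qed
  ultimately show ?thesis using eA by (intro exI[of _ M] exI[of _ e] exI[of _ A] conjI exI[of _ s]) auto
qed

section \<open>Achievability\<close>

text \<open>The interface between the alternatives and the two bounds, common to the product and the
  Markov case: domination, block length, and convergence in P-probability of the normalised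
  log-likelihood ratio to a.\<close>

definition log_ratio_rate :: "'a pmf \<Rightarrow> (nat \<Rightarrow> 'a list pmf) \<Rightarrow> real \<Rightarrow> bool" where
  "log_ratio_rate P Q a \<longleftrightarrow>
     (\<forall>n. set_pmf (replicate_pmf n P) \<subseteq> set_pmf (Q n)) \<and> (\<forall>n. \<forall>xs\<in>set_pmf (Q n). length xs = n) \<and>
     (\<forall>\<delta>>0. (\<lambda>n. measure (replicate_pmf n P)
        {xs. real n * \<delta> \<le> \<bar>ln (pmf (replicate_pmf n P) xs / pmf (Q n) xs) - real n * a\<bar>}) \<longlonglongrightarrow> 0)"

text \<open>A product law is Markov of order 0 with a constant transition law, and for k = 0 the
  mean increment is a single relative entropy.\<close>

lemma log_ratio_rate_product:
  fixes P Q :: "'a::finite pmf"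
  assumes "rel_entropy P Q < \<infinity>"
  shows "\<exists>a. rel_entropy P Q = ereal a \<and> log_ratio_rate P (\<lambda>n. replicate_pmf n Q) a"
proof -
  have sub: "set_pmf P \<subseteq> set_pmf Q" and rel: "rel_entropy P Q = ereal (expect P (\<lambda>x. ln (pmf P x / pmf Q x)))"
    using assms by (auto simp: rel_entropy_pmf split: if_splits)
  have mm: "markov_marginals 0 (\<lambda>_. Q) (\<lambda>n. replicate_pmf n Q)"
    unfolding markov_marginals_def by (auto simp: pmf_replicate_snoc set_replicate_pmf simp del: replicate_pmf.simps(2))
  have ac: "set_pmf (replicate_pmf n P) \<subseteq> set_pmf (replicate_pmf n Q)" for n
    using sub by (auto simp: set_replicate_pmf)
  have "log_ratio_rate P (\<lambda>n. replicate_pmf n Q) (expect P (\<lambda>x. ln (pmf P x / pmf Q x)))"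
    using log_ratio_concentration(2)[OF mm ac] ac
    unfolding log_ratio_rate_def by (auto simp: set_replicate_pmf)
  then show ?thesis using rel by blast
qed

lemma markov_marginals_of_process:
  fixes Q :: "nat \<Rightarrow> 'a::finite list pmf"
  assumes "finite_order_markov_marginals Q"
  shows "\<exists>k T. markov_marginals k T Q"
proof -
  obtain k L where law: "markov_process_law k L"
    and Q: "\<forall>n. measure_pmf (Q n) = distr L (count_space UNIV) (stake n)"
    using assms unfolding finite_order_markov_marginals_def by (elim exE conjE) (rule that)
  have L: "sets L = sets (stream_space (count_space UNIV))"
    using law unfolding markov_process_law_def by (elim conjE)
  obtain T where T: "\<forall>n\<ge>k. \<forall>xs a. length xs = n \<longrightarrow>
        measure L {\<omega> \<in> space L. stake (Suc n) \<omega> = xs @ [a]} =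
        measure L {\<omega> \<in> space L. stake n \<omega> = xs} * pmf (T (drop (n - k) xs)) a"
    using law unfolding markov_process_law_def by (elim conjE exE) (rule that)
  have meas: "stake n \<in> measurable L (count_space UNIV)" for n
    using measurable_stake measurable_cong_sets[OF L refl] by blast
  have pmfQ: "pmf (Q n) xs = measure L {\<omega> \<in> space L. stake n \<omega> = xs}" for n xs
  proof -
    have "pmf (Q n) xs = measure (Q n) {xs}" by (simp add: measure_pmf_single)
    also have "\<dots> = measure L (stake n -` {xs} \<inter> space L)"
      unfolding Q[rule_format] by (rule measure_distr) (use meas in auto)
    also have "stake n -` {xs} \<inter> space L = {\<omega> \<in> space L. stake n \<omega> = xs}" by auto
    finally show ?thesis .
  qed
  have "length xs = n" if "xs \<in> set_pmf (Q n)" for n xs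
  proof (rule ccontr)
    assume "length xs \<noteq> n"
    then have "{\<omega> \<in> space L. stake n \<omega> = xs} = {}" by auto
    then have "pmf (Q n) xs = 0" by (simp only: pmfQ measure_empty)
    then show False using that by (simp add: set_pmf_iff)
  qed
  then have "markov_marginals k T Q"
    unfolding markov_marginals_def pmfQ using T by blast
  then show ?thesis by blast
qed

lemma log_ratio_rate_markov:
  fixes P :: "'a::finite pmf"
  assumes Q: "finite_order_markov_marginals Q"
    and ac: "\<And>n. absolutely_continuous (measure_pmf (Q n)) (measure_pmf (replicate_pmf n P))"
  shows "\<exists>a. lim (rel_entropy_increment P Q) = ereal a \<and> log_ratio_rate P Q a"
proof -
  obtain k T where mm: "markov_marginals k T Q" using markov_marginals_of_process[OF Q] by blast
  have ac': "set_pmf (replicate_pmf n P) \<subseteq> set_pmf (Q n)" for n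
    using ac by (simp add: absolutely_continuous_pmf_iff)
  define a where "a = expect (replicate_pmf k P) (\<lambda>w. expect P (\<lambda>x. ln (pmf P x / pmf (T w) x)))"
  note conc = log_ratio_concentration[OF mm ac', folded a_def]
  have "rel_entropy_increment P Q \<longlonglongrightarrow> ereal a"
    by (rule tendsto_eventually) (use conc(1) in \<open>auto simp: eventually_at_top_linorder\<close>)
  then have "lim (rel_entropy_increment P Q) = ereal a" by (rule limI)
  moreover have "log_ratio_rate P Q a"
    using conc(2) ac' mm unfolding log_ratio_rate_def markov_marginals_def by blast
  ultimately show ?thesis by blast
qed

lemma alternative_rates:
  fixes P :: "('y::finite \<times> 'x::finite) pmf"
  assumes "product_alternative P QYs QXs d \<or> markov_alternative P QYs QXs d"
  shows "\<exists>aX aY. d = ereal (aX + aY) \<and> log_ratio_rate (map_pmf snd P) QXs aX \<and> log_ratio_rate (map_pmf fst P) QYs aY"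
  using assms
proof
  assume "product_alternative P QYs QXs d"
  then obtain QX QY where Q: "\<And>n. QXs n = replicate_pmf n QX" "\<And>n. QYs n = replicate_pmf n QY"
    and fin: "rel_entropy (map_pmf snd P) QX < \<infinity>" "rel_entropy (map_pmf fst P) QY < \<infinity>"
    and d: "d = rel_entropy (map_pmf snd P) QX + rel_entropy (map_pmf fst P) QY"
    by (auto simp: product_alternative_def Let_def)
  have "QXs = (\<lambda>n. replicate_pmf n QX)" "QYs = (\<lambda>n. replicate_pmf n QY)" using Q by auto
  moreover obtain aX where "rel_entropy (map_pmf snd P) QX = ereal aX"
    "log_ratio_rate (map_pmf snd P) (\<lambda>n. replicate_pmf n QX) aX"
    using log_ratio_rate_product[OF fin(1)] by blast
  moreover obtain aY where "rel_entropy (map_pmf fst P) QY = ereal aY"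
    "log_ratio_rate (map_pmf fst P) (\<lambda>n. replicate_pmf n QY) aY"
    using log_ratio_rate_product[OF fin(2)] by blast
  ultimately show ?thesis using d by (intro exI[of _ aX] exI[of _ aY]) simp
next
  assume "markov_alternative P QYs QXs d"
  then have m: "finite_order_markov_marginals QXs" "finite_order_markov_marginals QYs"
    "\<And>n. absolutely_continuous (measure_pmf (QXs n)) (measure_pmf (replicate_pmf n (map_pmf snd P)))"
    "\<And>n. absolutely_continuous (measure_pmf (QYs n)) (measure_pmf (replicate_pmf n (map_pmf fst P)))"
    and d: "d = lim (rel_entropy_increment (map_pmf snd P) QXs) + lim (rel_entropy_increment (map_pmf fst P) QYs)"
    by (auto simp: markov_alternative_def Let_def)
  obtain aX where "lim (rel_entropy_increment (map_pmf snd P) QXs) = ereal aX" "log_ratio_rate (map_pmf snd P) QXs aX"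
    using log_ratio_rate_markov[OF m(1,3)] by blast
  moreover obtain aY where "lim (rel_entropy_increment (map_pmf fst P) QYs) = ereal aY" "log_ratio_rate (map_pmf fst P) QYs aY"
    using log_ratio_rate_markov[OF m(2,4)] by blast
  ultimately show ?thesis using d by (intro exI[of _ aX] exI[of _ aY]) simp
qed

lemma map_fst_replicate: "map_pmf (map fst) (replicate_pmf n P) = replicate_pmf n (map_pmf fst P)"
  and map_snd_replicate: "map_pmf (map snd) (replicate_pmf n P) = replicate_pmf n (map_pmf snd P)"
  by (rule map_replicate_pmf)+

lemma error_exponent_ge:
  assumes "0 < n" "0 \<le> \<beta>" "\<beta> \<le> exp (- (real n * E))"
  shows "ereal E \<le> error_exponent n \<beta>"
proof (cases "\<beta> = 0")
  case False
  then have b: "0 < \<beta>" using assms by simp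
  have "ln \<beta> \<le> ln (exp (- (real n * E)))" using assms(3) b by (intro ln_mono) auto
  then have "real n * E \<le> ln (1 / \<beta>)" using b by (simp add: ln_div)
  then have "E \<le> 1 / real n * ln (1 / \<beta>)" using assms(1) by (simp add: field_simps)
  then show ?thesis using False by (simp add: error_exponent_def)
qed (simp add: error_exponent_def)

lemma pmf_bind_return_True: "pmf (bind_pmf p (\<lambda>z. return_pmf (b z))) True = measure p {z. b z}"
  and pmf_bind_return_False: "pmf (bind_pmf p (\<lambda>z. return_pmf (b z))) False = measure p {z. \<not> b z}"
  by (simp_all add: map_pmf_def[symmetric] pmf_map vimage_def)

text \<open>The multiplied form lets masses under Q be replaced by masses under P inside sums, also
  at points of mass 0. For b below the rate a the set has almost full P-probability and serves
  achievability; its counterpart \<open>above_rate\<close>, with b above a, serves the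
  converse.\<close>

definition below_rate :: "'a pmf \<Rightarrow> (nat \<Rightarrow> 'a list pmf) \<Rightarrow> real \<Rightarrow> nat \<Rightarrow> 'a list set" where
  "below_rate P Q b n = {xs. pmf (Q n) xs \<le> exp (- (real n * b)) * pmf (replicate_pmf n P) xs}"

definition above_rate :: "'a pmf \<Rightarrow> (nat \<Rightarrow> 'a list pmf) \<Rightarrow> real \<Rightarrow> nat \<Rightarrow> 'a list set" where
  "above_rate P Q b n = {xs. exp (- (real n * b)) * pmf (replicate_pmf n P) xs \<le> pmf (Q n) xs}"

lemma log_ratio_rate_negligible:
  assumes r: "log_ratio_rate P Q a" and \<delta>: "0 < \<delta>"
    and S: "\<And>n xs. xs \<in> set_pmf (replicate_pmf n P) \<Longrightarrow> 0 < pmf (replicate_pmf n P) xs \<Longrightarrow> 0 < pmf (Q n) xs \<Longrightarrow>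
      \<bar>ln (pmf (replicate_pmf n P) xs / pmf (Q n) xs) - real n * a\<bar> < real n * \<delta> \<Longrightarrow> xs \<in> S n"
  shows "(\<lambda>n. measure (replicate_pmf n P) (- S n)) \<longlonglongrightarrow> 0"
proof (rule Lim_null_comparison)
  let ?T = "\<lambda>n. {xs. real n * \<delta> \<le> \<bar>ln (pmf (replicate_pmf n P) xs / pmf (Q n) xs) - real n * a\<bar>}"
  show "(\<lambda>n. measure (replicate_pmf n P) (?T n)) \<longlonglongrightarrow> 0"
    using r \<delta> by (simp add: log_ratio_rate_def)
  have "measure (replicate_pmf n P) (- S n) \<le> measure (replicate_pmf n P) (?T n)" for n
  proof (rule measure_pmf_mono_on, rule CollectI, rule ccontr)
    fix xs assume xs: "xs \<in> set_pmf (replicate_pmf n P)" "xs \<in> - S n"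
      and lt: "\<not> real n * \<delta> \<le> \<bar>ln (pmf (replicate_pmf n P) xs / pmf (Q n) xs) - real n * a\<bar>"
    have "0 < pmf (replicate_pmf n P) xs" using xs(1) by (rule pmf_positive)
    moreover have "0 < pmf (Q n) xs" using xs(1) r by (intro pmf_positive) (auto simp: log_ratio_rate_def)
    ultimately show False using S[OF xs(1)] xs(2) lt by auto
  qed
  then show "\<forall>\<^sub>F n in sequentially. norm (measure (replicate_pmf n P) (- S n)) \<le> measure (replicate_pmf n P) (?T n)"
    by simp
qed

lemma below_rate_negligible:
  assumes r: "log_ratio_rate P Q a" and b: "b < a"
  shows "(\<lambda>n. measure (replicate_pmf n P) (- below_rate P Q b n)) \<longlonglongrightarrow> 0"
proof (rule log_ratio_rate_negligible[OF r, of "a - b"])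
  fix n xs assume p: "0 < pmf (replicate_pmf n P) xs" and q: "0 < pmf (Q n) xs"
    and lt: "\<bar>ln (pmf (replicate_pmf n P) xs / pmf (Q n) xs) - real n * a\<bar> < real n * (a - b)"
  have "ln (pmf (Q n) xs) \<le> ln (exp (- (real n * b)) * pmf (replicate_pmf n P) xs)"
    using lt p q by (simp add: ln_div ln_mult right_diff_distrib)
  then show "xs \<in> below_rate P Q b n"
    using p q by (subst (asm) ln_le_cancel_iff) (auto simp: below_rate_def)
qed (use b in simp)

lemma above_rate_negligible:
  assumes r: "log_ratio_rate P Q a" and b: "a < b"
  shows "(\<lambda>n. measure (replicate_pmf n P) (- above_rate P Q b n)) \<longlonglongrightarrow> 0"
proof (rule log_ratio_rate_negligible[OF r, of "b - a"])
  fix n xs assume p: "0 < pmf (replicate_pmf n P) xs" and q: "0 < pmf (Q n) xs"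
    and lt: "\<bar>ln (pmf (replicate_pmf n P) xs / pmf (Q n) xs) - real n * a\<bar> < real n * (b - a)"
  have "ln (exp (- (real n * b)) * pmf (replicate_pmf n P) xs) \<le> ln (pmf (Q n) xs)"
    using lt p q by (simp add: ln_div ln_mult right_diff_distrib)
  then show "xs \<in> above_rate P Q b n"
    using p q by (subst (asm) ln_le_cancel_iff) (auto simp: above_rate_def)
qed (use b in simp)

text \<open>The code made for the product of the marginals is reused. Blocks with untypical
  likelihood ratio are rejected, and on the others Q is at most exp (- n (aX + aY - 2 \<delta>))
  times the product of the marginals. Of the 3 \<delta> one is lost in the code and one in each of
  the two ratios.\<close>

lemma achievable_of_channel:
  fixes P :: "('y::finite \<times> 'x::finite) pmf"
  assumes W: "feasible_channel P R W" and R: "0 \<le> R" and \<delta>: "0 < \<delta>" and \<epsilon>: "0 \<le> \<epsilon>"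
    and X: "log_ratio_rate (map_pmf snd P) QXs aX" and Y: "log_ratio_rate (map_pmf fst P) QYs aY"
  shows "achievable P QYs QXs \<epsilon> R (info_YU P W + aX + aY - 3 * \<delta>)"
proof -
  define PX where "PX = map_pmf snd P"
  define PY where "PY = map_pmf fst P"
  define E where "E = info_YU P W + aX + aY - 3 * \<delta>"
  obtain M e A s' where code: "\<forall>n>0. index_code PY n (M n) (info_YU P W - \<delta>) (e n) (A n)"
    and err: "(\<lambda>n. miss_prob P n (e n) (A n)) \<longlonglongrightarrow> 0"
    and s': "s' \<longlonglongrightarrow> 0" "\<forall>n>0. 1 / real n * ln (real (M n + 1)) \<le> R + s' n"
    using code_sequence[OF W R \<delta>, folded PY_def] by (elim exE conjE) (rule that)
  \<comment> \<open>An untypical x-block is sent as message 0, which is never accepted; this check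
    falls to the encoder, as the decider does not see x. For n = 0 the code guarantees nothing, so 0
    is sent.\<close>
  define enc where "enc n xs = (if 0 < n \<and> xs \<in> below_rate PX QXs (aX - \<delta>) n then e n xs else 0)" for n xs
  define acc where "acc n = {(ys, m). ys \<in> below_rate PY QYs (aY - \<delta>) n \<and> (ys, m) \<in> A n}" for n
  define s :: "nat \<Rightarrow> ('y, 'x) test_scheme" where
    "s n = \<lparr>messages = {0..M n}, encoder = enc n, decider = (\<lambda>ys m. return_pmf ((ys, m) \<notin> acc n))\<rparr>" for n
  have scheme: "is_test_scheme n (s n)" for n
    using code by (auto simp: is_test_scheme_def s_def enc_def)
  have t1: "type1_error P n (s n) = measure (replicate_pmf n P) {zs. (map fst zs, enc n (map snd zs)) \<notin> acc n}" for n
    by (simp add: type1_error_def s_def pmf_bind_return_True)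
  have "(\<lambda>n. type1_error P n (s n)) \<longlonglongrightarrow> 0"
  proof (rule Lim_null_comparison)
    show "\<forall>\<^sub>F n in sequentially. norm (type1_error P n (s n)) \<le>
        miss_prob P n (e n) (A n)
        + (measure (replicate_pmf n PX) (- below_rate PX QXs (aX - \<delta>) n) + measure (replicate_pmf n PY) (- below_rate PY QYs (aY - \<delta>) n))"
      using eventually_gt_at_top[of 0]
    proof eventually_elim
      case (elim n)
      let ?R = "replicate_pmf n P"
      have "type1_error P n (s n) \<le> measure ?R ({zs. (map fst zs, e n (map snd zs)) \<notin> A n} \<union>
          (map snd -` (- below_rate PX QXs (aX - \<delta>) n) \<union> map fst -` (- below_rate PY QYs (aY - \<delta>) n)))"
        unfolding t1 by (intro measure_pmf.finite_measure_mono) (use elim in \<open>auto simp: enc_def acc_def\<close>)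
      also have "\<dots> \<le> measure ?R {zs. (map fst zs, e n (map snd zs)) \<notin> A n}
          + measure ?R (map snd -` (- below_rate PX QXs (aX - \<delta>) n) \<union> map fst -` (- below_rate PY QYs (aY - \<delta>) n))"
        by (rule measure_Un_le) auto
      also have "measure ?R (map snd -` (- below_rate PX QXs (aX - \<delta>) n) \<union> map fst -` (- below_rate PY QYs (aY - \<delta>) n))
        \<le> measure ?R (map snd -` (- below_rate PX QXs (aX - \<delta>) n)) + measure ?R (map fst -` (- below_rate PY QYs (aY - \<delta>) n))"
        by (rule measure_Un_le) auto
      finally show ?case
        unfolding PX_def PY_def map_fst_replicate[symmetric] map_snd_replicate[symmetric] measure_map_pmf
        by (simp add: type1_error_def)
    qed
    show "(\<lambda>n. miss_prob P n (e n) (A n)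
        + (measure (replicate_pmf n PX) (- below_rate PX QXs (aX - \<delta>) n) + measure (replicate_pmf n PY) (- below_rate PY QYs (aY - \<delta>) n))) \<longlonglongrightarrow> 0"
      using tendsto_add[OF err tendsto_add[OF below_rate_negligible[OF X, of "aX - \<delta>"] below_rate_negligible[OF Y, of "aY - \<delta>"]]] \<delta>
      by (simp add: PX_def PY_def)
  qed
  then have "limsup (\<lambda>n. ereal (type1_error P n (s n))) = ereal 0"
    by (intro lim_imp_Limsup) auto
  then have c1: "limsup (\<lambda>n. ereal (type1_error P n (s n))) \<le> ereal \<epsilon>" using \<epsilon> by simp
  have type2: "type2_error (QYs n) (QXs n) (s n) \<le> exp (- (real n * E))" if n: "0 < n" for n
  proof -
    let ?QQ = "pair_pmf (QYs n) (QXs n)"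
    let ?PP = "pair_pmf (replicate_pmf n PY) (replicate_pmf n PX)"
    let ?S = "{z. (fst z, enc n (snd z)) \<in> acc n}"
    let ?c = "exp (- (real n * (aX + aY - 2 * \<delta>)))"
    have finQ: "finite (set_pmf ?QQ)"
      using X Y by (auto simp: log_ratio_rate_def intro!: finite_set_pmf_lists)
    have "type2_error (QYs n) (QXs n) (s n) = measure ?QQ ?S"
      by (simp add: type2_error_def s_def case_prod_unfold pmf_bind_return_False)
    also have "\<dots> = (\<Sum>z\<in>set_pmf ?QQ \<inter> ?S. pmf ?QQ z)" by (rule measure_pmf_sum[OF finQ])
    also have "\<dots> \<le> (\<Sum>z\<in>set_pmf ?QQ \<inter> ?S. ?c * pmf ?PP z)"
    proof (rule sum_mono)
      fix z assume "z \<in> set_pmf ?QQ \<inter> ?S"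
      moreover obtain ys xs where z: "z = (ys, xs)" by (cases z)
      ultimately have "ys \<in> below_rate PY QYs (aY - \<delta>) n" "(ys, enc n xs) \<in> A n" by (auto simp: acc_def)
      moreover from this(2) have "enc n xs \<noteq> 0" using code n by (cases "enc n xs = 0") auto
      then have "xs \<in> below_rate PX QXs (aX - \<delta>) n" by (auto simp: enc_def split: if_splits)
      ultimately have "pmf (QYs n) ys * pmf (QXs n) xs
        \<le> (exp (- (real n * (aY - \<delta>))) * pmf (replicate_pmf n PY) ys) * (exp (- (real n * (aX - \<delta>))) * pmf (replicate_pmf n PX) xs)"
        by (intro mult_mono) (auto simp: below_rate_def)
      also have "\<dots> = (exp (- (real n * (aY - \<delta>))) * exp (- (real n * (aX - \<delta>)))) * pmf ?PP z"
        by (simp add: z pmf_pair)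
      also have "exp (- (real n * (aY - \<delta>))) * exp (- (real n * (aX - \<delta>))) = ?c"
        by (simp add: exp_add[symmetric] algebra_simps)
      finally show "pmf ?QQ z \<le> ?c * pmf ?PP z" by (simp add: z pmf_pair)
    qed
    also have "\<dots> = ?c * measure ?PP (set_pmf ?QQ \<inter> ?S)"
      using finQ by (simp add: sum_distrib_left measure_measure_pmf_finite)
    also have "measure ?PP (set_pmf ?QQ \<inter> ?S) \<le> measure ?PP {z. (fst z, enc n (snd z)) \<in> A n}"
      by (intro measure_pmf.finite_measure_mono) (auto simp: acc_def)
    \<comment> \<open>By independence x may be drawn before y; for each fixed x the message is fixed
      and the bound for single messages applies.\<close>
    also have "measure ?PP {z. (fst z, enc n (snd z)) \<in> A n} \<le> exp (- (real n * (info_YU P W - \<delta>)))"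
    proof -
      have fin: "finite (set_pmf (replicate_pmf n PX))" "finite (set_pmf (replicate_pmf n PY))"
        by (auto intro: finite_set_replicate_pmf)
      have "?PP = bind_pmf (replicate_pmf n PX) (\<lambda>xs. map_pmf (\<lambda>ys. (ys, xs)) (replicate_pmf n PY))"
        unfolding pair_pmf_def map_pmf_def by (rule bind_commute_pmf)
      then have "measure ?PP {z. (fst z, enc n (snd z)) \<in> A n}
        = expect (replicate_pmf n PX) (\<lambda>xs. measure (map_pmf (\<lambda>ys. (ys, xs)) (replicate_pmf n PY)) {z. (fst z, enc n (snd z)) \<in> A n})"
        by (simp only:) (rule measure_bind_expect, use fin in auto)
      also have "\<dots> \<le> expect (replicate_pmf n PX) (\<lambda>_. exp (- (real n * (info_YU P W - \<delta>))))"
        by (rule expect_mono[OF fin(1)]) (use code n in \<open>auto simp: measure_map_pmf vimage_def\<close>)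
      finally show ?thesis by simp
    qed
    finally have "type2_error (QYs n) (QXs n) (s n) \<le> ?c * exp (- (real n * (info_YU P W - \<delta>)))" by simp
    also have "\<dots> = exp (- (real n * E))" by (simp add: exp_add[symmetric] E_def algebra_simps)
    finally show ?thesis .
  qed
  have c2: "ereal E \<le> liminf (\<lambda>n. error_exponent n (type2_error (QYs n) (QXs n) (s n)))"
    by (rule Liminf_bounded, rule eventually_mono[OF eventually_gt_at_top[of 0]])
      (intro error_exponent_ge type2, auto simp: type2_error_def)
  have "limsup (\<lambda>n. ereal (1 / real n * ln (real (card (messages (s n)))))) \<le> limsup (\<lambda>n. ereal (R + s' n))"
    by (rule Limsup_mono, rule eventually_mono[OF eventually_gt_at_top[of 0]]) (use s'(2) in \<open>auto simp: s_def\<close>)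
  also have "\<dots> = ereal R"
    using tendsto_add[OF tendsto_const[of R] s'(1)] by (intro lim_imp_Limsup) auto
  finally have c3: "limsup (\<lambda>n. ereal (1 / real n * ln (real (card (messages (s n)))))) \<le> ereal R" .
  show ?thesis unfolding achievable_def E_def[symmetric]
    using scheme c1 c2 c3 by blast
qed

section \<open>Converse\<close>

text \<open>A randomized test against Q is turned into a deterministic region against the product of
  the marginals. Accepting when the acceptance probability is at least \<tau> loses at most \<tau>
  of the mass under P and inflates the second error by at most 1/\<tau>. Untypical x-blocks are
  merged into the extra message \<open>None\<close>, whence the + 1. Of the two terms -ln \<tau> in
  the exponent, one comes from a \<ge> \<tau> and one from the threshold.\<close>

lemma converse_scheme:
  fixes P :: "('y::finite \<times> 'x::finite) pmf" and s :: "('y, 'x) test_scheme"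
  assumes n: "0 < n" and s: "is_test_scheme n s"
    and X: "log_ratio_rate (map_pmf snd P) QXs aX" and Y: "log_ratio_rate (map_pmf fst P) QYs aY"
    and \<tau>: "0 < \<tau>" and \<delta>: "0 < \<delta>"
    and err: "type1_error P n s + measure (replicate_pmf n (map_pmf snd P)) (- above_rate (map_pmf snd P) QXs (aX + \<delta>) n)
       + measure (replicate_pmf n (map_pmf fst P)) (- above_rate (map_pmf fst P) QYs (aY + \<delta>) n) \<le> 1 - 2 * \<tau>"
  shows "\<exists>v h hX hY. (v, h, hX, hY) \<in> info_hull P \<and>
    real n * (cross_entropy v (pmf P) - h) \<le> ln (real (card (messages s)) + 1) - ln \<tau> \<and>
    real n * (cross_entropy v (pmf P) - cross_entropy v (\<lambda>z. pmf (map_pmf snd P) (snd z)) - (h - hX)) \<le> - ln \<tau> \<and>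
    real n * (cross_entropy v (pmf P) - vec_entropy v) \<le> - ln \<tau> \<and>
    0 < type2_error (QYs n) (QXs n) s \<and>
    - ln (type2_error (QYs n) (QXs n) s)
      \<le> real n * (cross_entropy v (\<lambda>z. pmf (map_pmf fst P) (fst z)) - hY + aX + aY + 2 * \<delta>) - 2 * ln \<tau>"
proof -
  define PX where "PX = map_pmf snd P"
  define PY where "PY = map_pmf fst P"
  define tX where "tX = above_rate PX QXs (aX + \<delta>) n"
  define tY where "tY = above_rate PY QYs (aY + \<delta>) n"
  define \<phi> where "\<phi> xs = (if xs \<in> tX then Some (encoder s xs) else None)" for xs
  define M where "M = insert None (Some ` messages s)"
  define w where "w ys m = pmf (decider s ys m) False" for ys m
  define A where "A = {(ys, m'). ys \<in> tY \<and> (\<exists>m. m' = Some m \<and> \<tau> \<le> w ys m)}"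
  define acc where "acc = {zs. (map fst zs, \<phi> (map snd zs)) \<in> A}"
  define a where "a = measure (replicate_pmf n P) acc"
  define \<beta> where "\<beta> = measure (pair_pmf (replicate_pmf n PY) (map_pmf \<phi> (replicate_pmf n PX))) A"
  let ?R = "replicate_pmf n P"
  have finR: "finite (set_pmf ?R)" by (intro finite_set_replicate_pmf) simp
  have w01: "0 \<le> w ys m" "w ys m \<le> 1" for ys m by (auto simp: w_def pmf_le_1)
  \<comment> \<open>The hypothesis leaves acceptance probability at least 2 \<tau> after discarding
    untypical blocks, and thresholding removes at most \<tau> of it.\<close>
  have "\<tau> \<le> a"
  proof -
    have TF: "pmf b True = 1 - pmf b False" for b :: "bool pmf"
    proof -
      have "(\<Sum>x\<in>UNIV. pmf b x) = 1" by (rule sum_pmf_eq_1) auto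
      then show ?thesis by (simp add: UNIV_bool)
    qed
    have "1 - type1_error P n s = expect ?R (\<lambda>zs. w (map fst zs) (encoder s (map snd zs)))"
      unfolding type1_error_def w_def pmf_bind TF by simp
    also have "\<dots> \<le> expect ?R (\<lambda>zs. indicator acc zs + (\<tau> + (indicator (map snd -` (- tX)) zs + indicator (map fst -` (- tY)) zs)))"
    proof (rule expect_mono[OF finR])
      fix zs
      show "w (map fst zs) (encoder s (map snd zs))
        \<le> indicator acc zs + (\<tau> + (indicator (map snd -` (- tX)) zs + indicator (map fst -` (- tY)) zs))"
        using w01[of "map fst zs" "encoder s (map snd zs)"] \<tau>
        by (auto simp: indicator_def acc_def A_def \<phi>_def split: if_splits)
    qed
    also have "\<dots> = a + (\<tau> + (measure (replicate_pmf n PX) (- tX) + measure (replicate_pmf n PY) (- tY)))"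
      unfolding PX_def PY_def map_fst_replicate[symmetric] map_snd_replicate[symmetric] measure_map_pmf a_def
      by (subst expect_add[OF finR], subst expect_add[OF finR], subst expect_add[OF finR]) simp
    finally show ?thesis using err by (simp add: PX_def PY_def tX_def tY_def)
  qed
  then have a0: "0 < a" using \<tau> by simp
  have lna: "- ln a \<le> - ln \<tau>" using \<open>\<tau> \<le> a\<close> \<tau> by simp
  have fins: "finite (messages s)" and encs: "\<And>xs. length xs = n \<Longrightarrow> encoder s xs \<in> messages s"
    using s by (auto simp: is_test_scheme_def)
  have finM: "finite M" and \<phi>M: "\<phi> \<in> {xs. length xs = n} \<rightarrow> M"
    using fins encs by (auto simp: M_def \<phi>_def)
  have cardM: "real (card M) = real (card (messages s)) + 1"
    unfolding M_def using fins by (subst card_insert_disjoint) (auto simp: card_image)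
  obtain v h hX hY where k: "(v, h, hX, hY) \<in> info_hull P"
    "real n * (cross_entropy v (pmf P) - h) \<le> ln (real (card M)) - ln a"
    "real n * (cross_entropy v (pmf P) - cross_entropy v (\<lambda>z. pmf PX (snd z)) - (h - hX)) \<le> - ln a"
    "real n * (cross_entropy v (pmf P) - vec_entropy v) \<le> - ln a"
    "0 < \<beta>" "- ln \<beta> \<le> real n * (cross_entropy v (\<lambda>z. pmf PY (fst z)) - hY) - ln a"
    using converse_block[OF n finM \<phi>M a0 a_def[unfolded acc_def] \<beta>_def[unfolded PX_def PY_def], folded PX_def PY_def]
    by (elim exE conjE) (rule that)
  define \<beta>2 where "\<beta>2 = type2_error (QYs n) (QXs n) s"
  let ?c = "exp (real n * (aX + aY + 2 * \<delta>))"
  have \<beta>le: "\<beta> \<le> ?c / \<tau> * \<beta>2"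
  proof -
    let ?QQ = "pair_pmf (QYs n) (QXs n)"
    let ?PP = "pair_pmf (replicate_pmf n PY) (replicate_pmf n PX)"
    let ?S = "{z. (fst z, \<phi> (snd z)) \<in> A}"
    let ?w = "\<lambda>z. w (fst z) (encoder s (snd z))"
    have finQ: "finite (set_pmf ?QQ)"
      using X Y by (auto simp: log_ratio_rate_def intro!: finite_set_pmf_lists)
    have sub: "set_pmf ?PP \<subseteq> set_pmf ?QQ"
      using X Y by (auto simp: log_ratio_rate_def PX_def PY_def)
    then have finP: "finite (set_pmf ?PP)" using finQ finite_subset by blast
    have "map_pmf (\<lambda>z. (fst z, \<phi> (snd z))) ?PP = pair_pmf (replicate_pmf n PY) (map_pmf \<phi> (replicate_pmf n PX))"
      by (simp add: pair_map_pmf2 apsnd_def map_prod_def case_prod_unfold)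
    then have "\<beta> = measure (map_pmf (\<lambda>z. (fst z, \<phi> (snd z))) ?PP) A" by (simp add: \<beta>_def)
    also have "\<dots> = measure ?PP ?S" by (simp add: measure_map_pmf vimage_def)
    also have "\<dots> = (\<Sum>z\<in>set_pmf ?PP \<inter> ?S. pmf ?PP z)" by (rule measure_pmf_sum[OF finP])
    also have "\<dots> \<le> (\<Sum>z\<in>set_pmf ?PP \<inter> ?S. ?c / \<tau> * (pmf ?QQ z * ?w z))"
    proof (rule sum_mono)
      fix z assume "z \<in> set_pmf ?PP \<inter> ?S"
      moreover obtain ys xs where z: "z = (ys, xs)" by (cases z)
      ultimately have t: "ys \<in> tY" "xs \<in> tX" and wz: "\<tau> \<le> ?w z"
        by (auto simp: A_def \<phi>_def split: if_splits)
      have "pmf ?PP z = ?c * ((exp (- (real n * (aY + \<delta>))) * pmf (replicate_pmf n PY) ys) * (exp (- (real n * (aX + \<delta>))) * pmf (replicate_pmf n PX) xs))"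
      proof -
        have "?c * (exp (- (real n * (aY + \<delta>))) * exp (- (real n * (aX + \<delta>)))) = 1"
          by (simp add: exp_add[symmetric] algebra_simps)
        then have "(?c * (exp (- (real n * (aY + \<delta>))) * exp (- (real n * (aX + \<delta>))))) * pmf ?PP z = pmf ?PP z" by simp
        then show ?thesis by (simp add: z pmf_pair mult_ac)
      qed
      also have "\<dots> \<le> ?c * (pmf (QYs n) ys * pmf (QXs n) xs)"
        using t by (intro mult_left_mono mult_mono) (auto simp: tX_def tY_def above_rate_def)
      also have "\<dots> = ?c * pmf ?QQ z" by (simp add: z pmf_pair)
      also have "\<dots> \<le> ?c * pmf ?QQ z * (?w z / \<tau>)"
        using mult_left_mono[of 1 "?w z / \<tau>" "?c * pmf ?QQ z"] wz \<tau> by simp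
      finally show "pmf ?PP z \<le> ?c / \<tau> * (pmf ?QQ z * ?w z)" by (simp add: mult_ac)
    qed
    also have "\<dots> \<le> (\<Sum>z\<in>set_pmf ?QQ. ?c / \<tau> * (pmf ?QQ z * ?w z))"
      using finQ sub \<tau> w01 by (intro sum_mono2) auto
    also have "\<dots> = ?c / \<tau> * expect ?QQ ?w"
      by (simp add: expect_sum[OF finQ subset_refl] sum_distrib_left)
    also have "expect ?QQ ?w = \<beta>2"
      by (simp add: \<beta>2_def type2_error_def pmf_bind w_def case_prod_unfold)
    finally show ?thesis .
  qed
  have "0 < ?c / \<tau> * \<beta>2" using k(5) \<beta>le by linarith
  then have \<beta>2: "0 < \<beta>2" using \<tau> by (simp add: zero_less_mult_iff zero_less_divide_iff)
  have "ln \<beta> \<le> ln (?c / \<tau> * \<beta>2)" using k(5) \<beta>le by (intro ln_mono) auto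
  also have "\<dots> = real n * (aX + aY + 2 * \<delta>) - ln \<tau> + ln \<beta>2"
    using \<tau> \<beta>2 by (simp add: ln_mult ln_div)
  finally have "- ln \<beta>2 \<le> - ln \<beta> + real n * (aX + aY + 2 * \<delta>) - ln \<tau>" by simp
  then have "- ln \<beta>2 \<le> real n * (cross_entropy v (\<lambda>z. pmf PY (fst z)) - hY) + real n * (aX + aY + 2 * \<delta>) - 2 * ln \<tau>"
    using k(6) lna by linarith
  also have "\<dots> = real n * (cross_entropy v (\<lambda>z. pmf PY (fst z)) - hY + aX + aY + 2 * \<delta>) - 2 * ln \<tau>"
    by (simp add: algebra_simps)
  finally have last: "- ln \<beta>2 \<le> real n * (cross_entropy v (\<lambda>z. pmf PY (fst z)) - hY + aX + aY + 2 * \<delta>) - 2 * ln \<tau>" .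
  show ?thesis
    unfolding PX_def[symmetric] PY_def[symmetric] \<beta>2_def[symmetric]
    by (intro exI conjI, rule k(1), rule order_trans[OF k(2)], (use lna cardM in simp),
        rule order_trans[OF k(3) lna], rule order_trans[OF k(4) lna], rule \<beta>2, rule last)
qed

text \<open>The conclusions of the block converse divided by n, with slack \<delta>. Cross entropies
  stand where \<open>info_region\<close> has entropies, since v is not yet P; the third condition is
  D(v || P) \<le> \<delta>.\<close>

definition relaxed_region :: "('y::finite \<times> 'x::finite) pmf \<Rightarrow> real \<Rightarrow> real \<Rightarrow> real
    \<Rightarrow> ((real ^ ('y \<times> 'x)) \<times> real \<times> real \<times> real) set" where
  "relaxed_region P R G \<delta> = {(v, h, hX, hY) \<in> info_hull P.
     cross_entropy v (pmf P) - h \<le> R + \<delta> \<and>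
     cross_entropy v (pmf P) - cross_entropy v (\<lambda>z. pmf (map_pmf snd P) (snd z)) - (h - hX) \<le> \<delta> \<and>
     cross_entropy v (pmf P) - vec_entropy v \<le> \<delta> \<and>
     G - \<delta> \<le> cross_entropy v (\<lambda>z. pmf (map_pmf fst P) (fst z)) - hY}"

lemma info_hull_fst_pmf:
  fixes P :: "('y::finite \<times> 'x::finite) pmf"
  assumes "(v, h, hX, hY) \<in> info_hull P"
  shows "\<exists>r. set_pmf r \<subseteq> set_pmf P \<and> v = (\<chi> z. pmf r z)"
proof -
  obtain q :: "nat pmf" and r where r: "\<And>i. i \<in> set_pmf q \<Longrightarrow> set_pmf (r i) \<subseteq> set_pmf P"
    and v: "\<And>z. v $ z = expect q (\<lambda>i. pmf (r i) z)"
    by (rule info_hull_explicit[OF assms]) (rule that, assumption+)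
  have "set_pmf (bind_pmf q r) \<subseteq> set_pmf P" using r by auto
  moreover have "v = (\<chi> z. pmf (bind_pmf q r) z)" by (simp add: vec_eq_iff v pmf_bind)
  ultimately show ?thesis by blast
qed

lemma compact_relaxed_region:
  fixes P :: "('y::finite \<times> 'x::finite) pmf"
  shows "compact (relaxed_region P R G \<delta>)"
proof -
  let ?H = "info_hull P"
  let ?S = "\<lambda>f (k :: (real ^ ('y \<times> 'x)) \<times> real \<times> real \<times> real). \<Sum>z\<in>UNIV. fst k $ z * - ln (f z)"
  \<comment> \<open>Continuity of \<open>vec_entropy\<close> is available on nonnegative vectors, so
    the letter component of the hull has to be recognised as a probability vector.\<close>
  have nn: "0 \<le> fst k $ z" if "k \<in> ?H" for k z
    using info_hull_fst_pmf[of "fst k" "fst (snd k)" "fst (snd (snd k))" "snd (snd (snd k))" P] that by auto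
  have cS: "continuous_on ?H (?S f)" for f by (intro continuous_intros)
  have cV: "continuous_on ?H (\<lambda>k. vec_entropy (fst k))"
    by (rule continuous_on_vec_entropy) (use nn in \<open>auto intro!: continuous_intros\<close>)
  have cH: "closed ?H" using compact_info_hull compact_imp_closed by blast
  have eq: "relaxed_region P R G \<delta> =
      {k \<in> ?H. ?S (pmf P) k - fst (snd k) \<le> R + \<delta>} \<inter>
      ({k \<in> ?H. ?S (pmf P) k - ?S (\<lambda>z. pmf (map_pmf snd P) (snd z)) k - (fst (snd k) - fst (snd (snd k))) \<le> \<delta>} \<inter>
      ({k \<in> ?H. ?S (pmf P) k - vec_entropy (fst k) \<le> \<delta>} \<inter>
      {k \<in> ?H. G - \<delta> \<le> ?S (\<lambda>z. pmf (map_pmf fst P) (fst z)) k - snd (snd (snd k))}))"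
    unfolding relaxed_region_def by auto
  have "closed (relaxed_region P R G \<delta>)"
    unfolding eq
    by (intro closed_Int continuous_on_closed_Collect_le cH continuous_on_diff cS cV) (intro continuous_intros)+
  moreover have "relaxed_region P R G \<delta> \<subseteq> ?H" by (auto simp: relaxed_region_def)
  ultimately show ?thesis using compact_info_hull[of P] compact_Int_closed[of ?H "relaxed_region P R G \<delta>"]
    by (simp add: Int_absorb1)
qed

text \<open>The relaxed regions are compact and shrink with \<delta>, so they have a common point.
  There D(v || P) \<le> 0, hence v = P by the equality case of Gibbs, and the cross entropies
  against P and its marginals become entropies.\<close>

lemma info_region_of_relaxed:
  fixes P :: "('y::finite \<times> 'x::finite) pmf"
  assumes ne: "\<And>\<delta>. 0 < \<delta> \<Longrightarrow> relaxed_region P R G \<delta> \<noteq> {}"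
  shows "\<exists>v h hX hY. (v, h, hX, hY) \<in> info_region P R \<and> G \<le> pmf_entropy (map_pmf fst P) - hY"
proof -
  have mono: "relaxed_region P R G \<delta> \<subseteq> relaxed_region P R G \<delta>'" if "\<delta> \<le> \<delta>'" for \<delta> \<delta>'
    using that by (auto simp: relaxed_region_def)
  have "\<Inter>(range (\<lambda>n. relaxed_region P R G (1 / real (Suc n)))) \<noteq> {}"
    by (rule compact_nest) (use compact_relaxed_region ne in \<open>auto intro!: mono simp: frac_le\<close>)
  then obtain k where "k \<in> \<Inter>(range (\<lambda>n. relaxed_region P R G (1 / real (Suc n))))" by blast
  then have k: "k \<in> relaxed_region P R G (1 / real (Suc n))" for n by blast
  obtain v h hX hY where kv: "k = (v, h, hX, hY)" by (cases k)
  have all: "(v, h, hX, hY) \<in> relaxed_region P R G \<delta>" if \<delta>: "0 < \<delta>" for \<delta>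
  proof -
    obtain n where "1 / real (Suc n) < \<delta>" using nat_approx_posE[OF \<delta>] by blast
    then show ?thesis using k[of n] mono[of "1 / real (Suc n)" \<delta>] by (auto simp: kv)
  qed
  have hull: "(v, h, hX, hY) \<in> info_hull P" using all[of 1] by (simp add: relaxed_region_def)
  let ?S = "\<lambda>f. \<Sum>z\<in>UNIV. v $ z * - ln (f z)"
  have i1: "?S (pmf P) - h \<le> R"
    by (rule field_le_epsilon) (use all in \<open>auto simp: relaxed_region_def\<close>)
  have i2: "?S (pmf P) - ?S (\<lambda>z. pmf (map_pmf snd P) (snd z)) - (h - hX) \<le> 0"
    by (rule field_le_epsilon) (use all in \<open>auto simp: relaxed_region_def\<close>)
  have i3: "?S (pmf P) - vec_entropy v \<le> 0"
    by (rule field_le_epsilon) (use all in \<open>auto simp: relaxed_region_def\<close>)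
  have i4: "G \<le> ?S (\<lambda>z. pmf (map_pmf fst P) (fst z)) - hY"
    by (rule field_le_epsilon) (use all in \<open>auto simp: relaxed_region_def algebra_simps\<close>)
  obtain r where r: "set_pmf r \<subseteq> set_pmf P" "v = (\<chi> z. pmf r z)"
    using info_hull_fst_pmf[OF hull] by blast
  have S: "?S f = expect r (\<lambda>z. - ln (f z))" for f
    by (simp add: expect_sum[of UNIV] r(2) sum_negf)
  have rP: "r = P"
  proof (rule gibbs_pmf_eq)
    show "expect r (\<lambda>x. - ln (pmf P x)) \<le> pmf_entropy r"
      using i3 S[of "pmf P"] pmf_entropy_vec[of r] by (simp add: r(2))
  qed (use r(1) in auto)
  have "?S (pmf P) = pmf_entropy P" by (simp only: S rP pmf_entropy_def)
  moreover have "?S (\<lambda>z. pmf (map_pmf snd P) (snd z)) = pmf_entropy (map_pmf snd P)"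
    by (simp only: S rP pmf_entropy_map)
  moreover have "?S (\<lambda>z. pmf (map_pmf fst P) (fst z)) = pmf_entropy (map_pmf fst P)"
    by (simp only: S rP pmf_entropy_map)
  ultimately show ?thesis using hull i1 i2 i4 r(2) rP
    by (intro exI[of _ v] exI[of _ h] exI[of _ hX] exI[of _ hY]) (simp add: info_region_def)
qed

lemma achievable_le:
  fixes P :: "('y::finite \<times> 'x::finite) pmf"
  assumes ach: "achievable P QYs QXs \<epsilon> R E" and \<epsilon>: "\<epsilon> < 1"
    and X: "log_ratio_rate (map_pmf snd P) QXs aX" and Y: "log_ratio_rate (map_pmf fst P) QYs aY"
  shows "\<exists>v h hX hY. (v, h, hX, hY) \<in> info_region P R \<and> E - aX - aY \<le> pmf_entropy (map_pmf fst P) - hY"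
proof (rule info_region_of_relaxed)
  fix \<delta>' :: real assume \<delta>': "0 < \<delta>'"
  \<comment> \<open>In the exponent one quarter is the margin below the liminf, two are spent on the
    likelihood ratios, and one absorbs the constants divided by n.\<close>
  define \<delta> where "\<delta> = \<delta>' / 4"
  have \<delta>: "0 < \<delta>" using \<delta>' by (simp add: \<delta>_def)
  obtain s :: "nat \<Rightarrow> ('y, 'x) test_scheme" where s: "\<And>n. is_test_scheme n (s n)"
    and t1: "limsup (\<lambda>n. ereal (type1_error P n (s n))) \<le> ereal \<epsilon>"
    and t2: "ereal E \<le> liminf (\<lambda>n. error_exponent n (type2_error (QYs n) (QXs n) (s n)))"
    and t3: "limsup (\<lambda>n. ereal (1 / real n * ln (real (card (messages (s n)))))) \<le> ereal R"
    using ach unfolding achievable_def by blast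
  \<comment> \<open>Thus \<epsilon> = 1 - 5 \<tau>: a margin \<tau> for the first error and \<tau>
    for each of the two untypical sets bring the sum to 1 - 2 \<tau>, as
    \<open>converse_scheme\<close> asks.\<close>
  define \<tau> where "\<tau> = (1 - \<epsilon>) / 5"
  have \<tau>: "0 < \<tau>" using \<epsilon> by (simp add: \<tau>_def)
  \<comment> \<open>Dominates ln 2 - ln \<tau>, -ln \<tau> and -2 ln \<tau>, the constants of the
    four bounds; the absolute value is there because \<epsilon> < 1 does not fix the sign of ln
    \<tau>.\<close>
  define c where "c = ln 2 - 2 * ln \<tau> + \<bar>ln \<tau>\<bar> + 1"
  have "limsup (\<lambda>n. ereal (type1_error P n (s n))) < ereal (\<epsilon> + \<tau>)"
    using t1 by (rule order_le_less_trans) (use \<tau> in simp)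
  then have e1: "\<forall>\<^sub>F n in sequentially. type1_error P n (s n) < \<epsilon> + \<tau>"
    by (auto dest!: Limsup_lessD)
  have "ereal (E - \<delta>) < liminf (\<lambda>n. error_exponent n (type2_error (QYs n) (QXs n) (s n)))"
    by (rule order_less_le_trans[OF _ t2]) (use \<delta> in simp)
  then have e2: "\<forall>\<^sub>F n in sequentially. ereal (E - \<delta>) < error_exponent n (type2_error (QYs n) (QXs n) (s n))"
    by (rule less_LiminfD)
  have "limsup (\<lambda>n. ereal (1 / real n * ln (real (card (messages (s n)))))) < ereal (R + \<delta>)"
    using t3 by (rule order_le_less_trans) (use \<delta> in simp)
  then have e3: "\<forall>\<^sub>F n in sequentially. 1 / real n * ln (real (card (messages (s n)))) < R + \<delta>"
    by (auto dest!: Limsup_lessD)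
  have e4: "\<forall>\<^sub>F n in sequentially. measure (replicate_pmf n (map_pmf snd P)) (- above_rate (map_pmf snd P) QXs (aX + \<delta>) n) < \<tau>"
    by (rule order_tendstoD(2)[OF above_rate_negligible[OF X]]) (use \<tau> \<delta> in auto)
  have e5: "\<forall>\<^sub>F n in sequentially. measure (replicate_pmf n (map_pmf fst P)) (- above_rate (map_pmf fst P) QYs (aY + \<delta>) n) < \<tau>"
    by (rule order_tendstoD(2)[OF above_rate_negligible[OF Y]]) (use \<tau> \<delta> in auto)
  have "(\<lambda>n. c * inverse (real n)) \<longlonglongrightarrow> c * 0" by (intro tendsto_mult tendsto_const lim_inverse_n)
  then have e6: "\<forall>\<^sub>F n in sequentially. c * inverse (real n) < \<delta>"
    by (rule order_tendstoD(2)) (use \<delta> in simp)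
  have "\<forall>\<^sub>F n in sequentially. relaxed_region P R (E - aX - aY) \<delta>' \<noteq> {}"
    using e1 e2 e3 e4 e5 e6 eventually_gt_at_top[of 0]
  proof eventually_elim
    case (elim n)
    have err: "type1_error P n (s n) + measure (replicate_pmf n (map_pmf snd P)) (- above_rate (map_pmf snd P) QXs (aX + \<delta>) n)
       + measure (replicate_pmf n (map_pmf fst P)) (- above_rate (map_pmf fst P) QYs (aY + \<delta>) n) \<le> 1 - 2 * \<tau>"
      using elim(1,4,5) by (simp add: \<tau>_def field_simps)
    obtain v h hX hY where k: "(v, h, hX, hY) \<in> info_hull P"
      "real n * (cross_entropy v (pmf P) - h) \<le> ln (real (card (messages (s n))) + 1) - ln \<tau>"
      "real n * (cross_entropy v (pmf P) - cross_entropy v (\<lambda>z. pmf (map_pmf snd P) (snd z)) - (h - hX)) \<le> - ln \<tau>"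
      "real n * (cross_entropy v (pmf P) - vec_entropy v) \<le> - ln \<tau>"
      "0 < type2_error (QYs n) (QXs n) (s n)"
      "- ln (type2_error (QYs n) (QXs n) (s n))
        \<le> real n * (cross_entropy v (\<lambda>z. pmf (map_pmf fst P) (fst z)) - hY + aX + aY + 2 * \<delta>) - 2 * ln \<tau>"
      using converse_scheme[OF elim(7) s X Y \<tau> \<delta> err] by (elim exE conjE) (rule that)
    have n: "0 < real n" using elim(7) by simp
    have c: "c < real n * \<delta>" using elim(6) n by (simp add: field_simps)
    have ln2: "0 < ln (2::real)" by simp
    have div: "x \<le> y" if "real n * x \<le> real n * y" for x y using that n by simp
    have "encoder (s n) (replicate n undefined) \<in> messages (s n)" "finite (messages (s n))"
      using s[of n] by (auto simp: is_test_scheme_def)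
    then have card: "1 \<le> real (card (messages (s n)))"
      by (metis One_nat_def Suc_leI card_gt_0_iff empty_iff of_nat_1 of_nat_mono)
    have "ln (real (card (messages (s n))) + 1) \<le> ln (2 * real (card (messages (s n))))"
      using card by (intro ln_mono) auto
    also have "\<dots> = ln 2 + ln (real (card (messages (s n))))" using card by (subst ln_mult_pos) auto
    also have "ln (real (card (messages (s n)))) \<le> real n * (R + \<delta>)"
      using elim(3) n by (simp add: field_simps)
    finally have lnM: "ln (real (card (messages (s n))) + 1) \<le> ln 2 + real n * (R + \<delta>)" by simp
    have "1 / real n * ln (1 / type2_error (QYs n) (QXs n) (s n)) > E - \<delta>"
      using elim(2) k(5) by (simp add: error_exponent_def)
    then have "real n * (E - \<delta>) < - ln (type2_error (QYs n) (QXs n) (s n))"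
      using n k(5) by (simp add: field_simps ln_div)
    with k(6) have k6: "real n * (E - \<delta>) \<le> real n * (cross_entropy v (\<lambda>z. pmf (map_pmf fst P) (fst z)) - hY + aX + aY + 2 * \<delta>) - 2 * ln \<tau>"
      by linarith
    have d: "real n * \<delta>' = 4 * (real n * \<delta>)" and nd: "0 < real n * \<delta>" using n \<delta> by (auto simp: \<delta>_def)
    have "(v, h, hX, hY) \<in> relaxed_region P R (E - aX - aY) \<delta>'"
      unfolding relaxed_region_def
    proof (intro CollectI case_prodI conjI k(1))
      show "cross_entropy v (pmf P) - h \<le> R + \<delta>'"
        by (rule div, rule order_trans[OF k(2)]) (use lnM c d ln2 nd in \<open>unfold c_def distrib_left, linarith\<close>)
      show "cross_entropy v (pmf P) - cross_entropy v (\<lambda>z. pmf (map_pmf snd P) (snd z)) - (h - hX) \<le> \<delta>'"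
        by (rule div, rule order_trans[OF k(3)]) (use c d ln2 nd in \<open>unfold c_def, linarith\<close>)
      show "cross_entropy v (pmf P) - vec_entropy v \<le> \<delta>'"
        by (rule div, rule order_trans[OF k(4)]) (use c d ln2 nd in \<open>unfold c_def, linarith\<close>)
      have "real n * (E - \<delta>) \<le> real n * (cross_entropy v (\<lambda>z. pmf (map_pmf fst P) (fst z)) - hY + aX + aY + 2 * \<delta>) + real n * \<delta>"
        using k6 c ln2 unfolding c_def by linarith
      also have "\<dots> = real n * (cross_entropy v (\<lambda>z. pmf (map_pmf fst P) (fst z)) - hY + aX + aY + 3 * \<delta>)"
        by (simp add: distrib_left)
      finally have "E - \<delta> \<le> cross_entropy v (\<lambda>z. pmf (map_pmf fst P) (fst z)) - hY + aX + aY + 3 * \<delta>"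
        by (rule div)
      then show "E - aX - aY - \<delta>' \<le> cross_entropy v (\<lambda>z. pmf (map_pmf fst P) (fst z)) - hY"
        by (simp add: \<delta>_def)
    qed
    then show ?case by blast
  qed
  then show "relaxed_region P R (E - aX - aY) \<delta>' \<noteq> {}" by simp
qed

theorem theorem7:
  fixes P :: "('y::finite \<times> 'x::finite) pmf"
    and QYs :: "nat \<Rightarrow> 'y list pmf"
    and QXs :: "nat \<Rightarrow> 'x list pmf"
    and d :: ereal
    and R :: real
  assumes alt: "product_alternative P QYs QXs d \<or> markov_alternative P QYs QXs d"
    and rate: "0 \<le> R"
  shows "\<exists>W. is_arg_max (info_YU P) (feasible_channel P R) W \<and>
             (\<forall>\<epsilon>\<in>{0..<1}. max_exponent P QYs QXs \<epsilon> R = ereal (info_YU P W) + d)"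
proof -
  obtain aX aY where d: "d = ereal (aX + aY)" and X: "log_ratio_rate (map_pmf snd P) QXs aX"
    and Y: "log_ratio_rate (map_pmf fst P) QYs aY"
    using alternative_rates[OF alt] by blast
  obtain W where W: "is_arg_max (info_YU P) (feasible_channel P R) W"
    and max: "\<And>v h hX hY. (v, h, hX, hY) \<in> info_region P R \<Longrightarrow> pmf_entropy (map_pmf fst P) - hY \<le> info_YU P W"
    using ex_max_channel[OF rate] by blast
  have feas: "feasible_channel P R W" using W by (simp add: is_arg_max_def)
  have "max_exponent P QYs QXs \<epsilon> R = ereal (info_YU P W) + d" if \<epsilon>: "\<epsilon> \<in> {0..<1}" for \<epsilon>
  proof (rule antisym)
    show "max_exponent P QYs QXs \<epsilon> R \<le> ereal (info_YU P W) + d"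
      unfolding max_exponent_def
    proof (rule Sup_least)
      fix t assume "t \<in> {ereal E | E. achievable P QYs QXs \<epsilon> R E}"
      then obtain E where t: "t = ereal E" and E: "achievable P QYs QXs \<epsilon> R E" by blast
      obtain v h hX hY where "(v, h, hX, hY) \<in> info_region P R" "E - aX - aY \<le> pmf_entropy (map_pmf fst P) - hY"
        using achievable_le[OF E _ X Y] \<epsilon> by auto
      then have "E \<le> info_YU P W + (aX + aY)" using max by fastforce
      then show "t \<le> ereal (info_YU P W) + d" by (simp add: t d)
    qed
    show "ereal (info_YU P W) + d \<le> max_exponent P QYs QXs \<epsilon> R"
    proof (rule ereal_le_epsilon2)
      fix \<delta> :: real assume \<delta>: "0 < \<delta>"
      have "achievable P QYs QXs \<epsilon> R (info_YU P W + aX + aY - 3 * (\<delta> / 3))"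
        by (rule achievable_of_channel[OF feas rate _ _ X Y]) (use \<delta> \<epsilon> in auto)
      then have "ereal (info_YU P W + aX + aY - \<delta>) \<le> max_exponent P QYs QXs \<epsilon> R"
        unfolding max_exponent_def by (intro Sup_upper) auto
      then have "ereal (info_YU P W + aX + aY - \<delta>) + ereal \<delta> \<le> max_exponent P QYs QXs \<epsilon> R + ereal \<delta>"
        by (rule add_right_mono)
      then show "ereal (info_YU P W) + d \<le> max_exponent P QYs QXs \<epsilon> R + ereal \<delta>"
        by (simp add: d add.assoc)
    qed
  qed
  then show ?thesis using W by blast
qed

end
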